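(* Let $(\Pi,c)$ be a complete, separable, locally compact semimetric space such that $c$ is jointly (sequentially) continuous and, for some $B\ge 1$, $c(x,y)\le B[c(x,z)+c(z,y)]$ for all $x,y,z\in\Pi$. Let $T>0$ and let $\boldsymbol{\mathcal A}=\{\mathcal A_t\}_{t\in[0,T]}$ be an $\mathrm{Exp}_c$-continuous curve of generators in $\mathcal G_c^0(\Pi)$. Then for any $\rho_0\in\mathcal P_c(\Pi)$ there exists a unique $\rho\in C([0,T];\mathcal P_c(\Pi))$ such that the following holds: for every piecewise constant approximating sequence $\{\boldsymbol{\mathcal A}^{(n)}\}_n$ of $\boldsymbol{\mathcal A}$, the curves $\rho^{(n)}:=\mathbb S_0(\rho_0;\boldsymbol{\mathcal A}^{(n)})$ converge to $\rho$ in the sense that $$\lim_{n\to\infty}\sup_{t\in[0,T]}\mathcal C_c(\rho_t,\rho_t^{(n)})=0.$$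
   Context: A semimetric on a set $\Pi$ is a map $c:\Pi\times\Pi\to[0,\infty)$ with $c(x,y)=c(y,x)$ and $c(x,y)=0$ iff $x=y$; $x_n\to x$ means $c(x_n,x)\to0$, and $\Pi$ carries the topology generated by the balls $\{y:c(x,y)<r\}$. Complete: every sequence with $\lim_n\sup_{m\ge n}c(x_n,x_m)=0$ converges. Continuity of $c$: $x_n\to x$, $y_n\to y$ imply $c(x_n,y_n)\to c(x,y)$. $\mathcal P(\Pi)$: Borel probability measures; $\langle\mu,\phi\rangle=\int\phi\,d\mu$. $\mathcal C_c(\mu,\nu)=\inf_\gamma\int c\,d\gamma$ over couplings $\gamma$ of $\mu,\nu$. $\mathcal P_c(\Pi)$: those $\mu\in\mathcal P(\Pi)$ with $\int c(z,x)\,d\mu(x)<\infty$ for some (equivalently all) $z$. $C([0,T];\mathcal P_c(\Pi))$: curves $\rho:[0,T]\to\mathcal P_c(\Pi)$ with $\lim_{s\to t}\mathcal C_c(\rho_t,\rho_s)=0$ for all $t$. A probability semigroup is a family $T_t\phi(x)=\int\phi(y)\,\kappa_t(x,dy)$, $t\ge0$, with $\kappa_t(x,\cdot)\in\mathcal P(\Pi)$ weakly continuous in $x$, $T_t$ preserving $C_0(\Pi)$ (continuous functions vanishing at infinity), $T_0=I$, $T_{t+s}=T_tT_s$, $\|T_t\phi-\phi\|_\infty\to0$ as $t\searrow0$ for $\phi\in C_0(\Pi)$. Its generator $\mathcal A\phi=\lim_{t\searrow0}(T_t\phi-\phi)/t$ (uniform limit) has domain $D(\mathcal A)\subset C_0(\Pi)$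 where the limit exists; write $T_t=e^{t\mathcal A}$, and $\mu e^{t\mathcal A}$ for the measure with $\langle\mu e^{t\mathcal A},\phi\rangle=\langle\mu,e^{t\mathcal A}\phi\rangle$. $\mathcal G_c^0(\Pi)$: generators $\mathcal A$ such that for all $\mu\in\mathcal P_c(\Pi)$, $\mu e^{t\mathcal A}\in\mathcal P_c(\Pi)$ for all $t$ and $t\mapsto\mu e^{t\mathcal A}$ is $\mathcal C_c$-continuous. For $\mathcal A,\mathcal B\in\mathcal G_c^0(\Pi)$, $\omega_c(\mu,\nu;\mathcal A,\mathcal B)=\limsup_{t\searrow0}\frac1t[\mathcal C_c(\mu e^{t\mathcal A},\nu e^{t\mathcal B})-\mathcal C_c(\mu,\nu)]$. $\mathrm{Exp}_c$-continuity: $\{\mathcal A_t\}_{t\in[0,T]}$ is $\mathrm{Exp}_c$-continuous if $\mathcal A_t\in\mathcal G_c^0(\Pi)$ for all $t$ and there is $\beta\ge0$ such that for every $\varepsilon>0$ there is $\delta>0$ with: $|t-s|<\delta$ implies $\omega_c(\mu,\nu;\mathcal A_t,\mathcal A_s)\le\varepsilon+\beta\,\mathcal C_c(\mu,\nu)$ for all $\mu,\nu\in\mathcal P_c(\Pi)$. Piecewise constant curves and $\mathbb S_0$: a curve $\boldsymbol{\mathcal A}:[0,T]\to\mathcal G_c^0(\Pi)$ is (right-continuous) piecewise constant if there is a partition $0=t_0<\dots<t_K=T$ with $\mathcal A$ constant on each $[t_{k-1},t_k)$. For such a curve, $\mathbb S_0(\rho_0;\boldsymbol{\mathcal A})\in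 C([0,T];\mathcal P_c(\Pi))$ is the unique strong dual solution of $\partial_t\rho_t=\rho_t\mathcal A_t$ with initial value $\rho_0$, i.e. the curve with $\lim_{h\searrow0}\frac1h(\langle\rho_{t+h},\phi\rangle-\langle\rho_t,\phi\rangle)=\langle\rho_t,\mathcal A_t\phi\rangle$ for all $t\in(0,T)$, $\phi\in D(\mathcal A_t)$; explicitly $\rho_t=\rho_{t_{k-1}}e^{(t-t_{k-1})\mathcal A(t_{k-1})}$ for $t\in[t_{k-1},t_k]$. Piecewise constant approximating sequence: for a partition $\Delta=\{0=t_0<\dots<t_n=T\}$ let $\mathcal A^\Delta(t)=\mathcal A(t_k)$ for $t\in[t_{k-1},t_k)$ (the value at $t=T$ is immaterial) and $\mathrm{mesh}(\Delta)=\max_k|t_k-t_{k-1}|$. A piecewise constant approximating sequence of $\boldsymbol{\mathcal A}$ is $\boldsymbol{\mathcal A}^{(n)}=\boldsymbol{\mathcal A}^{\Delta_n}$ with $\mathrm{mesh}(\Delta_n)\to0$. *)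

theory Defs
  imports "HOL-Probability.Probability"
begin

section \<open>Semimetric spaces\<close>

text \<open>
  The space is the whole of a type \<open>'a\<close> of class \<open>topological_space\<close>; the predicate
  \<open>semimetric_topology\<close> forces the class topology to be the one generated by the balls of \<open>c\<close>, so
  that \<open>borel\<close>, \<open>compact\<close>, \<open>continuous_on\<close> refer to \<open>c\<close>.
\<close>

definition semimetric :: "('a \<Rightarrow> 'a \<Rightarrow> real) \<Rightarrow> bool" where
  "semimetric c \<longleftrightarrow> (\<forall>x y. 0 \<le> c x y \<and> c x y = c y x \<and> (c x y = 0 \<longleftrightarrow> x = y))"

definition semimetric_topology :: "('a::topological_space \<Rightarrow> 'a \<Rightarrow> real) \<Rightarrow> bool" where
  "semimetric_topology c \<longleftrightarrow>
     (\<forall>U. open U \<longleftrightarrow> generate_topology {{y. c x y < r} | x r. r > 0} U)"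

definition semimetric_complete :: "('a \<Rightarrow> 'a \<Rightarrow> real) \<Rightarrow> bool" where
  "semimetric_complete c \<longleftrightarrow>
     (\<forall>x :: nat \<Rightarrow> 'a. (\<lambda>n. SUP m\<in>{n..}. ennreal (c (x n) (x m))) \<longlonglongrightarrow> 0
        \<longrightarrow> (\<exists>l. (\<lambda>n. c (x n) l) \<longlonglongrightarrow> 0))"

definition semimetric_continuous :: "('a \<Rightarrow> 'a \<Rightarrow> real) \<Rightarrow> bool" where
  "semimetric_continuous c \<longleftrightarrow>
     (\<forall>(x :: nat \<Rightarrow> 'a) (y :: nat \<Rightarrow> 'a) a b.
        (\<lambda>n. c (x n) a) \<longlonglongrightarrow> 0 \<longrightarrow> (\<lambda>n. c (y n) b) \<longlonglongrightarrow> 0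
        \<longrightarrow> (\<lambda>n. c (x n) (y n)) \<longlonglongrightarrow> c a b)"


section \<open>Probability measures and transport cost\<close>

definition borel_probs :: "'a::topological_space measure set" where
  "borel_probs = {\<mu>. prob_space \<mu> \<and> sets \<mu> = sets borel}"

definition couplings ::
  "'a::topological_space measure \<Rightarrow> 'a measure \<Rightarrow> ('a \<times> 'a) measure set" where
  "couplings \<mu> \<nu> = {\<gamma> \<in> borel_probs. distr \<gamma> borel fst = \<mu> \<and> distr \<gamma> borel snd = \<nu>}"

definition transport_cost ::
  "('a::topological_space \<Rightarrow> 'a \<Rightarrow> real) \<Rightarrow> 'a measure \<Rightarrow> 'a measure \<Rightarrow> ennreal" where
  "transport_cost c \<mu> \<nu> = (INF \<gamma>\<in>couplings \<mu> \<nu>. \<integral>\<^sup>+ z. ennreal (c (fst z) (snd z)) \<partial>\<gamma>)"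

definition probs_c ::
  "('a::topological_space \<Rightarrow> 'a \<Rightarrow> real) \<Rightarrow> 'a measure set" where
  "probs_c c = {\<mu> \<in> borel_probs. \<exists>z. (\<integral>\<^sup>+ x. ennreal (c z x) \<partial>\<mu>) < \<infinity>}"

text \<open>Curves on \<open>[0,T]\<close> are extensional functions (\<open>undefined\<close> off \<open>[0,T]\<close>), so that two curves
  are equal iff they agree on \<open>[0,T]\<close>.\<close>

definition curves_c ::
  "('a::topological_space \<Rightarrow> 'a \<Rightarrow> real) \<Rightarrow> real \<Rightarrow> (real \<Rightarrow> 'a measure) set" where
  "curves_c c T = {\<rho> \<in> {0..T} \<rightarrow>\<^sub>E probs_c c.
     \<forall>t\<in>{0..T}. ((\<lambda>s. transport_cost c (\<rho> t) (\<rho> s)) \<longlongrightarrow> 0) (at t within {0..T})}"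


section \<open>Probability semigroups and generators\<close>

definition C0 :: "('a::topological_space \<Rightarrow> real) set" where
  "C0 = {\<phi>. continuous_on UNIV \<phi> \<and> (\<forall>\<epsilon>>0. \<exists>K. compact K \<and> (\<forall>x. x \<notin> K \<longrightarrow> \<bar>\<phi> x\<bar> < \<epsilon>))}"

definition kernel_op ::
  "(real \<Rightarrow> 'a \<Rightarrow> 'a measure) \<Rightarrow> real \<Rightarrow> ('a \<Rightarrow> real) \<Rightarrow> 'a \<Rightarrow> real" where
  "kernel_op \<kappa> t \<phi> = (\<lambda>x. \<integral>y. \<phi> y \<partial>(\<kappa> t x))"

text \<open>Weak continuity of the kernels means that the operators map bounded continuous functions to
  (bounded) continuous functions; \<open>T\<^sub>0 = I\<close> and the semigroup law are identities between operators on
  this function space. Only times \<open>t \<ge> 0\<close> are relevant.\<close>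

definition probability_semigroup :: "(real \<Rightarrow> 'a::topological_space \<Rightarrow> 'a measure) \<Rightarrow> bool" where
  "probability_semigroup \<kappa> \<longleftrightarrow>
     (\<forall>t\<ge>0. \<forall>x. \<kappa> t x \<in> borel_probs) \<and>
     (\<forall>t\<ge>0. \<forall>\<phi>\<in>bcontfun. continuous_on UNIV (kernel_op \<kappa> t \<phi>)) \<and>
     (\<forall>t\<ge>0. \<forall>\<phi>\<in>C0. kernel_op \<kappa> t \<phi> \<in> C0) \<and>
     (\<forall>\<phi>\<in>bcontfun. kernel_op \<kappa> 0 \<phi> = \<phi>) \<and>
     (\<forall>t\<ge>0. \<forall>s\<ge>0. \<forall>\<phi>\<in>bcontfun. kernel_op \<kappa> (t + s) \<phi> = kernel_op \<kappa> t (kernel_op \<kappa> s \<phi>)) \<and>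
     (\<forall>\<phi>\<in>C0. uniform_limit UNIV (\<lambda>t. kernel_op \<kappa> t \<phi>) \<phi> (at_right 0))"

text \<open>A generator is an unbounded operator on \<open>C0\<close>, identified with its graph; its domain is the
  \<open>Domain\<close> of the graph.\<close>

type_synonym 'a operator = "(('a \<Rightarrow> real) \<times> ('a \<Rightarrow> real)) set"

definition generator :: "(real \<Rightarrow> 'a::topological_space \<Rightarrow> 'a measure) \<Rightarrow> 'a operator" where
  "generator \<kappa> = {(\<phi>, \<psi>). \<phi> \<in> C0 \<and>
     uniform_limit UNIV (\<lambda>t x. (kernel_op \<kappa> t \<phi> x - \<phi> x) / t) \<psi> (at_right 0)}"

text \<open>A generator determines its semigroup at all times \<open>t \<ge> 0\<close>, so for a generator the choice below
  is immaterial there.\<close>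

definition semigroup_of :: "'a::topological_space operator \<Rightarrow> real \<Rightarrow> 'a \<Rightarrow> 'a measure" where
  "semigroup_of A = (SOME \<kappa>. probability_semigroup \<kappa> \<and> generator \<kappa> = A)"

definition exp_op ::
  "real \<Rightarrow> 'a::topological_space operator \<Rightarrow> ('a \<Rightarrow> real) \<Rightarrow> 'a \<Rightarrow> real" where
  "exp_op t A = kernel_op (semigroup_of A) t"

definition dual_exp ::
  "'a::topological_space measure \<Rightarrow> real \<Rightarrow> 'a operator \<Rightarrow> 'a measure" where
  "dual_exp \<mu> t A =
     (THE \<nu>. \<nu> \<in> borel_probs \<and> (\<forall>\<phi>\<in>bcontfun. (\<integral>x. \<phi> x \<partial>\<nu>) = (\<integral>x. exp_op t A \<phi> x \<partial>\<mu>)))"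

definition generators_c ::
  "('a::topological_space \<Rightarrow> 'a \<Rightarrow> real) \<Rightarrow> 'a operator set" where
  "generators_c c = {A. (\<exists>\<kappa>. probability_semigroup \<kappa> \<and> generator \<kappa> = A) \<and>
     (\<forall>\<mu>\<in>probs_c c.
        (\<forall>t\<ge>0. dual_exp \<mu> t A \<in> probs_c c) \<and>
        (\<forall>t\<ge>0. ((\<lambda>s. transport_cost c (dual_exp \<mu> t A) (dual_exp \<mu> s A)) \<longlongrightarrow> 0)
                  (at t within {0..})))}"

text \<open>All costs occurring in \<open>omega_c\<close> are finite for measures in \<open>probs_c c\<close> when \<open>c\<close> satisfies a
  relaxed triangle inequality, so the \<open>ereal\<close> subtraction is the real one.\<close>

definition omega_c ::
  "('a::topological_space \<Rightarrow> 'a \<Rightarrow> real) \<Rightarrow> 'a measure \<Rightarrow> 'a measure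
     \<Rightarrow> 'a operator \<Rightarrow> 'a operator \<Rightarrow> ereal" where
  "omega_c c \<mu> \<nu> A B = Limsup (at_right (0::real)) (\<lambda>t.
     (enn2ereal (transport_cost c (dual_exp \<mu> t A) (dual_exp \<nu> t B))
        - enn2ereal (transport_cost c \<mu> \<nu>)) / ereal t)"

definition exp_continuous ::
  "('a::topological_space \<Rightarrow> 'a \<Rightarrow> real) \<Rightarrow> real \<Rightarrow> (real \<Rightarrow> 'a operator) \<Rightarrow> bool" where
  "exp_continuous c T A \<longleftrightarrow>
     (\<forall>t\<in>{0..T}. A t \<in> generators_c c) \<and>
     (\<exists>\<beta>\<ge>0::real. \<forall>\<epsilon>>0::real. \<exists>\<delta>>0::real. \<forall>t\<in>{0..T}. \<forall>s\<in>{0..T}. \<bar>t - s\<bar> < \<delta> \<longrightarrow>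
        (\<forall>\<mu>\<in>probs_c c. \<forall>\<nu>\<in>probs_c c.
           omega_c c \<mu> \<nu> (A t) (A s) \<le> ereal \<epsilon> + ereal \<beta> * enn2ereal (transport_cost c \<mu> \<nu>)))"


section \<open>Dual solutions for piecewise constant curves\<close>

definition strong_dual_solution ::
  "('a::topological_space \<Rightarrow> 'a \<Rightarrow> real) \<Rightarrow> real \<Rightarrow> 'a measure \<Rightarrow> (real \<Rightarrow> 'a operator)
     \<Rightarrow> (real \<Rightarrow> 'a measure) \<Rightarrow> bool" where
  "strong_dual_solution c T \<rho>0 A \<rho> \<longleftrightarrow> \<rho> \<in> curves_c c T \<and> \<rho> 0 = \<rho>0 \<and>
     (\<forall>t\<in>{0<..<T}. \<forall>(\<phi>, \<psi>)\<in>A t.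
        ((\<lambda>h. ((\<integral>x. \<phi> x \<partial>(\<rho> (t + h))) - (\<integral>x. \<phi> x \<partial>(\<rho> t))) / h) \<longlongrightarrow> (\<integral>x. \<psi> x \<partial>(\<rho> t)))
          (at_right 0))"

definition S0 ::
  "('a::topological_space \<Rightarrow> 'a \<Rightarrow> real) \<Rightarrow> real \<Rightarrow> 'a measure \<Rightarrow> (real \<Rightarrow> 'a operator)
     \<Rightarrow> real \<Rightarrow> 'a measure" where
  "S0 c T \<rho>0 A = (THE \<rho>. strong_dual_solution c T \<rho>0 A \<rho>)"

text \<open>A partition \<open>0 = p 0 < \<dots> < p K = T\<close> is given by \<open>K\<close> and the function \<open>p\<close>; values of \<open>p\<close>
  beyond \<open>K\<close> are irrelevant.\<close>

definition is_partition :: "real \<Rightarrow> nat \<Rightarrow> (nat \<Rightarrow> real) \<Rightarrow> bool" where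
  "is_partition T K p \<longleftrightarrow> p 0 = 0 \<and> p K = T \<and> (\<forall>k\<in>{1..K}. p (k - 1) < p k)"

definition mesh :: "nat \<Rightarrow> (nat \<Rightarrow> real) \<Rightarrow> real" where
  "mesh K p = Max ((\<lambda>k. \<bar>p k - p (k - 1)\<bar>) ` {1..K})"

text \<open>The approximants take the value of \<open>A\<close> at the right endpoint of each subinterval. Their value
  at \<open>t = T\<close> is left unconstrained: it does not enter \<open>strong_dual_solution\<close>.\<close>

definition pc_approximating_sequence ::
  "real \<Rightarrow> (real \<Rightarrow> 'a operator) \<Rightarrow> (nat \<Rightarrow> real \<Rightarrow> 'a operator) \<Rightarrow> bool" where
  "pc_approximating_sequence T A AA \<longleftrightarrow>
     (\<exists>(K :: nat \<Rightarrow> nat) (p :: nat \<Rightarrow> nat \<Rightarrow> real).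
        (\<forall>n. is_partition T (K n) (p n) \<and>
             (\<forall>k\<in>{1..K n}. \<forall>t\<in>{p n (k - 1)..<p n k}. AA n t = A (p n k))) \<and>
        (\<lambda>n. mesh (K n) (p n)) \<longlonglongrightarrow> 0)"

end

theory Submission
  imports Defs
begin

text \<open>
  Two curves that are piecewise generated by \<open>A\<close> at points close to the current time have
  \<open>D\<^sup>+ f \<le> \<epsilon> + \<beta> f\<close> for the distance \<open>f t = transport_cost c (\<rho> t) (\<sigma> t)\<close>, by the
  \<open>Exp\<close>-continuity of \<open>A\<close>. As \<open>c\<close> satisfies only a relaxed triangle inequality, \<open>f\<close> need not
  inherit continuity from the curves, but it is lower semicontinuous, which suffices for Gronwall.
  So the approximations are uniformly Cauchy, and the limit exists because the transport cost is
  complete.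

  Triangle inequality, lower semicontinuity and completeness of the transport cost all come from one
  approximate gluing of couplings: decompose the space into countably many small cells and run a
  Markov chain which, conditionally on the cell of the previous second marginal, draws the next
  coupling. Completeness then follows from almost sure convergence of that chain.

  That \<open>S0\<close> is the explicit composition of semigroups needs uniqueness of strong dual solutions: for
  \<open>\<phi>\<close> in the domain, \<open>s \<mapsto> \<langle>\<rho> s, exp ((t - s) A) \<phi>\<rangle>\<close> is continuous with right derivative \<open>0\<close>.
\<close>

section \<open>The topology of a relaxed semimetric\<close>

text \<open>The comparison of approximations is a differential inequality, not an iterated triangle
  inequality: iterating would multiply by the triangle constant on every subinterval and blow up as
  the mesh shrinks. Both curves start at \<rho>0, so the differential inequality bounds their cost
  by exp (\<beta> T) \<epsilon> T; it is essential that \<beta> in \<open>exp_continuous\<close> is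
  fixed before \<epsilon>. The triangle inequality for transport costs is then used a bounded number
  of times, so that its constant is harmless.

  Lower semicontinuity is enough because there are two ways for f to cross a barrier: an upward jump
  on arrival from the left, which semicontinuity excludes, and growth to the right, which the Dini
  estimate bounds. Downward jumps do no harm.

  Measures are tested against \<open>C0\<close>, because generator domains are dense subsets of it;
  separability and local compactness make \<open>C0\<close> rich enough to determine Borel measures
  although c is not a metric.\<close>

locale relaxed_semimetric =
  fixes c :: "'a::topological_space \<Rightarrow> 'a \<Rightarrow> real" and B :: real
  assumes semimetric: "semimetric c"
    and topology: "semimetric_topology c"
    and separable: "separable_space (euclidean :: 'a topology)"
    and locally_compact: "locally_compact_space (euclidean :: 'a topology)"
    and c_seq_continuous: "semimetric_continuous c"
    and B_ge_1: "B \<ge> 1"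
    and c_relaxed: "\<And>x y z. c x y \<le> B * (c x z + c z y)"
begin

lemma c_nonneg [simp]: "0 \<le> c x y"
  and c_sym: "c x y = c y x"
  and c_self [simp]: "c x x = 0"
  using semimetric by (auto simp: semimetric_def)

lemma B_pos: "B > 0"
  using B_ge_1 by linarith

text \<open>The factor \<open>2 * B\<close> takes over the role of 2 in halving arguments for
  metrics; the radii \<open>r / (2*B)\<close> in later covers and partitions come from here.\<close>

lemma c_lt: "c x z < r / (2*B) \<Longrightarrow> c z y < r / (2*B) \<Longrightarrow> c x y < r"
  using c_relaxed[of x y z] B_pos mult_strict_left_mono[of "c x z + c z y" "r/B" B]
  by (fastforce simp: field_simps)

definition c_ball :: "'a \<Rightarrow> real \<Rightarrow> 'a set" where
  "c_ball x r = {y. c x y < r}"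

lemma mem_c_ball [simp]: "y \<in> c_ball x r \<longleftrightarrow> c x y < r"
  by (simp add: c_ball_def)

lemma open_c_ball: "open (c_ball x r)"
proof (cases "r > 0")
  case True
  then show ?thesis
    using topology by (auto simp: semimetric_topology_def c_ball_def intro!: generate_topology.Basis)
next
  case False
  then have "c_ball x r = {}"
    by (auto simp: not_less) (metis c_nonneg leD order_trans)
  then show ?thesis by simp
qed

text \<open>Joint continuity is assumed along sequences only. Balls of radius 1/(n+1) turn a failure
  of the uniform statement into two sequences converging to x and y along which c does not converge
  to \<open>c x y\<close>.\<close>

lemma c_continuous_at:
  assumes "e > 0"
  shows "\<exists>r>0. \<forall>x' y'. c x x' < r \<longrightarrow> c y y' < r \<longrightarrow> \<bar>c x' y' - c x y\<bar> < e"
proof (rule ccontr)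
  assume *: "\<not> ?thesis"
  have "\<forall>n::nat. \<exists>x' y'. c x x' < 1 / Suc n \<and> c y y' < 1 / Suc n \<and> \<not> \<bar>c x' y' - c x y\<bar> < e"
    using * by (meson of_nat_0_less_iff zero_less_Suc zero_less_divide_1_iff)
  then obtain X Y where XY: "\<And>n::nat. c x (X n) < 1 / Suc n" "\<And>n. c y (Y n) < 1 / Suc n"
      "\<And>n. \<not> \<bar>c (X n) (Y n) - c x y\<bar> < e"
    by metis
  have lim: "(\<lambda>n. 1 / real (Suc n)) \<longlonglongrightarrow> 0"
    by (rule LIMSEQ_Suc[OF lim_1_over_n])
  have "(\<lambda>n. c (X n) x) \<longlonglongrightarrow> 0" "(\<lambda>n. c (Y n) y) \<longlonglongrightarrow> 0"
    using XY by (auto intro!: tendsto_sandwich[OF _ _ tendsto_const lim] simp: c_sym less_imp_le)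
  then have "(\<lambda>n. c (X n) (Y n)) \<longlonglongrightarrow> c x y"
    using c_seq_continuous by (auto simp: semimetric_continuous_def)
  from tendstoD[OF this assms] XY(3) show False
    by (auto simp: dist_real_def)
qed

text \<open>By definition the balls are merely a subbase. That they are neighbourhoods of all their
  points follows from continuity of c. The relaxed triangle inequality would not give it: near x it
  bounds \<open>c z y\<close> only by about \<open>B * c z x\<close>, which may exceed the
  radius.\<close>

lemma open_iff: "open U \<longleftrightarrow> (\<forall>x\<in>U. \<exists>r>0. c_ball x r \<subseteq> U)"
proof
  assume "open U"
  then have "generate_topology {{y. c x y < r} | x r. r > 0} U"
    using topology by (simp add: semimetric_topology_def)
  then show "\<forall>x\<in>U. \<exists>r>0. c_ball x r \<subseteq> U"
  proof induction
    case UNIV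
    then show ?case by (auto intro: exI[of _ 1])
  next
    case (Int U V)
    show ?case
    proof
      fix x assume "x \<in> U \<inter> V"
      then obtain r s where "r > 0" "c_ball x r \<subseteq> U" "s > 0" "c_ball x s \<subseteq> V"
        using Int by blast
      then show "\<exists>r>0. c_ball x r \<subseteq> U \<inter> V"
        by (intro exI[of _ "min r s"]) auto
    qed
  next
    case (UN K)
    then show ?case by blast
  next
    case (Basis S)
    then obtain z s where S: "S = {y. c z y < s}" by auto
    show ?case
    proof
      fix x assume "x \<in> S"
      then obtain r where "r > 0" "\<And>x' y'. c z x' < r \<Longrightarrow> c x y' < r \<Longrightarrow> \<bar>c x' y' - c z x\<bar> < s - c z x"
        using c_continuous_at[of "s - c z x" z x] S by auto
      from this(1) this(2)[of z] show "\<exists>r>0. c_ball x r \<subseteq> S"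
        by (intro exI[of _ r]) (fastforce simp: S)
    qed
  qed
next
  assume "\<forall>x\<in>U. \<exists>r>0. c_ball x r \<subseteq> U"
  then obtain r where r: "\<And>x. x \<in> U \<Longrightarrow> r x > 0 \<and> c_ball x (r x) \<subseteq> U" by metis
  then have "U = (\<Union>x\<in>U. c_ball x (r x))" by fastforce
  moreover have "open (\<Union>x\<in>U. c_ball x (r x))" by (intro open_UN ballI open_c_ball)
  ultimately show "open U" by simp
qed

lemma eventually_nhds_iff: "(\<forall>\<^sub>F y in nhds x. P y) \<longleftrightarrow> (\<exists>r>0. \<forall>y. c x y < r \<longrightarrow> P y)"
proof
  assume "\<forall>\<^sub>F y in nhds x. P y"
  then obtain S where "open S" "x \<in> S" "\<forall>y\<in>S. P y" by (auto simp: eventually_nhds)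
  then show "\<exists>r>0. \<forall>y. c x y < r \<longrightarrow> P y" unfolding open_iff by force
next
  assume "\<exists>r>0. \<forall>y. c x y < r \<longrightarrow> P y"
  then obtain r where "r > 0" "\<And>y. c x y < r \<Longrightarrow> P y" by auto
  then show "\<forall>\<^sub>F y in nhds x. P y"
    by (auto simp: eventually_nhds intro!: exI[of _ "c_ball x r"] open_c_ball)
qed

lemma continuous_on_c: "continuous_on UNIV (\<lambda>z. c (fst z) (snd z))"
proof -
  have "((\<lambda>z. c (fst z) (snd z)) \<longlongrightarrow> c x y) (nhds (x, y))" for x y
  proof (rule tendstoI)
    fix e :: real assume "e > 0"
    then obtain r where r: "r > 0" "\<And>x' y'. c x x' < r \<Longrightarrow> c y y' < r \<Longrightarrow> \<bar>c x' y' - c x y\<bar> < e"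
      using c_continuous_at by blast
    show "\<forall>\<^sub>F z in nhds (x, y). dist (c (fst z) (snd z)) (c x y) < e"
      unfolding eventually_nhds
      using r by (intro exI[of _ "c_ball x r \<times> c_ball y r"]) (auto intro!: open_Times open_c_ball simp: dist_real_def)
  qed
  then show ?thesis
    by (auto simp: continuous_on_def intro: tendsto_mono[OF at_within_le_nhds])
qed

lemma continuous_on_c1: "continuous_on UNIV (c x)"
  using continuous_on_compose2[OF continuous_on_c, of UNIV "\<lambda>y. (x, y)"]
  by (simp add: continuous_on_Pair)

lemma borel_measurable_c1 [measurable]: "c x \<in> borel_measurable borel"
  by (rule borel_measurable_continuous_onI[OF continuous_on_c1])

section \<open>Countable base and Borel sets\<close>

lemma dense_exists: "\<exists>d :: nat \<Rightarrow> 'a. \<forall>x. \<forall>r>0. \<exists>i. c (d i) x < r"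
proof -
  obtain D :: "'a set" where D: "countable D" "euclidean closure_of D = UNIV"
    using separable by (auto simp: separable_space_def)
  then have "D \<noteq> {}" by auto
  have "\<exists>i. c (from_nat_into D i) x < r" if "r > 0" for x r
  proof -
    have "x \<in> c_ball x r \<and> open (c_ball x r)" using that open_c_ball by simp
    then obtain y where "y \<in> D" "y \<in> c_ball x r"
      using D(2) unfolding in_closure_of set_eq_iff by (metis UNIV_I open_openin)
    then show ?thesis
      using from_nat_into_surj[OF D(1) \<open>y \<in> D\<close>] by (metis c_sym mem_c_ball)
  qed
  then show ?thesis by blast
qed

definition dense_seq :: "nat \<Rightarrow> 'a" where
  "dense_seq = (SOME d. \<forall>x. \<forall>r>0. \<exists>i. c (d i) x < r)"

lemma dense_seq: "r > 0 \<Longrightarrow> \<exists>i. c (dense_seq i) x < r"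
  using someI_ex[OF dense_exists] unfolding dense_seq_def by blast

definition base_ball :: "nat \<times> nat \<Rightarrow> 'a set" where
  "base_ball p = c_ball (dense_seq (fst p)) (1 / Suc (snd p))"

lemma open_base_ball: "open (base_ball p)"
  by (simp add: base_ball_def open_c_ball)

text \<open>A dense point within r/(2B) of x carries a ball of radius below r/(2B) that contains x
  and by \<open>c_lt\<close> stays inside \<open>c_ball x r\<close>. Countability of the index set
  makes every open set a countable union of such balls.\<close>

lemma base:
  assumes "open U" "x \<in> U"
  shows "\<exists>p. x \<in> base_ball p \<and> base_ball p \<subseteq> U"
proof -
  obtain r where r: "r > 0" "c_ball x r \<subseteq> U" using assms by (auto simp: open_iff)
  obtain n where n: "1 / real (Suc n) < r / (2*B)"
    using r B_pos nat_approx_posE[of "r / (2*B)"] by auto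
  obtain i where i: "c (dense_seq i) x < 1 / real (Suc n)"
    using dense_seq by (metis of_nat_0_less_iff zero_less_Suc zero_less_divide_1_iff)
  have "c_ball (dense_seq i) (1 / Suc n) \<subseteq> c_ball x r"
  proof
    fix y assume "y \<in> c_ball (dense_seq i) (1 / Suc n)"
    then have "c x (dense_seq i) < r / (2*B)" "c (dense_seq i) y < r / (2*B)"
      using i n by (auto simp: c_sym)
    then show "y \<in> c_ball x r" using c_lt by simp
  qed
  with i r show ?thesis
    by (intro exI[of _ "(i, n)"]) (auto simp: base_ball_def)
qed

lemma open_eq_Union_base: "open U \<Longrightarrow> U = \<Union>(base_ball ` {p. base_ball p \<subseteq> U})"
  using base by fast

lemma compact_nhd: "\<exists>r>0. \<exists>K. compact K \<and> c_ball x r \<subseteq> K"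
proof -
  obtain U K where "open U" "compact K" "x \<in> U" "U \<subseteq> K"
    using locally_compact by (simp add: locally_compact_space_def) metis
  then show ?thesis unfolding open_iff by (meson order_trans)
qed

text \<open>Couplings are Borel measures for the product topology, while random pairs are measurable
  for the product sigma-algebra. The two agree because the countable base makes every open set of
  the product a countable union of open rectangles.\<close>

lemma sets_borel_pair: "sets (borel :: ('a \<times> 'a) measure) = sets (borel \<Otimes>\<^sub>M borel)"
proof
  have fs: "fst \<in> borel_measurable (borel :: ('a \<times> 'a) measure)"
      "snd \<in> borel_measurable (borel :: ('a \<times> 'a) measure)"
    by (auto intro!: borel_measurable_continuous_onI continuous_intros)
  show "sets (borel \<Otimes>\<^sub>M borel) \<subseteq> sets (borel :: ('a \<times> 'a) measure)"
  proof (rule sets_pair_in_sets)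
    fix a b :: "'a set" assume "a \<in> sets borel" "b \<in> sets borel"
    then have "fst -` a \<inter> snd -` b \<in> sets (borel :: ('a \<times> 'a) measure)"
      using measurable_sets[OF fs(1), of a] measurable_sets[OF fs(2), of b] by auto
    then show "a \<times> b \<in> sets (borel :: ('a \<times> 'a) measure)"
      by (simp add: vimage_fst vimage_snd Times_Int_Times)
  qed
  show "sets (borel :: ('a \<times> 'a) measure) \<subseteq> sets (borel \<Otimes>\<^sub>M borel)"
  proof -
    have "W \<in> sets (borel \<Otimes>\<^sub>M borel)" if W: "open W" for W :: "('a \<times> 'a) set"
    proof -
      define J where "J = {(p, q). base_ball p \<times> base_ball q \<subseteq> W}"
      have "W = (\<Union>(p, q)\<in>J. base_ball p \<times> base_ball q)"
      proof
        show "W \<subseteq> (\<Union>(p, q)\<in>J. base_ball p \<times> base_ball q)"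
        proof
          fix z assume "z \<in> W"
          then obtain U V where "open U" "open V" "z \<in> U \<times> V" "U \<times> V \<subseteq> W"
            using bspec[OF W[unfolded open_prod_def] \<open>z \<in> W\<close>] by (elim exE conjE) blast
          moreover from this obtain p q where "fst z \<in> base_ball p" "base_ball p \<subseteq> U" "snd z \<in> base_ball q" "base_ball q \<subseteq> V"
            by (metis base mem_Times_iff)
          ultimately show "z \<in> (\<Union>(p, q)\<in>J. base_ball p \<times> base_ball q)"
            by (intro UN_I[of "(p, q)"]) (auto simp: J_def mem_Times_iff subset_iff)
        qed
      qed (auto simp: J_def)
      also have "\<dots> \<in> sets (borel \<Otimes>\<^sub>M borel)"
        using open_base_ball by (intro sets.countable_UN') (auto intro!: pair_measureI)
      finally show ?thesis .
    qed
    then show ?thesis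
      using sets.sigma_sets_subset[of "{S. open S}" "borel \<Otimes>\<^sub>M borel :: ('a \<times> 'a) measure"]
      by (auto simp: borel_def space_pair_measure)
  qed
qed

definition cost :: "('a \<times> 'a) measure \<Rightarrow> ennreal" where
  "cost \<gamma> = (\<integral>\<^sup>+ z. ennreal (c (fst z) (snd z)) \<partial>\<gamma>)"

lemma measure_eqI_open:
  assumes "\<mu> \<in> borel_probs" "\<nu> \<in> borel_probs"
    and eq: "\<And>U :: 'a set. open U \<Longrightarrow> emeasure \<mu> U = emeasure \<nu> U"
  shows "\<mu> = \<nu>"
proof (rule measure_eqI_generator_eq[where E="{S. open S}" and \<Omega>=UNIV and A="\<lambda>_. UNIV"])
  interpret prob_space \<mu> using assms by (simp add: borel_probs_def)
  show "emeasure \<mu> UNIV \<noteq> \<infinity>" by simp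
qed (use assms in \<open>auto simp: borel_probs_def borel_def Int_stable_def\<close>)

section \<open>Test functions vanishing at infinity\<close>

text \<open>A tent over a base ball, continuous because c is; it stands in for Urysohn
  functions.\<close>

definition bump :: "nat \<times> nat \<Rightarrow> 'a \<Rightarrow> real" where
  "bump p x = max 0 (1 / Suc (snd p) - c (dense_seq (fst p)) x)"

lemma bump_pos_iff: "bump p x > 0 \<longleftrightarrow> x \<in> base_ball p"
  by (auto simp: bump_def base_ball_def)

lemma bump_nonneg: "bump p x \<ge> 0"
  by (simp add: bump_def)

lemma continuous_on_bump: "continuous_on UNIV (bump p)"
  unfolding bump_def by (intro continuous_intros continuous_on_c1)

definition good_base :: "(nat \<times> nat) set" where
  "good_base = {p. \<exists>K. compact K \<and> base_ball p \<subseteq> K}"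

text \<open>Local compactness leaves a base after discarding the balls not contained in a compact
  set. Functions built from finitely many of the remaining balls vanish off a compact set, hence lie
  in \<open>C0\<close>.\<close>

lemma good_base:
  assumes "open U" "x \<in> U"
  shows "\<exists>p\<in>good_base. x \<in> base_ball p \<and> base_ball p \<subseteq> U"
proof -
  obtain r K where K: "r > 0" "compact K" "c_ball x r \<subseteq> K" using compact_nhd by blast
  then obtain p where "x \<in> base_ball p" "base_ball p \<subseteq> U \<inter> c_ball x r"
    using base[of "U \<inter> c_ball x r" x] assms open_c_ball by (metis Int_iff c_self mem_c_ball open_Int)
  with K show ?thesis unfolding good_base_def by blast
qed

lemma C0_bcontfun: "\<phi> \<in> C0 \<Longrightarrow> \<phi> \<in> bcontfun"
proof -
  assume \<phi>: "\<phi> \<in> C0"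
  then obtain K where K: "compact K" "\<And>x. x \<notin> K \<Longrightarrow> \<bar>\<phi> x\<bar> < 1"
    unfolding C0_def using zero_less_one by blast
  have cont: "continuous_on UNIV \<phi>" using \<phi> by (simp add: C0_def)
  then have "compact (\<phi> ` K)"
    using K(1) by (intro compact_continuous_image) (auto intro: continuous_on_subset)
  then obtain b where b: "\<And>x. x \<in> K \<Longrightarrow> \<bar>\<phi> x\<bar> \<le> b"
    using compact_imp_bounded[of "\<phi> ` K"] by (auto simp: bounded_iff)
  have "norm (\<phi> x) \<le> max b 1" for x
    using b[of x] K(2)[of x] by (cases "x \<in> K") auto
  then show "\<phi> \<in> bcontfun" by (rule bcontfun_normI[OF cont])
qed

lemma C0_compact_support:
  assumes "continuous_on UNIV \<phi>" "compact K" "\<And>x. x \<notin> K \<Longrightarrow> \<phi> x = 0"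
  shows "\<phi> \<in> C0"
  using assms by (auto simp: C0_def intro!: exI[of _ K])

lemma compact_UN_good: "finite I \<Longrightarrow> I \<subseteq> good_base \<Longrightarrow> \<exists>K. compact K \<and> (\<Union>p\<in>I. base_ball p) \<subseteq> K"
proof (induction rule: finite_induct)
  case empty
  then show ?case by (auto intro: exI[of _ "{}"])
next
  case (insert p I)
  then obtain K L where "compact K" "(\<Union>p\<in>I. base_ball p) \<subseteq> K" "compact L" "base_ball p \<subseteq> L"
    by (auto simp: good_base_def)
  then show ?case by (intro exI[of _ "K \<union> L"]) (auto simp: compact_Un)
qed

text \<open>Tents of the finitely many good balls inside U with indices at most n are summed,
  multiplied by n and cut off at 1. At a point of U some tent is positive, and n times it eventually
  exceeds 1; off U all tents vanish. This carries identities and measurability from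
  \<open>C0\<close> to open sets.\<close>

lemma open_approx_C0:
  assumes "open U"
  obtains f :: "nat \<Rightarrow> 'a \<Rightarrow> real" where
    "\<And>n. f n \<in> C0" "\<And>n x. 0 \<le> f n x" "\<And>n x. f n x \<le> 1"
    "\<And>x. (\<lambda>n. f n x) \<longlonglongrightarrow> indicator U x"
proof -
  define I where "I n = {p\<in>good_base. base_ball p \<subseteq> U \<and> fst p \<le> n \<and> snd p \<le> n}" for n
  have fin: "finite (I n)" for n
    by (rule finite_subset[of _ "{..n} \<times> {..n}"]) (auto simp: I_def)
  define g where "g n x = (\<Sum>p\<in>I n. bump p x)" for n x
  define f where "f n x = min 1 (real n * g n x)" for n x
  have g0: "g n x \<ge> 0" for n x by (auto simp: g_def intro!: sum_nonneg bump_nonneg)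
  have zero: "f n x = 0" if "x \<notin> (\<Union>p\<in>I n. base_ball p)" for n x
  proof -
    have "bump p x = 0" if "p \<in> I n" for p
      using \<open>x \<notin> _\<close> that bump_pos_iff[of p x] bump_nonneg[of p x] by auto
    then have "g n x = 0" by (simp add: g_def)
    then show ?thesis by (simp add: f_def)
  qed
  show thesis
  proof
    fix n
    obtain K where "compact K" "(\<Union>p\<in>I n. base_ball p) \<subseteq> K"
      using compact_UN_good[OF fin, of n] by (auto simp: I_def)
    moreover have "continuous_on UNIV (f n)"
      unfolding f_def g_def by (intro continuous_intros continuous_on_bump)
    ultimately show "f n \<in> C0"
      using zero[of _ n] by (intro C0_compact_support[where K=K]) blast+
  next
    fix x
    show "(\<lambda>n. f n x) \<longlonglongrightarrow> indicator U x"
    proof (cases "x \<in> U")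
      case False
      then have "x \<notin> (\<Union>p\<in>I n. base_ball p)" for n by (auto simp: I_def)
      then show ?thesis using False zero by simp
    next
      case True
      then obtain p where p: "p \<in> good_base" "x \<in> base_ball p" "base_ball p \<subseteq> U"
        using good_base assms by blast
      then have b: "bump p x > 0" by (simp add: bump_pos_iff)
      obtain m where m: "1 < real m * bump p x"
        using reals_Archimedean3[OF b] by blast
      have "f n x = 1" if "n \<ge> max m (max (fst p) (snd p))" for n
      proof -
        have "bump p x \<le> g n x"
          unfolding g_def using p that
          by (intro member_le_sum fin bump_nonneg) (auto simp: I_def)
        moreover have "real m * bump p x \<le> real n * bump p x"
          using that b by (intro mult_right_mono) auto
        ultimately have "1 < real n * g n x"
          using m mult_left_mono[of "bump p x" "g n x" "real n"] by linarith
        then show ?thesis by (simp add: f_def)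
      qed
      then show ?thesis
        using True by (auto intro!: tendsto_eventually eventually_sequentiallyI[of "max m (max (fst p) (snd p))"])
    qed
  qed (auto simp: f_def g0)
qed

lemma borel_measurable_bcontfun: "\<phi> \<in> bcontfun \<Longrightarrow> \<phi> \<in> borel_measurable borel"
  by (auto simp: bcontfun_def intro: borel_measurable_continuous_onI)

lemma bcontfun_bounded: "(\<phi> :: 'a \<Rightarrow> real) \<in> bcontfun \<Longrightarrow> \<exists>b\<ge>0. \<forall>x. \<bar>\<phi> x\<bar> \<le> b"
  by (auto simp: bcontfun_def bounded_iff image_iff) (metis abs_ge_zero order_trans)

lemma integrable_bcontfun:
  assumes "\<mu> \<in> borel_probs" "\<phi> \<in> bcontfun"
  shows "integrable \<mu> (\<phi> :: 'a \<Rightarrow> real)"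
proof -
  interpret prob_space \<mu> using assms by (simp add: borel_probs_def)
  obtain b where "\<And>x. \<bar>\<phi> x\<bar> \<le> b" using bcontfun_bounded assms by blast
  moreover have "\<phi> \<in> borel_measurable \<mu>"
    using borel_measurable_bcontfun[OF assms(2)] assms(1)
    by (auto simp: borel_probs_def cong: measurable_cong_sets)
  ultimately show ?thesis
    by (intro integrable_const_bound[where B=b]) auto
qed

lemma space_borel_probs: "\<mu> \<in> borel_probs \<Longrightarrow> space \<mu> = UNIV"
  by (auto simp: borel_probs_def dest: sets_eq_imp_space_eq)

lemma integral_approx_open:
  assumes \<mu>: "\<mu> \<in> borel_probs"
    and f: "\<And>n. f n \<in> (C0 :: ('a \<Rightarrow> real) set)" "\<And>n x. 0 \<le> f n x" "\<And>n x. f n x \<le> 1"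
    "\<And>x. (\<lambda>n. f n x) \<longlonglongrightarrow> indicator U x" and U: "open U"
  shows "(\<lambda>n. \<integral>x. f n x \<partial>\<mu>) \<longlonglongrightarrow> measure \<mu> U"
proof -
  interpret prob_space \<mu> using \<mu> by (simp add: borel_probs_def)
  have U': "U \<in> sets \<mu>" using U \<mu> by (simp add: borel_probs_def)
  have "(\<lambda>n. \<integral>x. f n x \<partial>\<mu>) \<longlonglongrightarrow> (\<integral>x. indicator U x \<partial>\<mu>)"
  proof (rule integral_dominated_convergence[where w="\<lambda>_. 1"])
    show "f n \<in> borel_measurable \<mu>" for n
      using integrable_bcontfun[OF \<mu> C0_bcontfun[OF f(1)]] by auto
  qed (use f U' in auto)
  then show ?thesis using U' by simp
qed

text \<open>Dominated convergence along \<open>open_approx_C0\<close> gives equal mass on open sets,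
  a generating pi-system. Testing on \<open>C0\<close> is what closeness in transport cost and
  duality with a generator can deliver.\<close>

lemma measure_eqI_C0:
  assumes \<mu>: "\<mu> \<in> borel_probs" and \<nu>: "\<nu> \<in> borel_probs"
    and eq: "\<And>\<phi> :: 'a \<Rightarrow> real. \<phi> \<in> C0 \<Longrightarrow> (\<integral>x. \<phi> x \<partial>\<mu>) = (\<integral>x. \<phi> x \<partial>\<nu>)"
  shows "\<mu> = \<nu>"
proof (rule measure_eqI_open[OF \<mu> \<nu>])
  fix U :: "'a set" assume U: "open U"
  interpret \<mu>: prob_space \<mu> using \<mu> by (simp add: borel_probs_def)
  interpret \<nu>: prob_space \<nu> using \<nu> by (simp add: borel_probs_def)
  obtain f where f: "\<And>n. f n \<in> (C0 :: ('a \<Rightarrow> real) set)" "\<And>n x. 0 \<le> f n x" "\<And>n x. f n x \<le> 1"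
    "\<And>x. (\<lambda>n. f n x) \<longlonglongrightarrow> indicator U x"
    using open_approx_C0[OF U] by blast
  have "measure \<mu> U = measure \<nu> U"
    using integral_approx_open[OF \<mu> f U] integral_approx_open[OF \<nu> f U] eq[OF f(1)]
    by (auto intro: LIMSEQ_unique)
  then show "emeasure \<mu> U = emeasure \<nu> U"
    by (simp add: \<mu>.emeasure_eq_measure \<nu>.emeasure_eq_measure)
qed

end

section \<open>Markov chains\<close>

text \<open>The Ionescu-Tulcea theorem with kernels that look only at the last coordinate. The
  conclusion keeps just the initial law and the conditional law of consecutive coordinates, from
  which the gluing is computed.\<close>

lemma markov_chain_exists:
  fixes \<mu> N :: "'b measure" and K :: "nat \<Rightarrow> 'b \<Rightarrow> 'b measure"
  assumes \<mu>: "prob_space \<mu>" "sets \<mu> = sets N"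
    and K[measurable]: "\<And>n. K n \<in> N \<rightarrow>\<^sub>M subprob_algebra N"
    and prob_K: "\<And>n x. x \<in> space N \<Longrightarrow> prob_space (K n x)"
  shows "\<exists>Q. prob_space Q \<and> sets Q = sets (PiM UNIV (\<lambda>_::nat. N)) \<and> distr Q N (\<lambda>\<omega>. \<omega> 0) = \<mu> \<and>
    (\<forall>n. \<forall>f\<in>borel_measurable (N \<Otimes>\<^sub>M N).
      (\<integral>\<^sup>+\<omega>. f (\<omega> n, \<omega> (Suc n)) \<partial>Q) = (\<integral>\<^sup>+\<omega>. (\<integral>\<^sup>+y. f (\<omega> n, y) \<partial>K n (\<omega> n)) \<partial>Q))"
proof -
  interpret \<mu>: prob_space \<mu> by fact
  \<comment> \<open>The kernel at index i draws coordinate i from the coordinates below i; hence the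
    shift to i - 1 and the separate case of the initial law.\<close>
  define P where "P i \<omega> = (if i = 0 then \<mu> else K (i - 1) (\<omega> (i - 1)))" for i and \<omega> :: "nat \<Rightarrow> 'b"
  have mP: "P i \<in> measurable (PiM {0..<i} (\<lambda>_. N)) (subprob_algebra N)" for i
  proof (cases i)
    case 0
    have "\<mu> \<in> space (subprob_algebra N)"
      using \<mu> by (simp add: space_subprob_algebra \<mu>.subprob_space_axioms)
    then show ?thesis by (simp add: P_def[abs_def] 0)
  next
    case (Suc n)
    have "(\<lambda>\<omega>. \<omega> n) \<in> PiM {0..<Suc n} (\<lambda>_. N) \<rightarrow>\<^sub>M N"
      by (rule measurable_component_singleton) auto
    then show ?thesis
      unfolding P_def[abs_def] by (simp add: Suc)
  qed
  interpret IT: Ionescu_Tulcea P "\<lambda>_. N"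
  proof (rule Ionescu_Tulcea.intro)
    fix i :: nat and x assume "x \<in> space (PiM {0..<i} (\<lambda>_. N))"
    then show "prob_space (P i x)"
      by (cases i) (auto simp: P_def \<mu>.prob_space_axioms space_PiM PiE_iff intro!: prob_K)
  qed (rule mP)
  let ?L = IT.PF.lim
  let ?I = "\<lambda>m::nat. PiM {0..<m} (\<lambda>_. N)"
  \<comment> \<open>The empty history, the only point of the product over the empty index
    set.\<close>
  let ?u = "\<lambda>_. undefined"
  have sL[measurable_cong]: "sets ?L = sets (PiM UNIV (\<lambda>_::nat. N))"
    by (simp add: IT.PF.sets_lim)
  have u: "?u \<in> space (?I 0)" by (simp add: space_PiM PiE_iff)
  \<comment> \<open>On an initial segment no coordinate has to be integrated out, so the law in the
    projective family is the m-step law itself.\<close>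
  have CI: "IT.CI {0..<m} = IT.C 0 m ?u" for m
  proof (rule measure_eqI)
    show "sets (IT.CI {0..<m}) = sets (IT.C 0 m ?u)"
      using IT.sets_C[OF u, of m] by (simp add: IT.CI_def)
    fix X assume "X \<in> sets (IT.CI {0..<m})"
    then have X: "X \<in> sets (?I m)" by (simp add: IT.CI_def)
    then have "IT.PF.emb {0..<m} {0..<m} X = X"
      using sets.sets_into_space[OF X] by (intro prod_emb_id) (simp add: space_PiM)
    then show "emeasure (IT.CI {0..<m}) X = emeasure (IT.C 0 m ?u) X"
      using IT.emeasure_CI[of "{0..<m}" m X] X by simp
  qed
  have dL: "distr ?L (?I m) (\<lambda>\<omega>. restrict \<omega> {0..<m}) = IT.C 0 m ?u" for m
    using IT.distr_lim[of "{0..<m}"] CI by simp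
  have res[measurable]: "(\<lambda>\<omega>. restrict \<omega> {0..<m}) \<in> ?L \<rightarrow>\<^sub>M ?I m" for m
    by (simp add: measurable_cong_sets[OF sL refl] measurable_restrict_subset)
  have int: "(\<integral>\<^sup>+\<omega>. g (restrict \<omega> {0..<m}) \<partial>?L) = (\<integral>\<^sup>+\<omega>. g \<omega> \<partial>IT.C 0 m ?u)"
    if "g \<in> borel_measurable (?I m)" for g m
    using that by (simp add: dL[symmetric] nn_integral_distr)
  have "prob_space (IT.C 0 0 ?u)" by (rule IT.prob_space_C[OF u])
  then have pL: "prob_space ?L"
    using dL[of 0] prob_space_distrD[OF res[of 0]] by simp
  have comp[measurable]: "(\<lambda>\<omega>. \<omega> n) \<in> ?L \<rightarrow>\<^sub>M N" for n
    by (simp add: measurable_cong_sets[OF sL refl])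
  have comp': "(\<lambda>\<omega>. \<omega> n) \<in> ?I m \<rightarrow>\<^sub>M N" if "n < m" for n m
    using that by (intro measurable_component_singleton) auto
  \<comment> \<open>Integrates out the last of m + 1 coordinates; it is applied below to functions
    of the last one or two coordinates.\<close>
  have step: "(\<integral>\<^sup>+\<omega>. g \<omega> \<partial>IT.C 0 (Suc m) ?u) = (\<integral>\<^sup>+\<omega>. (\<integral>\<^sup>+y. g (fun_upd \<omega> m y) \<partial>P m \<omega>) \<partial>IT.C 0 m ?u)"
    if [measurable]: "g \<in> borel_measurable (?I (Suc m))" for g m
  proof -
    have "(\<integral>\<^sup>+\<omega>. g \<omega> \<partial>IT.C 0 (Suc m) ?u) = (\<integral>\<^sup>+\<omega>. (\<integral>\<^sup>+y. g y \<partial>IT.eP m \<omega>) \<partial>IT.C 0 m ?u)"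
      using IT.sets_C[OF u, of m] IT.measurable_eP[of m]
      by (simp, intro nn_integral_bind[where B="?I (Suc m)"]) (simp_all cong: measurable_cong_sets)
    also have "\<dots> = (\<integral>\<^sup>+\<omega>. (\<integral>\<^sup>+y. g (fun_upd \<omega> m y) \<partial>P m \<omega>) \<partial>IT.C 0 m ?u)"
      using IT.space_C[OF u, of m] by (intro nn_integral_cong IT.nn_integral_eP that) simp
    finally show ?thesis .
  qed
  have "distr ?L N (\<lambda>\<omega>. \<omega> 0) = \<mu>"
  proof (rule measure_eqI)
    fix X assume "X \<in> sets (distr ?L N (\<lambda>\<omega>. \<omega> 0))"
    then have X[measurable]: "X \<in> sets N" by simp
    have "emeasure (distr ?L N (\<lambda>\<omega>. \<omega> 0)) X = (\<integral>\<^sup>+\<omega>. indicator X (\<omega> 0) \<partial>?L)"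
      by (simp add: nn_integral_distr flip: nn_integral_indicator)
    also have "\<dots> = (\<integral>\<^sup>+\<omega>. indicator X (\<omega> 0) \<partial>IT.C 0 (Suc 0) ?u)"
      using comp'[of 0 "Suc 0"] int[of "\<lambda>\<omega>. indicator X (\<omega> 0)" "Suc 0"] by simp
    also have "\<dots> = (\<integral>\<^sup>+\<omega>. (\<integral>\<^sup>+y. indicator X y \<partial>P 0 \<omega>) \<partial>IT.C 0 0 ?u)"
      using comp'[of 0 "Suc 0"] by (subst step) simp_all
    also have "\<dots> = emeasure \<mu> X"
      using X \<mu>(2) u by (simp add: P_def nn_integral_return)
    finally show "emeasure (distr ?L N (\<lambda>\<omega>. \<omega> 0)) X = emeasure \<mu> X" .
  qed (simp add: \<mu>)
  moreover have "(\<integral>\<^sup>+\<omega>. f (\<omega> n, \<omega> (Suc n)) \<partial>?L) = (\<integral>\<^sup>+\<omega>. (\<integral>\<^sup>+y. f (\<omega> n, y) \<partial>K n (\<omega> n)) \<partial>?L)"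
    if f[measurable]: "f \<in> borel_measurable (N \<Otimes>\<^sub>M N)" for n f
  proof -
    have [measurable]: "(\<lambda>x. \<integral>\<^sup>+y. f (x, y) \<partial>K n x) \<in> borel_measurable N"
      by (rule nn_integral_measurable_subprob_algebra2[where N=N]) (auto simp: f)
    have [measurable]: "(\<lambda>\<omega>. \<omega> n) \<in> ?I (Suc n) \<rightarrow>\<^sub>M N" "(\<lambda>\<omega>. \<omega> n) \<in> ?I (Suc (Suc n)) \<rightarrow>\<^sub>M N"
      "(\<lambda>\<omega>. \<omega> (Suc n)) \<in> ?I (Suc (Suc n)) \<rightarrow>\<^sub>M N"
      by (auto intro!: comp')
    have "(\<integral>\<^sup>+\<omega>. f (\<omega> n, \<omega> (Suc n)) \<partial>?L) = (\<integral>\<^sup>+\<omega>. f (\<omega> n, \<omega> (Suc n)) \<partial>IT.C 0 (Suc (Suc n)) ?u)"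
      using int[of "\<lambda>\<omega>. f (\<omega> n, \<omega> (Suc n))" "Suc (Suc n)"] by simp
    also have "\<dots> = (\<integral>\<^sup>+\<omega>. (\<integral>\<^sup>+y. f (\<omega> n, y) \<partial>K n (\<omega> n)) \<partial>IT.C 0 (Suc n) ?u)"
      by (subst step) (simp_all add: P_def)
    also have "\<dots> = (\<integral>\<^sup>+\<omega>. (\<integral>\<^sup>+y. f (\<omega> n, y) \<partial>K n (\<omega> n)) \<partial>?L)"
      using int[of "\<lambda>\<omega>. \<integral>\<^sup>+y. f (\<omega> n, y) \<partial>K n (\<omega> n)" "Suc n"] by simp
    finally show ?thesis .
  qed
  ultimately show ?thesis
    using pL sL by (intro exI[of _ ?L]) blast
qed

section \<open>Gluing couplings\<close>

context relaxed_semimetric begin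

text \<open>Assigning to y the first dense point within e/(2B) splits the space into countably many
  disjoint Borel sets, and \<open>c_lt\<close> keeps c below e on each of them.\<close>

definition cell :: "real \<Rightarrow> 'a \<Rightarrow> nat" where
  "cell e y = (LEAST i. c (dense_seq i) y < e / (2*B))"

lemma cell_eq_imp_close:
  assumes "e > 0" "cell e x = cell e y"
  shows "c x y < e"
proof -
  have *: "c (dense_seq (cell e z)) z < e / (2*B)" for z
    unfolding cell_def using assms(1) B_pos
    by (intro LeastI_ex[of "\<lambda>i. c (dense_seq i) z < e / (2*B)"] dense_seq) simp
  show ?thesis
    using *[of x] *[of y] assms(2) c_sym[of x] c_lt[of x "dense_seq (cell e x)"] by metis
qed

lemma measurable_cell [measurable]: "cell e \<in> borel \<rightarrow>\<^sub>M count_space UNIV"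
  unfolding cell_def by measurable

lemma measurable_fst_borel [measurable]: "fst \<in> borel_measurable (borel :: ('a \<times> 'a) measure)"
  and measurable_snd_borel [measurable]: "snd \<in> borel_measurable (borel :: ('a \<times> 'a) measure)"
  by (auto intro!: borel_measurable_continuous_onI continuous_intros)

lemma measurable_Pair_borel:
  assumes "f \<in> M \<rightarrow>\<^sub>M borel" "g \<in> M \<rightarrow>\<^sub>M borel"
  shows "(\<lambda>\<omega>. (f \<omega> :: 'a, g \<omega> :: 'a)) \<in> M \<rightarrow>\<^sub>M borel"
  using assms by (subst measurable_cong_sets[OF refl sets_borel_pair]) measurable

lemma borel_measurable_c: "(\<lambda>z. c (fst z) (snd z)) \<in> borel_measurable borel"
  by (rule borel_measurable_continuous_onI[OF continuous_on_c])

lemma borel_measurable_c_comp [measurable]: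
  assumes "f \<in> M \<rightarrow>\<^sub>M borel" "g \<in> M \<rightarrow>\<^sub>M borel"
  shows "(\<lambda>\<omega>. c (f \<omega>) (g \<omega>)) \<in> borel_measurable M"
  using measurable_compose[OF measurable_Pair_borel[OF assms] borel_measurable_c] by simp

text \<open>Discretised gluing: from \<open>\<gamma> n\<close> to \<open>\<gamma> (n + 1)\<close> the chain only remembers the cell of the second
  coordinate, so conditioning is elementary and no disintegration is needed; the price is that the
  two copies of the common marginal agree only up to \<open>e n\<close>.\<close>

lemma glue_couplings:
  fixes \<gamma> :: "nat \<Rightarrow> ('a \<times> 'a) measure" and e :: "nat \<Rightarrow> real"
  assumes \<gamma>: "\<And>n. \<gamma> n \<in> borel_probs"
    and link: "\<And>n. distr (\<gamma> n) borel snd = distr (\<gamma> (Suc n)) borel fst"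
    and e: "\<And>n. e n > 0"
  obtains Q :: "(nat \<Rightarrow> 'a \<times> 'a) measure" where
    "prob_space Q" "\<And>n. (\<lambda>\<omega>. \<omega> n) \<in> Q \<rightarrow>\<^sub>M borel" "\<And>n. distr Q borel (\<lambda>\<omega>. \<omega> n) = \<gamma> n"
    "\<And>n. AE \<omega> in Q. c (snd (\<omega> n)) (fst (\<omega> (Suc n))) < e n"
proof -
  let ?N = "borel :: ('a \<times> 'a) measure"
  have s\<gamma>[measurable_cong, simp]: "sets (\<gamma> n) = sets ?N" for n
    using \<gamma>[of n] by (simp add: borel_probs_def)
  have sp[simp]: "space (\<gamma> n) = UNIV" for n
    using sets_eq_imp_space_eq[OF s\<gamma>[of n]] by simp
  have p\<gamma>: "prob_space (\<gamma> n)" for n using \<gamma>[of n] by (simp add: borel_probs_def)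
  define S where "S n i = {z :: 'a \<times> 'a. cell (e n) (fst z) = i}" for n i
  have S[measurable]: "S n i \<in> sets ?N" for n i
  proof -
    have "(\<lambda>z. cell (e n) (fst z)) -` {i} \<inter> space ?N \<in> sets ?N"
      by (rule measurable_sets[where A="count_space UNIV"]) auto
    then show ?thesis by (simp add: S_def vimage_def)
  qed
  \<comment> \<open>Conditional law of the next pair given that its first coordinate lies in cell i.
    The default for a null cell only has to be a probability measure, since such a cell enters with
    weight zero.\<close>
  define U where "U n i = (if emeasure (\<gamma> (Suc n)) (S n i) = 0 then \<gamma> (Suc n)
      else uniform_measure (\<gamma> (Suc n)) (S n i))" for n i
  have pU: "prob_space (U n i)" for n i
  proof -
    interpret prob_space "\<gamma> (Suc n)" by (rule p\<gamma>)
    show ?thesis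
      by (auto simp: U_def p\<gamma> intro!: prob_space_uniform_measure)
  qed
  have sU[simp]: "sets (U n i) = sets ?N" for n i
    by (auto simp: U_def)
  have mU: "U n \<in> count_space UNIV \<rightarrow>\<^sub>M subprob_algebra ?N" for n
    using pU by (auto simp: space_subprob_algebra prob_space_imp_subprob_space)
  define K where "K n z = U n (cell (e n) (snd z))" for n and z :: "'a \<times> 'a"
  have mK: "K n \<in> ?N \<rightarrow>\<^sub>M subprob_algebra ?N" for n
    unfolding K_def by (rule measurable_compose[OF _ mU]) simp
  have "\<exists>Q. prob_space Q \<and> sets Q = sets (PiM UNIV (\<lambda>_::nat. ?N)) \<and> distr Q ?N (\<lambda>\<omega>. \<omega> 0) = \<gamma> 0 \<and>
    (\<forall>n. \<forall>f\<in>borel_measurable (?N \<Otimes>\<^sub>M ?N).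
      (\<integral>\<^sup>+\<omega>. f (\<omega> n, \<omega> (Suc n)) \<partial>Q) = (\<integral>\<^sup>+\<omega>. (\<integral>\<^sup>+y. f (\<omega> n, y) \<partial>K n (\<omega> n)) \<partial>Q))"
    by (rule markov_chain_exists[OF p\<gamma> _ mK]) (auto simp: K_def pU)
  then obtain Q where Q: "prob_space Q" "sets Q = sets (PiM UNIV (\<lambda>_::nat. ?N))"
      "distr Q ?N (\<lambda>\<omega>. \<omega> 0) = \<gamma> 0"
    and step: "\<And>n f. f \<in> borel_measurable (?N \<Otimes>\<^sub>M ?N) \<Longrightarrow>
      (\<integral>\<^sup>+\<omega>. f (\<omega> n, \<omega> (Suc n)) \<partial>Q) = (\<integral>\<^sup>+\<omega>. (\<integral>\<^sup>+y. f (\<omega> n, y) \<partial>K n (\<omega> n)) \<partial>Q)"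
    by blast
  have comp[measurable]: "(\<lambda>\<omega>. \<omega> n) \<in> Q \<rightarrow>\<^sub>M ?N" for n
    by (simp add: measurable_cong_sets[OF Q(2) refl])
  \<comment> \<open>By \<open>link\<close>, the cell of the second coordinate of
    \<open>\<omega> n\<close> has the same distribution as the cell of the first coordinate under
    the next coupling.\<close>
  have cells: "(\<integral>\<^sup>+\<omega>. F (cell (e n) (snd (\<omega> n))) \<partial>Q) = (\<Sum>i. F i * emeasure (\<gamma> (Suc n)) (S n i))"
    if law: "distr Q ?N (\<lambda>\<omega>. \<omega> n) = \<gamma> n" for n and F :: "nat \<Rightarrow> ennreal"
  proof -
    have F[measurable]: "(\<lambda>y. F (cell (e n) y)) \<in> borel_measurable borel"
      by (rule measurable_compose[OF measurable_cell]) simp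
    have "(\<integral>\<^sup>+\<omega>. F (cell (e n) (snd (\<omega> n))) \<partial>Q) = (\<integral>\<^sup>+y. F (cell (e n) y) \<partial>distr (\<gamma> n) borel snd)"
      by (simp add: nn_integral_distr flip: law)
    also have "\<dots> = (\<integral>\<^sup>+z. F (cell (e n) (fst z)) \<partial>\<gamma> (Suc n))"
      unfolding link by (rule nn_integral_distr) (simp_all add: F measurable_cong_sets[OF s\<gamma> refl])
    also have "\<dots> = (\<integral>\<^sup>+z. (\<Sum>i. F i * indicator (S n i) z) \<partial>\<gamma> (Suc n))"
    proof (rule nn_integral_cong)
      fix z
      have "(\<Sum>i. F i * indicator (S n i) z) = (\<Sum>i\<in>{cell (e n) (fst z)}. F i * indicator (S n i) z)"
        by (rule suminf_finite) (auto simp: S_def)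
      then show "F (cell (e n) (fst z)) = (\<Sum>i. F i * indicator (S n i) z)"
        by (simp add: S_def)
    qed
    also have "\<dots> = (\<Sum>i. F i * emeasure (\<gamma> (Suc n)) (S n i))"
      by (subst nn_integral_suminf)
        (simp_all add: nn_integral_cmult_indicator measurable_cong_sets[OF s\<gamma> refl])
    finally show ?thesis .
  qed
  \<comment> \<open>Law of total probability: averaging the conditional laws over the cells restores
    \<open>\<gamma> (Suc n)\<close>.\<close>
  have law: "distr Q ?N (\<lambda>\<omega>. \<omega> n) = \<gamma> n" for n
  proof (induction n)
    case 0
    show ?case by (rule Q)
  next
    case (Suc n)
    show ?case
    proof (rule measure_eqI)
      fix X assume "X \<in> sets (distr Q ?N (\<lambda>\<omega>. \<omega> (Suc n)))"
      then have X[measurable]: "X \<in> sets ?N" by simp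
      interpret prob_space "\<gamma> (Suc n)" by (rule p\<gamma>)
      have "emeasure (distr Q ?N (\<lambda>\<omega>. \<omega> (Suc n))) X = (\<integral>\<^sup>+\<omega>. indicator X (snd (\<omega> n, \<omega> (Suc n))) \<partial>Q)"
        by (simp add: nn_integral_distr flip: nn_integral_indicator)
      also have "\<dots> = (\<integral>\<^sup>+\<omega>. (\<integral>\<^sup>+y. indicator X y \<partial>K n (\<omega> n)) \<partial>Q)"
        by (subst step) (auto simp: measurable_compose[OF measurable_snd])
      also have "\<dots> = (\<integral>\<^sup>+\<omega>. emeasure (U n (cell (e n) (snd (\<omega> n)))) X \<partial>Q)"
        by (simp add: K_def)
      also have "\<dots> = (\<Sum>i. emeasure (U n i) X * emeasure (\<gamma> (Suc n)) (S n i))"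
        by (rule cells[OF Suc])
      also have "\<dots> = (\<Sum>i. emeasure (\<gamma> (Suc n)) (S n i \<inter> X))"
      proof (rule arg_cong[where f=suminf], rule ext)
        fix i
        show "emeasure (U n i) X * emeasure (\<gamma> (Suc n)) (S n i) = emeasure (\<gamma> (Suc n)) (S n i \<inter> X)"
        proof (cases "emeasure (\<gamma> (Suc n)) (S n i) = 0")
          case True
          then have "emeasure (\<gamma> (Suc n)) (S n i \<inter> X) = 0"
            using emeasure_mono[of "S n i \<inter> X" "S n i" "\<gamma> (Suc n)"] by simp
          then show ?thesis using True by simp
        next
          case False
          then show ?thesis
            by (simp add: U_def emeasure_uniform_measure ennreal_divide_times ennreal_divide_self less_top[symmetric])
        qed
      qed
      also have "\<dots> = emeasure (\<gamma> (Suc n)) (\<Union>i. S n i \<inter> X)"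
        by (rule suminf_emeasure) (auto simp: disjoint_family_on_def S_def)
      also have "(\<Union>i. S n i \<inter> X) = X" by (auto simp: S_def)
      finally show "emeasure (distr Q ?N (\<lambda>\<omega>. \<omega> (Suc n))) X = emeasure (\<gamma> (Suc n)) X" .
    qed simp
  qed
  have "AE \<omega> in Q. c (snd (\<omega> n)) (fst (\<omega> (Suc n))) < e n" for n
  proof -
    \<comment> \<open>Indicator of a cell mismatch. The conditional law given cell i is concentrated
      on cell i, so the integral of f vanishes and a mismatch is a null event.\<close>
    define f :: "('a \<times> 'a) \<times> ('a \<times> 'a) \<Rightarrow> ennreal" where
      "f p = (if cell (e n) (snd (fst p)) = cell (e n) (fst (snd p)) then 0 else 1)" for p
    have [measurable]: "(\<lambda>p. cell (e n) (snd (fst p))) \<in> ?N \<Otimes>\<^sub>M ?N \<rightarrow>\<^sub>M count_space UNIV"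
      "(\<lambda>p. cell (e n) (fst (snd p))) \<in> ?N \<Otimes>\<^sub>M ?N \<rightarrow>\<^sub>M count_space UNIV"
      by (auto intro!: measurable_compose[OF _ measurable_cell] measurable_compose[OF measurable_fst]
          measurable_compose[OF measurable_snd])
    have f: "f \<in> borel_measurable (?N \<Otimes>\<^sub>M ?N)"
      unfolding f_def
      by (rule measurable_compose_countable[where f="\<lambda>i p. if i = cell (e n) (fst (snd p)) then 0 else 1"]) measurable
    have "(\<integral>\<^sup>+\<omega>. f (\<omega> n, \<omega> (Suc n)) \<partial>Q) =
        (\<integral>\<^sup>+\<omega>. (\<lambda>i. \<integral>\<^sup>+y. (if i = cell (e n) (fst y) then 0 else 1) \<partial>U n i) (cell (e n) (snd (\<omega> n))) \<partial>Q)"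
      by (subst step[OF f]) (simp add: K_def f_def)
    also have "\<dots> = (\<Sum>i. (\<integral>\<^sup>+y. (if i = cell (e n) (fst y) then 0 else 1) \<partial>U n i) *
        emeasure (\<gamma> (Suc n)) (S n i))"
      by (rule cells[OF law])
    also have "\<dots> = (\<Sum>i::nat. 0)"
    proof (rule arg_cong[where f=suminf], rule ext)
      fix i
      interpret prob_space "\<gamma> (Suc n)" by (rule p\<gamma>)
      show "(\<integral>\<^sup>+y. (if i = cell (e n) (fst y) then 0 else 1) \<partial>U n i) * emeasure (\<gamma> (Suc n)) (S n i) = 0"
      proof (cases "emeasure (\<gamma> (Suc n)) (S n i) = 0")
        case False
        have "(\<integral>\<^sup>+y. (if i = cell (e n) (fst y) then 0 else 1) \<partial>U n i) = (\<integral>\<^sup>+y. indicator (- S n i) y \<partial>U n i)"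
          by (intro nn_integral_cong) (auto simp: S_def)
        also have "\<dots> = emeasure (U n i) (- S n i)"
          by (subst nn_integral_indicator) auto
        also have "\<dots> = 0"
          using False by (simp add: U_def emeasure_uniform_measure)
        finally show ?thesis by simp
      qed simp
    qed
    finally have "(\<integral>\<^sup>+\<omega>. f (\<omega> n, \<omega> (Suc n)) \<partial>Q) = 0" by simp
    moreover have "(\<lambda>\<omega>. f (\<omega> n, \<omega> (Suc n))) \<in> borel_measurable Q"
      by (rule measurable_compose[OF _ f]) measurable
    ultimately have "AE \<omega> in Q. f (\<omega> n, \<omega> (Suc n)) = 0"
      by (simp add: nn_integral_0_iff_AE)
    then show ?thesis
      by eventually_elim (auto simp: f_def split: if_splits intro!: cell_eq_imp_close e)
  qed
  then show thesis
    using that[OF Q(1) comp law] by blast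
qed

end

section \<open>The transport cost\<close>

context relaxed_semimetric begin

lemma transport_cost_eq: "transport_cost c \<mu> \<nu> = (INF \<gamma>\<in>couplings \<mu> \<nu>. cost \<gamma>)"
  by (simp add: transport_cost_def cost_def)

lemma transport_cost_less_iff: "transport_cost c \<mu> \<nu> < a \<longleftrightarrow> (\<exists>\<gamma>\<in>couplings \<mu> \<nu>. cost \<gamma> < a)"
  by (simp add: transport_cost_eq INF_less_iff)

lemma borel_probsD: "\<mu> \<in> borel_probs \<Longrightarrow> prob_space \<mu>" "\<mu> \<in> borel_probs \<Longrightarrow> sets \<mu> = sets borel"
  by (auto simp: borel_probs_def)

lemma couplingsD:
  assumes "\<gamma> \<in> couplings \<mu> \<nu>"
  shows "\<gamma> \<in> borel_probs" "distr \<gamma> borel fst = \<mu>" "distr \<gamma> borel snd = \<nu>"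
  using assms by (auto simp: couplings_def)

lemma couplings_measurable:
  assumes "\<gamma> \<in> couplings \<mu> (\<nu> :: 'a measure)"
  shows "fst \<in> \<gamma> \<rightarrow>\<^sub>M borel" "snd \<in> \<gamma> \<rightarrow>\<^sub>M borel"
  by (simp_all only: measurable_cong_sets[OF borel_probsD(2)[OF couplingsD(1)[OF assms]] refl]
      measurable_fst_borel measurable_snd_borel)

lemma distr_borel_probs:
  assumes "prob_space Q" "X \<in> Q \<rightarrow>\<^sub>M borel"
  shows "distr Q borel X \<in> borel_probs"
  using assms by (auto simp: borel_probs_def intro: prob_space.prob_space_distr)

lemma joint_coupling:
  fixes X Y :: "'b \<Rightarrow> 'a"
  assumes Q: "prob_space Q" and [measurable]: "X \<in> Q \<rightarrow>\<^sub>M borel" "Y \<in> Q \<rightarrow>\<^sub>M borel"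
  shows "distr Q borel (\<lambda>\<omega>. (X \<omega>, Y \<omega>)) \<in> couplings (distr Q borel X) (distr Q borel Y)"
    and "cost (distr Q borel (\<lambda>\<omega>. (X \<omega>, Y \<omega>))) = (\<integral>\<^sup>+\<omega>. ennreal (c (X \<omega>) (Y \<omega>)) \<partial>Q)"
proof -
  have [measurable]: "(\<lambda>\<omega>. (X \<omega>, Y \<omega>)) \<in> Q \<rightarrow>\<^sub>M borel"
    by (rule measurable_Pair_borel) auto
  show "distr Q borel (\<lambda>\<omega>. (X \<omega>, Y \<omega>)) \<in> couplings (distr Q borel X) (distr Q borel Y)"
    using Q by (auto simp: couplings_def distr_borel_probs distr_distr comp_def)
  show "cost (distr Q borel (\<lambda>\<omega>. (X \<omega>, Y \<omega>))) = (\<integral>\<^sup>+\<omega>. ennreal (c (X \<omega>) (Y \<omega>)) \<partial>Q)"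
    using borel_measurable_c by (simp add: cost_def nn_integral_distr)
qed

text \<open>The form in which glued chains are used: any two variables of a chain yield an upper
  bound for the cost between their laws.\<close>

lemma transport_cost_le_joint:
  fixes X Y :: "'b \<Rightarrow> 'a"
  assumes "prob_space Q" "X \<in> Q \<rightarrow>\<^sub>M borel" "Y \<in> Q \<rightarrow>\<^sub>M borel"
  shows "transport_cost c (distr Q borel X) (distr Q borel Y) \<le> (\<integral>\<^sup>+\<omega>. ennreal (c (X \<omega>) (Y \<omega>)) \<partial>Q)"
  unfolding transport_cost_eq joint_coupling(2)[OF assms, symmetric]
  by (rule INF_lower[OF joint_coupling(1)[OF assms]])

lemma diagonal_coupling:
  assumes "\<mu> \<in> (borel_probs :: 'a measure set)"
  shows "distr \<mu> borel (\<lambda>x. (x, x)) \<in> couplings \<mu> \<mu>"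
proof -
  have "(\<lambda>x. x) \<in> \<mu> \<rightarrow>\<^sub>M borel"
    by (subst measurable_cong_sets[OF borel_probsD(2)[OF assms] refl]) simp
  moreover have "distr \<mu> borel (\<lambda>x. x) = \<mu>"
    using assms by (intro distr_id2) (simp add: borel_probs_def)
  ultimately show ?thesis
    using joint_coupling(1)[of \<mu> "\<lambda>x. x" "\<lambda>x. x"] borel_probsD(1)[OF assms] by simp
qed

lemma transport_cost_self [simp]:
  assumes "\<mu> \<in> (borel_probs :: 'a measure set)"
  shows "transport_cost c \<mu> \<mu> = 0"
proof -
  have "(\<lambda>x. x) \<in> \<mu> \<rightarrow>\<^sub>M borel"
    by (subst measurable_cong_sets[OF borel_probsD(2)[OF assms] refl]) simp
  moreover have "distr \<mu> borel (\<lambda>x. x) = \<mu>"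
    using assms by (intro distr_id2) (simp add: borel_probs_def)
  ultimately show ?thesis
    using transport_cost_le_joint[of \<mu> "\<lambda>x. x" "\<lambda>x. x"] borel_probsD(1)[OF assms] by simp
qed

lemma transport_cost_le_swap: "transport_cost c \<mu> \<nu> \<le> transport_cost c \<nu> \<mu>"
  unfolding transport_cost_eq[of \<nu> \<mu>]
proof (rule INF_greatest)
  fix \<gamma> assume \<gamma>: "\<gamma> \<in> couplings \<nu> \<mu>"
  note m = couplings_measurable[OF \<gamma>]
  show "transport_cost c \<mu> \<nu> \<le> cost \<gamma>"
    using transport_cost_le_joint[OF borel_probsD(1)[OF couplingsD(1)[OF \<gamma>]] m(2) m(1)] couplingsD(2,3)[OF \<gamma>]
    by (simp add: cost_def c_sym[of "snd _"])
qed

lemma transport_cost_sym: "transport_cost c \<mu> \<nu> = transport_cost c \<nu> \<mu>"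
  by (intro antisym transport_cost_le_swap)

lemma glue3:
  assumes \<gamma>: "\<gamma>0 \<in> couplings \<mu>0 \<mu>1" "\<gamma>1 \<in> couplings \<mu>1 \<mu>2" "\<gamma>2 \<in> couplings \<mu>2 (\<mu>3 :: 'a measure)"
    and e: "e > 0"
  obtains Q :: "(nat \<Rightarrow> 'a \<times> 'a) measure" where
    "prob_space Q" "\<And>n. (\<lambda>\<omega>. \<omega> n) \<in> Q \<rightarrow>\<^sub>M borel"
    "distr Q borel (\<lambda>\<omega>. \<omega> 0) = \<gamma>0" "distr Q borel (\<lambda>\<omega>. \<omega> (Suc 0)) = \<gamma>1" "distr Q borel (\<lambda>\<omega>. \<omega> 2) = \<gamma>2"
    "AE \<omega> in Q. c (snd (\<omega> 0)) (fst (\<omega> (Suc 0))) < e \<and> c (snd (\<omega> (Suc 0))) (fst (\<omega> 2)) < e"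
proof -
  have \<mu>3: "\<mu>3 \<in> borel_probs"
    using couplingsD[OF \<gamma>(3)] couplings_measurable[OF \<gamma>(3)] distr_borel_probs borel_probsD(1) by metis
  note d = diagonal_coupling[OF \<mu>3]
  \<comment> \<open>Gluing works on infinite sequences, so the three couplings are continued by
    diagonal couplings of the last marginal, which keep consecutive marginals equal.\<close>
  define G where "G n = (if n = 0 then \<gamma>0 else if n = 1 then \<gamma>1 else if n = 2 then \<gamma>2
     else distr \<mu>3 borel (\<lambda>x. (x, x)))" for n :: nat
  have "G n \<in> borel_probs" for n
    using \<gamma> d by (auto simp: G_def dest: couplingsD)
  moreover have "distr (G n) borel snd = distr (G (Suc n)) borel fst" for n
    using couplingsD[OF \<gamma>(1)] couplingsD[OF \<gamma>(2)] couplingsD[OF \<gamma>(3)] couplingsD[OF d]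
    by (auto simp: G_def numeral_2_eq_2)
  ultimately obtain Q :: "(nat \<Rightarrow> 'a \<times> 'a) measure" where
    Q: "prob_space Q" "\<And>n. (\<lambda>\<omega>. \<omega> n) \<in> Q \<rightarrow>\<^sub>M borel" "\<And>n. distr Q borel (\<lambda>\<omega>. \<omega> n) = G n"
    "\<And>n. AE \<omega> in Q. c (snd (\<omega> n)) (fst (\<omega> (Suc n))) < e"
    using glue_couplings[of G "\<lambda>_. e"] e by blast
  have "AE \<omega> in Q. c (snd (\<omega> 0)) (fst (\<omega> (Suc 0))) < e \<and> c (snd (\<omega> (Suc 0))) (fst (\<omega> 2)) < e"
    using Q(4)[of 0] Q(4)[of 1] by eventually_elim (simp add: numeral_2_eq_2)
  with that[OF Q(1,2)] Q(3)[of 0] Q(3)[of 1] Q(3)[of 2] show thesis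
    by (simp add: G_def)
qed

lemma distr_fst_snd:
  assumes "\<gamma> \<in> couplings \<mu> (\<nu> :: 'a measure)" "distr Q borel Z = \<gamma>" "Z \<in> Q \<rightarrow>\<^sub>M borel"
  shows "distr Q borel (\<lambda>\<omega>. fst (Z \<omega>)) = \<mu>" "distr Q borel (\<lambda>\<omega>. snd (Z \<omega>)) = \<nu>"
    "(\<integral>\<^sup>+\<omega>. ennreal (c (fst (Z \<omega>)) (snd (Z \<omega>))) \<partial>Q) = cost \<gamma>"
proof -
  note couplingsD(2,3)[OF assms(1), folded assms(2)]
  moreover have "distr (distr Q borel Z) borel fst = distr Q borel (\<lambda>\<omega>. fst (Z \<omega>))"
    "distr (distr Q borel Z) borel snd = distr Q borel (\<lambda>\<omega>. snd (Z \<omega>))"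
    by (simp_all add: distr_distr[OF _ assms(3)] comp_def)
  ultimately show "distr Q borel (\<lambda>\<omega>. fst (Z \<omega>)) = \<mu>" "distr Q borel (\<lambda>\<omega>. snd (Z \<omega>)) = \<nu>"
    by simp_all
  show "(\<integral>\<^sup>+\<omega>. ennreal (c (fst (Z \<omega>)) (snd (Z \<omega>))) \<partial>Q) = cost \<gamma>"
    unfolding cost_def assms(2)[symmetric]
    by (rule nn_integral_distr[OF assms(3), symmetric]) (simp add: borel_measurable_c)
qed

text \<open>The constant is \<open>B\<^sup>2\<close> rather than \<open>B\<close> because the gluing is only approximate.\<close>

lemma transport_cost_triangle:
  assumes \<mu>: "\<mu> \<in> borel_probs" and \<sigma>: "\<sigma> \<in> borel_probs" and \<nu>: "\<nu> \<in> borel_probs"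
  shows "transport_cost c \<mu> \<nu> \<le> ennreal (B\<^sup>2) * (transport_cost c \<mu> \<sigma> + transport_cost c \<sigma> \<nu>)"
proof -
  have "transport_cost c \<mu> \<nu> \<le> ennreal (B\<^sup>2) * ((cost \<gamma>0 + cost \<gamma>1) + ennreal e)"
    if \<gamma>: "\<gamma>0 \<in> couplings \<mu> \<sigma>" "\<gamma>1 \<in> couplings \<sigma> \<nu>" and e: "e > 0" for \<gamma>0 \<gamma>1 e
  proof -
    \<comment> \<open>The diagonal coupling of \<nu> fills the third slot of
      \<open>glue3\<close>.\<close>
    obtain Q where Q: "prob_space Q" "\<And>n. (\<lambda>\<omega>. \<omega> n) \<in> Q \<rightarrow>\<^sub>M borel"
      "distr Q borel (\<lambda>\<omega>. \<omega> 0) = \<gamma>0" "distr Q borel (\<lambda>\<omega>. \<omega> (Suc 0)) = \<gamma>1"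
      and close: "AE \<omega> in Q. c (snd (\<omega> 0)) (fst (\<omega> (Suc 0))) < e \<and> c (snd (\<omega> (Suc 0))) (fst (\<omega> 2)) < e"
      using glue3[OF \<gamma> diagonal_coupling[OF \<nu>] e] by blast
    interpret prob_space Q by (rule Q)
    note [measurable] = Q(2) measurable_compose[OF Q(2) measurable_fst_borel] measurable_compose[OF Q(2) measurable_snd_borel]
    note l0 = distr_fst_snd[OF \<gamma>(1) Q(3) Q(2)] and l1 = distr_fst_snd[OF \<gamma>(2) Q(4) Q(2)]
    have "transport_cost c \<mu> \<nu> \<le> (\<integral>\<^sup>+\<omega>. ennreal (c (fst (\<omega> 0)) (snd (\<omega> (Suc 0)))) \<partial>Q)"
      using transport_cost_le_joint[of Q "\<lambda>\<omega>. fst (\<omega> 0)" "\<lambda>\<omega>. snd (\<omega> (Suc 0))"] Q(1) l0 l1 by simp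
    also have "\<dots> \<le> (\<integral>\<^sup>+\<omega>. ennreal (B\<^sup>2) * ((ennreal (c (fst (\<omega> 0)) (snd (\<omega> 0))) +
        ennreal (c (fst (\<omega> (Suc 0))) (snd (\<omega> (Suc 0))))) + ennreal e) \<partial>Q)"
    proof (rule nn_integral_mono_AE)
      show "AE \<omega> in Q. ennreal (c (fst (\<omega> 0)) (snd (\<omega> (Suc 0)))) \<le>
          ennreal (B\<^sup>2) * ((ennreal (c (fst (\<omega> 0)) (snd (\<omega> 0))) +
          ennreal (c (fst (\<omega> (Suc 0))) (snd (\<omega> (Suc 0))))) + ennreal e)"
        using close
      proof eventually_elim
        case (elim \<omega>)
        let ?x = "fst (\<omega> 0)" and ?y = "snd (\<omega> 0)" and ?y' = "fst (\<omega> (Suc 0))" and ?z = "snd (\<omega> (Suc 0))"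
        have "c ?x ?z \<le> B * (c ?x ?y + c ?y ?z)" by (rule c_relaxed)
        \<comment> \<open>The first term receives an extra factor B so that all terms share the
          factor \<open>B\<^sup>2\<close>.\<close>
        also have "\<dots> \<le> B * (B * c ?x ?y + B * (c ?y ?y' + c ?y' ?z))"
        proof -
          have "1 * c ?x ?y \<le> B * c ?x ?y" by (intro mult_right_mono B_ge_1 c_nonneg)
          then show ?thesis
            using B_pos c_relaxed[of ?y ?z ?y'] by (intro mult_left_mono add_mono) auto
        qed
        also have "\<dots> \<le> B * (B * c ?x ?y + B * (e + c ?y' ?z))"
          using B_pos elim by (intro mult_left_mono add_mono) auto
        also have "\<dots> = B\<^sup>2 * ((c ?x ?y + c ?y' ?z) + e)"
          by (simp add: power2_eq_square algebra_simps)
        finally show ?case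
          using e by (simp flip: ennreal_plus ennreal_mult add: ennreal_leI)
      qed
    qed
    also have "\<dots> = ennreal (B\<^sup>2) * ((cost \<gamma>0 + cost \<gamma>1) + ennreal e)"
      by (simp add: nn_integral_cmult nn_integral_add emeasure_space_1 l0 l1)
    finally show ?thesis .
  qed
  note * = this
  show ?thesis
  proof (cases "transport_cost c \<mu> \<sigma> + transport_cost c \<sigma> \<nu> = top")
    case True
    then show ?thesis
      unfolding True using B_pos by (simp add: ennreal_mult_eq_top_iff[THEN iffD2] top_unique ennreal_eq_0_iff)
  next
    case False
    have B2: "B\<^sup>2 > 0" using B_pos by simp
    show ?thesis
    proof (rule ennreal_le_epsilon)
      fix e :: real assume e: "e > 0"
      \<comment> \<open>Two nearly optimal couplings and the gluing lose d each, and the factor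
        \<open>B\<^sup>2\<close> turns 3 d into e.\<close>
      define d where "d = e / (3 * B\<^sup>2)"
      have d: "d > 0" using e B2 by (simp add: d_def)
      have "transport_cost c \<mu> \<sigma> < transport_cost c \<mu> \<sigma> + ennreal d"
        "transport_cost c \<sigma> \<nu> < transport_cost c \<sigma> \<nu> + ennreal d"
        using False d by (auto simp: ennreal_add_eq_top less_top)
      then obtain \<gamma>0 \<gamma>1 where \<gamma>: "\<gamma>0 \<in> couplings \<mu> \<sigma>" "\<gamma>1 \<in> couplings \<sigma> \<nu>"
        "cost \<gamma>0 \<le> transport_cost c \<mu> \<sigma> + ennreal d" "cost \<gamma>1 \<le> transport_cost c \<sigma> \<nu> + ennreal d"
        unfolding transport_cost_less_iff by (meson less_imp_le)
      have "transport_cost c \<mu> \<nu> \<le> ennreal (B\<^sup>2) * ((cost \<gamma>0 + cost \<gamma>1) + ennreal d)"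
        by (rule *[OF \<gamma>(1,2) d])
      also have "\<dots> \<le> ennreal (B\<^sup>2) * (((transport_cost c \<mu> \<sigma> + ennreal d) + (transport_cost c \<sigma> \<nu> + ennreal d)) + ennreal d)"
        by (intro mult_left_mono add_mono \<gamma>) auto
      also have "\<dots> = ennreal (B\<^sup>2) * ((transport_cost c \<mu> \<sigma> + transport_cost c \<sigma> \<nu>) + ennreal (3 * d))"
        using d ennreal_plus[of d d] ennreal_plus[of "2 * d" d] by (simp add: ac_simps)
      also have "\<dots> = ennreal (B\<^sup>2) * (transport_cost c \<mu> \<sigma> + transport_cost c \<sigma> \<nu>) + ennreal e"
        using d B2 by (simp add: distrib_left ennreal_mult[symmetric] d_def)
      finally show "transport_cost c \<mu> \<nu> \<le>
        ennreal (B\<^sup>2) * (transport_cost c \<mu> \<sigma> + transport_cost c \<sigma> \<nu>) + ennreal e" .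
    qed
  qed
qed

section \<open>Finiteness of the transport cost\<close>

lemma product_coupling:
  assumes \<mu>: "\<mu> \<in> borel_probs" and \<nu>: "\<nu> \<in> borel_probs"
  shows "\<mu> \<Otimes>\<^sub>M \<nu> \<in> couplings \<mu> (\<nu> :: 'a measure)"
proof -
  interpret \<mu>: prob_space \<mu> by (rule borel_probsD[OF \<mu>])
  interpret \<nu>: prob_space \<nu> by (rule borel_probsD[OF \<nu>])
  interpret P: pair_prob_space \<mu> \<nu> ..
  have s: "sets (\<mu> \<Otimes>\<^sub>M \<nu>) = sets borel"
    unfolding sets_borel_pair by (intro sets_pair_measure_cong borel_probsD \<mu> \<nu>)
  have "distr (\<mu> \<Otimes>\<^sub>M \<nu>) borel fst = \<mu>" "distr (\<mu> \<Otimes>\<^sub>M \<nu>) borel snd = \<nu>"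
  proof -
    have m: "fst \<in> \<mu> \<Otimes>\<^sub>M \<nu> \<rightarrow>\<^sub>M borel" "snd \<in> \<mu> \<Otimes>\<^sub>M \<nu> \<rightarrow>\<^sub>M borel"
      by (simp_all add: measurable_cong_sets[OF s refl])
    have sp: "space (\<mu> \<Otimes>\<^sub>M \<nu>) = UNIV" using sets_eq_imp_space_eq[OF s] by simp
    show "distr (\<mu> \<Otimes>\<^sub>M \<nu>) borel fst = \<mu>"
    proof (rule measure_eqI)
      fix A assume "A \<in> sets (distr (\<mu> \<Otimes>\<^sub>M \<nu>) borel fst)"
      then have A: "A \<in> sets borel" by simp
      have "fst -` A = A \<times> (UNIV :: 'a set)" by auto
      then show "emeasure (distr (\<mu> \<Otimes>\<^sub>M \<nu>) borel fst) A = emeasure \<mu> A"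
        using A borel_probsD(2)[OF \<mu>] borel_probsD(2)[OF \<nu>] \<nu>.emeasure_space_1 space_borel_probs[OF \<nu>]
        by (simp add: emeasure_distr[OF m(1) A] sp \<nu>.emeasure_pair_measure_Times)
    qed (simp add: borel_probsD[OF \<mu>])
    show "distr (\<mu> \<Otimes>\<^sub>M \<nu>) borel snd = \<nu>"
    proof (rule measure_eqI)
      fix A assume "A \<in> sets (distr (\<mu> \<Otimes>\<^sub>M \<nu>) borel snd)"
      then have A: "A \<in> sets borel" by simp
      have "snd -` A = (UNIV :: 'a set) \<times> A" by auto
      then show "emeasure (distr (\<mu> \<Otimes>\<^sub>M \<nu>) borel snd) A = emeasure \<nu> A"
        using A borel_probsD(2)[OF \<mu>] borel_probsD(2)[OF \<nu>] \<mu>.emeasure_space_1 space_borel_probs[OF \<mu>]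
        by (simp add: emeasure_distr[OF m(2) A] sp \<nu>.emeasure_pair_measure_Times)
    qed (simp add: borel_probsD[OF \<nu>])
  qed
  then show ?thesis
    using s P.prob_space_axioms by (simp add: couplings_def borel_probs_def)
qed

lemma probs_cD: "\<mu> \<in> probs_c c \<Longrightarrow> \<mu> \<in> borel_probs"
  by (simp add: probs_c_def)

lemma borel_measurable_c_probs [measurable]:
  assumes "\<mu> \<in> borel_probs"
  shows "c z \<in> borel_measurable \<mu>"
  by (subst measurable_cong_sets[OF borel_probsD(2)[OF assms] refl]) simp

lemma probs_c_finite:
  assumes "\<mu> \<in> probs_c c"
  shows "(\<integral>\<^sup>+x. ennreal (c z x) \<partial>\<mu>) < \<infinity>"
proof -
  from assms obtain w where w: "(\<integral>\<^sup>+x. ennreal (c w x) \<partial>\<mu>) < \<infinity>" and \<mu>: "\<mu> \<in> borel_probs"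
    by (auto simp: probs_c_def)
  interpret prob_space \<mu> by (rule borel_probsD[OF \<mu>])
  have [measurable]: "c w \<in> borel_measurable \<mu>" by (rule borel_measurable_c_probs[OF \<mu>])
  have "(\<integral>\<^sup>+x. ennreal (c z x) \<partial>\<mu>) \<le> (\<integral>\<^sup>+x. ennreal B * (ennreal (c z w) + ennreal (c w x)) \<partial>\<mu>)"
    using c_relaxed[of z _ w] B_pos
    by (intro nn_integral_mono) (simp flip: ennreal_plus ennreal_mult add: ennreal_leI)
  also have "\<dots> = ennreal B * (ennreal (c z w) + (\<integral>\<^sup>+x. ennreal (c w x) \<partial>\<mu>))"
    by (simp add: nn_integral_cmult nn_integral_add emeasure_space_1)
  also have "\<dots> < \<infinity>"
    using w by (simp add: ennreal_mult_less_top)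
  finally show ?thesis .
qed

text \<open>The product coupling has finite cost: c is dominated by B times the sum of the distances
  to one base point, and each marginal has a finite first moment there.\<close>

lemma transport_cost_finite:
  assumes \<mu>: "\<mu> \<in> probs_c c" and \<nu>: "\<nu> \<in> probs_c c"
  shows "transport_cost c \<mu> \<nu> < \<infinity>"
proof -
  let ?z = "dense_seq 0"
  note b = probs_cD[OF \<mu>] probs_cD[OF \<nu>]
  note \<gamma> = product_coupling[OF b]
  interpret prob_space "\<mu> \<Otimes>\<^sub>M \<nu>" by (rule borel_probsD(1)[OF couplingsD(1)[OF \<gamma>]])
  note [measurable] = couplings_measurable[OF \<gamma>]
  have "transport_cost c \<mu> \<nu> \<le> cost (\<mu> \<Otimes>\<^sub>M \<nu>)"
    unfolding transport_cost_eq by (rule INF_lower[OF \<gamma>])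
  also have "\<dots> \<le> (\<integral>\<^sup>+p. ennreal B * (ennreal (c ?z (fst p)) + ennreal (c ?z (snd p))) \<partial>(\<mu> \<Otimes>\<^sub>M \<nu>))"
    unfolding cost_def using c_relaxed[of _ _ ?z] B_pos
    by (intro nn_integral_mono) (simp flip: ennreal_plus ennreal_mult add: ennreal_leI c_sym[of _ ?z])
  also have "\<dots> = ennreal B * ((\<integral>\<^sup>+p. ennreal (c ?z (fst p)) \<partial>(\<mu> \<Otimes>\<^sub>M \<nu>)) + (\<integral>\<^sup>+p. ennreal (c ?z (snd p)) \<partial>(\<mu> \<Otimes>\<^sub>M \<nu>)))"
    by (simp add: nn_integral_cmult nn_integral_add)
  also have "(\<integral>\<^sup>+p. ennreal (c ?z (fst p)) \<partial>(\<mu> \<Otimes>\<^sub>M \<nu>)) = (\<integral>\<^sup>+x. ennreal (c ?z x) \<partial>\<mu>)"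
    by (subst (2) couplingsD(2)[OF \<gamma>, symmetric]) (simp add: nn_integral_distr)
  also have "(\<integral>\<^sup>+p. ennreal (c ?z (snd p)) \<partial>(\<mu> \<Otimes>\<^sub>M \<nu>)) = (\<integral>\<^sup>+x. ennreal (c ?z x) \<partial>\<nu>)"
    by (subst (2) couplingsD(3)[OF \<gamma>, symmetric]) (simp add: nn_integral_distr)
  also have "ennreal B * ((\<integral>\<^sup>+x. ennreal (c ?z x) \<partial>\<mu>) + (\<integral>\<^sup>+x. ennreal (c ?z x) \<partial>\<nu>)) < \<infinity>"
    using probs_c_finite[OF \<mu>] probs_c_finite[OF \<nu>] by (simp add: ennreal_mult_less_top)
  finally show ?thesis .
qed

section \<open>Transport cost and integrals of C0 functions\<close>

text \<open>Compactness handles pairs that meet K; for pairs outside K both values are below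
  e/2.\<close>

lemma C0_uniformly_continuous:
  assumes \<phi>: "\<phi> \<in> C0" and e: "e > 0"
  shows "\<exists>d>0. \<forall>x y. c x y < d \<longrightarrow> \<bar>\<phi> x - \<phi> y\<bar> < (e::real)"
proof -
  obtain K where K: "compact K" "\<And>x. x \<notin> K \<Longrightarrow> \<bar>\<phi> x\<bar> < e / 2"
    using \<phi> half_gt_zero[OF e] unfolding C0_def by blast
  have "\<exists>r>0. \<forall>y. c x y < r \<longrightarrow> \<bar>\<phi> y - \<phi> x\<bar> < e / 2" for x
  proof -
    have "(\<phi> \<longlongrightarrow> \<phi> x) (nhds x)"
      using \<phi> by (simp add: C0_def continuous_on_def tendsto_at_iff_tendsto_nhds)
    then have "\<forall>\<^sub>F y in nhds x. dist (\<phi> y) (\<phi> x) < e / 2"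
      using e by (intro tendstoD) auto
    then show ?thesis by (simp add: eventually_nhds_iff dist_real_def)
  qed
  then obtain r where r: "\<And>x. r x > 0" "\<And>x y. c x y < r x \<Longrightarrow> \<bar>\<phi> y - \<phi> x\<bar> < e / 2" by metis
  have cover: "K \<subseteq> (\<Union>x\<in>K. c_ball x (r x / (2*B)))"
  proof
    fix x assume "x \<in> K"
    moreover have "x \<in> c_ball x (r x / (2*B))" using r(1)[of x] B_pos by simp
    ultimately show "x \<in> (\<Union>x\<in>K. c_ball x (r x / (2*B)))" by (rule UN_I)
  qed
  obtain F where F: "F \<subseteq> K" "finite F" "K \<subseteq> (\<Union>x\<in>F. c_ball x (r x / (2*B)))"
    by (rule compactE_image[OF K(1) open_c_ball cover])
  \<comment> \<open>A Lebesgue number of the cover; the 1 keeps the minimum defined when F is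
    empty.\<close>
  define d where "d = Min (insert 1 ((\<lambda>x. r x / (2*B)) ` F))"
  have d: "d > 0" "\<And>x. x \<in> F \<Longrightarrow> d \<le> r x / (2*B)"
    using F(2) r(1) B_pos by (auto simp: d_def)
  have K1: "\<bar>\<phi> x - \<phi> y\<bar> < e" if "x \<in> K" "c x y < d" for x y
  proof -
    obtain z where z: "z \<in> F" "c z x < r z / (2*B)" using F(3) \<open>x \<in> K\<close> by auto
    then have "c x y < r z / (2*B)" using d(2) that(2) by fastforce
    then have "c z y < r z" using z c_lt by blast
    moreover have "c z x < r z" using c_lt[of z x "r z" x] z r(1)[of z] B_pos by simp
    ultimately show ?thesis using r(2)[of z x] r(2)[of z y] by linarith
  qed
  have "\<bar>\<phi> x - \<phi> y\<bar> < e" if "c x y < d" for x y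
  proof (cases "x \<in> K \<or> y \<in> K")
    case True
    then show ?thesis using K1[of x y] K1[of y x] that by (auto simp: c_sym abs_minus_commute)
  next
    case False
    then show ?thesis using K(2)[of x] K(2)[of y] by auto
  qed
  with d(1) show ?thesis by blast
qed

text \<open>Under any coupling the difference of the values of \<phi> is below e/2 when c is below d
  and at most 2 b otherwise, hence at most e/2 + (2 b/d) c throughout. Integration leaves a bound by
  the cost, uniform in the two measures.\<close>

lemma integral_C0_close:
  assumes \<phi>: "\<phi> \<in> C0" and e: "e > 0"
  shows "\<exists>d>0. \<forall>\<mu> \<nu>. transport_cost c \<mu> \<nu> < ennreal d \<longrightarrow>
    \<bar>(\<integral>x. \<phi> x \<partial>\<mu>) - (\<integral>x. \<phi> x \<partial>\<nu>)\<bar> < (e :: real)"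
proof -
  obtain d where d: "d > 0" "\<And>x y. c x y < d \<Longrightarrow> \<bar>\<phi> x - \<phi> y\<bar> < e / 2"
    using C0_uniformly_continuous[OF \<phi>, of "e / 2"] e by auto
  obtain b where b: "b \<ge> 0" "\<And>x. \<bar>\<phi> x\<bar> \<le> b" using bcontfun_bounded[OF C0_bcontfun[OF \<phi>]] by blast
  \<comment> \<open>Chosen so that (2 b/d) r is at most e/4; b + 1 avoids division by zero.\<close>
  define r where "r = d * e / (8 * (b + 1))"
  have r: "r > 0" using d e b by (simp add: r_def)
  have "\<bar>(\<integral>x. \<phi> x \<partial>\<mu>) - (\<integral>x. \<phi> x \<partial>\<nu>)\<bar> < e" if less: "transport_cost c \<mu> \<nu> < ennreal r" for \<mu> \<nu>
  proof -
    obtain \<gamma> where \<gamma>: "\<gamma> \<in> couplings \<mu> \<nu>" "cost \<gamma> < ennreal r"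
      using less unfolding transport_cost_less_iff by blast
    interpret prob_space \<gamma> by (rule borel_probsD(1)[OF couplingsD(1)[OF \<gamma>(1)]])
    note [measurable] = couplings_measurable[OF \<gamma>(1)] borel_measurable_bcontfun[OF C0_bcontfun[OF \<phi>]]
    have i1: "integrable \<gamma> (\<lambda>z. \<phi> (fst z))" "integrable \<gamma> (\<lambda>z. \<phi> (snd z))"
      using b(2) by (auto intro!: integrable_const_bound[where B=b])
    have i2: "integrable \<gamma> (\<lambda>z. c (fst z) (snd z))"
      using \<gamma>(2) by (intro integrableI_nonneg) (auto simp: cost_def less_top[symmetric] top_unique)
    have cost_eq: "cost \<gamma> = ennreal (\<integral>z. c (fst z) (snd z) \<partial>\<gamma>)"
      unfolding cost_def using i2 by (intro nn_integral_eq_integral) auto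
    have "(\<integral>z. c (fst z) (snd z) \<partial>\<gamma>) < r"
      using \<gamma>(2) r unfolding cost_eq by (simp add: ennreal_less_iff)
    then have lt: "2 * b / d * (\<integral>z. c (fst z) (snd z) \<partial>\<gamma>) \<le> 2 * b / d * r"
      using b d by (intro mult_left_mono) auto
    have e1: "(\<integral>x. \<phi> x \<partial>\<mu>) = (\<integral>z. \<phi> (fst z) \<partial>\<gamma>)"
      by (subst couplingsD(2)[OF \<gamma>(1), symmetric]) (simp add: integral_distr)
    have e2: "(\<integral>x. \<phi> x \<partial>\<nu>) = (\<integral>z. \<phi> (snd z) \<partial>\<gamma>)"
      by (subst couplingsD(3)[OF \<gamma>(1), symmetric]) (simp add: integral_distr)
    have "\<bar>(\<integral>x. \<phi> x \<partial>\<mu>) - (\<integral>x. \<phi> x \<partial>\<nu>)\<bar> = \<bar>\<integral>z. \<phi> (fst z) - \<phi> (snd z) \<partial>\<gamma>\<bar>"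
      by (simp add: e1 e2 i1)
    also have "\<dots> \<le> (\<integral>z. \<bar>\<phi> (fst z) - \<phi> (snd z)\<bar> \<partial>\<gamma>)"
      by (rule integral_abs_bound)
    also have "\<dots> \<le> (\<integral>z. e / 2 + 2 * b / d * c (fst z) (snd z) \<partial>\<gamma>)"
    proof (rule integral_mono)
      fix z
      show "\<bar>\<phi> (fst z) - \<phi> (snd z)\<bar> \<le> e / 2 + 2 * b / d * c (fst z) (snd z)"
      proof (cases "c (fst z) (snd z) < d")
        case True
        then show ?thesis using d(2)[OF True] d(1) b by (smt (verit) c_nonneg divide_nonneg_nonneg mult_nonneg_nonneg)
      next
        case False
        have "2 * b / d * d \<le> 2 * b / d * c (fst z) (snd z)"
          using False b d by (intro mult_left_mono) auto
        then show ?thesis using b(2)[of "fst z"] b(2)[of "snd z"] d e by simp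
      qed
    qed (use i1 i2 in auto)
    also have "\<dots> = e / 2 + 2 * b / d * (\<integral>z. c (fst z) (snd z) \<partial>\<gamma>)"
      using i2 by (simp add: prob_space)
    also have "\<dots> \<le> e / 2 + 2 * b / d * r" using lt by simp
    also have "\<dots> < e"
    proof -
      have "2 * b / d * r = (e / 4) * (b / (b + 1))" using d b by (simp add: r_def field_simps)
      also have "\<dots> \<le> (e / 4) * 1" using b e by (intro mult_left_mono) auto
      finally show ?thesis using e by linarith
    qed
    finally show ?thesis .
  qed
  with r show ?thesis by blast
qed

text \<open>The vanishing infimum is not known to be attained, so the argument passes through
  \<open>C0\<close> integrals instead of an optimal coupling.\<close>

lemma transport_cost_0_imp_eq:
  assumes "\<mu> \<in> borel_probs" "\<nu> \<in> borel_probs" "transport_cost c \<mu> \<nu> = 0"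
  shows "\<mu> = \<nu>"
proof (rule measure_eqI_C0[OF assms(1,2)])
  fix \<phi> :: "'a \<Rightarrow> real" assume \<phi>: "\<phi> \<in> C0"
  have "\<bar>(\<integral>x. \<phi> x \<partial>\<mu>) - (\<integral>x. \<phi> x \<partial>\<nu>)\<bar> \<le> e" if "e > 0" for e
    using integral_C0_close[OF \<phi> that] assms(3) by (metis ennreal_less_zero_iff less_imp_le)
  then have "\<bar>(\<integral>x. \<phi> x \<partial>\<mu>) - (\<integral>x. \<phi> x \<partial>\<nu>)\<bar> \<le> 0" by (rule field_le_epsilon[where y=0, simplified])
  then show "(\<integral>x. \<phi> x \<partial>\<mu>) = (\<integral>x. \<phi> x \<partial>\<nu>)" by simp
qed

section \<open>Lower semicontinuity of the transport cost\<close>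

text \<open>A Lebesgue number argument on K x K. Only x and y are confined to K: in the application
  x' and y' are values of perturbed variables, about which no compactness is known.\<close>

lemma c_modulus_on_compact:
  assumes K: "compact K" and e: "e > 0"
  shows "\<exists>r>0. \<forall>x\<in>K. \<forall>y\<in>K. \<forall>x' y'. c x x' < r \<longrightarrow> c y y' < r \<longrightarrow> \<bar>c x' y' - c x y\<bar> < e"
proof -
  have "\<forall>p. \<exists>r>0. \<forall>x' y'. c (fst p) x' < r \<longrightarrow> c (snd p) y' < r \<longrightarrow> \<bar>c x' y' - c (fst p) (snd p)\<bar> < e / 2"
    by (intro allI c_continuous_at half_gt_zero e)
  then obtain r where r: "\<And>p. r p > 0" "\<And>p x' y'. c (fst p) x' < r p \<Longrightarrow> c (snd p) y' < r p \<Longrightarrow>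
      \<bar>c x' y' - c (fst p) (snd p)\<bar> < e / 2"
    by metis
  define s where "s p = r p / (2*B)" for p
  have s: "s p > 0" "s p \<le> r p" for p
    using r(1)[of p] B_ge_1 by (auto simp: s_def field_simps)
  have cover: "K \<times> K \<subseteq> (\<Union>p\<in>K \<times> K. c_ball (fst p) (s p) \<times> c_ball (snd p) (s p))"
  proof
    fix p assume "p \<in> K \<times> K"
    moreover have "p \<in> c_ball (fst p) (s p) \<times> c_ball (snd p) (s p)" using s(1)[of p] by (auto simp: mem_Times_iff)
    ultimately show "p \<in> (\<Union>p\<in>K \<times> K. c_ball (fst p) (s p) \<times> c_ball (snd p) (s p))" by (rule UN_I)
  qed
  obtain F where F: "F \<subseteq> K \<times> K" "finite F" "K \<times> K \<subseteq> (\<Union>p\<in>F. c_ball (fst p) (s p) \<times> c_ball (snd p) (s p))"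
    by (rule compactE_image[OF compact_Times[OF K K] _ cover]) (auto intro!: open_Times open_c_ball)
  define d where "d = Min (insert 1 (s ` F))"
  have d: "d > 0" "\<And>p. p \<in> F \<Longrightarrow> d \<le> s p"
    using F(2) s(1) by (auto simp: d_def)
  have "\<bar>c x' y' - c x y\<bar> < e" if xy: "x \<in> K" "y \<in> K" "c x x' < d" "c y y' < d" for x y x' y'
  proof -
    obtain p where p: "p \<in> F" "c (fst p) x < s p" "c (snd p) y < s p" using F(3) xy(1,2) by fastforce
    have "c x x' < s p" "c y y' < s p" using d(2)[OF p(1)] xy by auto
    then have "c (fst p) x' < r p" "c (snd p) y' < r p"
      using p(2,3) c_lt[of "fst p" x "r p" x'] c_lt[of "snd p" y "r p" y'] by (auto simp: s_def)
    moreover have "c (fst p) x < r p" "c (snd p) y < r p" using p(2,3) s(2)[of p] by auto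
    ultimately show ?thesis using r(2)[of p x' y'] r(2)[of p x y] by linarith
  qed
  with d(1) show ?thesis by blast
qed

text \<open>Finite unions of good base balls increase to the whole space, so tightness is continuity
  of the measures along them. The open set provides a Borel event, the compact set around it the
  uniform modulus of c.\<close>

lemma tight_pair:
  fixes \<mu> \<nu> :: "'a measure"
  assumes \<mu>: "\<mu> \<in> borel_probs" and \<nu>: "\<nu> \<in> borel_probs" and e: "e > 0"
  shows "\<exists>U K. open U \<and> compact K \<and> U \<subseteq> K \<and> measure \<mu> (- U) < e \<and> measure \<nu> (- U) < e"
proof -
  define G where "G n = {p\<in>good_base. fst p \<le> n \<and> snd p \<le> n}" for n
  define U where "U n = (\<Union>p\<in>G n. base_ball p)" for n
  have fin: "finite (G n)" for n
    by (rule finite_subset[of _ "{..n} \<times> {..n}"]) (auto simp: G_def)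
  have U: "open (U n)" "incseq U" for n
    by (auto simp: U_def G_def incseq_def intro!: open_UN open_base_ball intro: order_trans)
  have UN: "(\<Union>n. U n) = UNIV"
  proof (rule UNIV_eq_I[symmetric])
    fix x
    obtain p where "p \<in> good_base" "x \<in> base_ball p" using good_base[of UNIV x] by auto
    then have "x \<in> U (max (fst p) (snd p))"
      unfolding U_def G_def by (intro UN_I[of p]) auto
    then show "x \<in> (\<Union>n. U n)" by blast
  qed
  have lim: "(\<lambda>n. measure \<sigma> (- U n)) \<longlonglongrightarrow> 0" if \<sigma>: "\<sigma> \<in> borel_probs" for \<sigma>
  proof -
    interpret prob_space \<sigma> by (rule borel_probsD[OF \<sigma>])
    have s: "range U \<subseteq> sets \<sigma>" using U(1) borel_probsD(2)[OF \<sigma>] by auto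
    have "(\<lambda>n. measure \<sigma> (U n)) \<longlonglongrightarrow> 1"
      using finite_Lim_measure_incseq[OF s U(2)] prob_space by (simp add: UN space_borel_probs[OF \<sigma>])
    then have "(\<lambda>n. 1 - measure \<sigma> (U n)) \<longlonglongrightarrow> 1 - 1" by (intro tendsto_intros)
    moreover have "measure \<sigma> (- U n) = 1 - measure \<sigma> (U n)" for n
      using prob_compl[of "U n"] s by (auto simp: space_borel_probs[OF \<sigma>] Compl_eq_Diff_UNIV)
    ultimately show ?thesis by simp
  qed
  have "\<forall>\<^sub>F n in sequentially. measure \<mu> (- U n) < e \<and> measure \<nu> (- U n) < e"
    using order_tendstoD(2)[OF lim[OF \<mu>] e] order_tendstoD(2)[OF lim[OF \<nu>] e] by (rule eventually_conj)
  then obtain n where n: "measure \<mu> (- U n) < e \<and> measure \<nu> (- U n) < e"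
    using eventually_happens'[OF sequentially_bot] by blast
  obtain K where "compact K" "U n \<subseteq> K"
    using compact_UN_good[OF fin[of n]] unfolding U_def by (auto simp: G_def)
  with n U(1) show ?thesis by blast
qed

text \<open>Since \<open>ennreal\<close> sends negative numbers to 0, the integrand is the excess of
  \<open>c z\<close> over M; it is dominated by \<open>c z\<close> and eventually 0 at every
  point.\<close>

lemma first_moment_tail:
  assumes \<mu>: "\<mu> \<in> probs_c c" and e: "e > (0::real)"
  shows "\<exists>N::nat. \<forall>M\<ge>real N. (\<integral>\<^sup>+x. ennreal (c z x - M) \<partial>\<mu>) < ennreal e"
proof -
  have [measurable]: "c z \<in> borel_measurable \<mu>" by (rule borel_measurable_c_probs[OF probs_cD[OF \<mu>]])
  have "(\<lambda>n. \<integral>\<^sup>+x. ennreal (c z x - real n) \<partial>\<mu>) \<longlonglongrightarrow> (\<integral>\<^sup>+x. 0 \<partial>\<mu>)"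
  proof (rule nn_integral_dominated_convergence[where w="\<lambda>x. ennreal (c z x)"])
    show "AE x in \<mu>. (\<lambda>n. ennreal (c z x - real n)) \<longlonglongrightarrow> 0"
    proof (rule AE_I2)
      fix x
      obtain N :: nat where "c z x \<le> N" using real_arch_simple by blast
      then have "ennreal (c z x - real n) = 0" if "n \<ge> N" for n
        using that by (intro ennreal_neg) simp
      then show "(\<lambda>n. ennreal (c z x - real n)) \<longlonglongrightarrow> 0"
        by (intro tendsto_eventually eventually_sequentiallyI[of N])
    qed
  qed (use probs_c_finite[OF \<mu>] in \<open>auto intro!: AE_I2 ennreal_leI\<close>)
  then have "\<forall>\<^sub>F n in sequentially. (\<integral>\<^sup>+x. ennreal (c z x - real n) \<partial>\<mu>) < ennreal e"
    using e by (intro order_tendstoD(2)) auto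
  then obtain N :: nat where N: "(\<integral>\<^sup>+x. ennreal (c z x - real N) \<partial>\<mu>) < ennreal e"
    using eventually_happens'[OF sequentially_bot] by blast
  have "(\<integral>\<^sup>+x. ennreal (c z x - M) \<partial>\<mu>) < ennreal e" if "M \<ge> real N" for M
    using that by (intro le_less_trans[OF nn_integral_mono N] ennreal_leI) auto
  then show ?thesis by blast
qed

text \<open>A glued chain X, X0, X1, Y1, Y0, Y joins cheap couplings of \<mu> with \<mu>' and of
  \<nu>' with \<nu> through a nearly optimal one of \<mu>' with \<nu>'. With high probability X and
  Y lie in a compact set and are moved little, so c at (X, Y) exceeds c at (X1, Y1) by at most e1.
  On the exceptional event c at (X, Y) is bounded through a base point, with tails of \<mu> and
  \<nu> alone; hence d does not depend on \<mu>' and \<nu>'.\<close>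

lemma transport_cost_lsc:
  assumes \<mu>: "\<mu> \<in> probs_c c" and \<nu>: "\<nu> \<in> probs_c c" and e: "e > 0"
  shows "\<exists>d>0. \<forall>\<mu>' \<nu>'. transport_cost c \<mu> \<mu>' < ennreal d \<longrightarrow> transport_cost c \<nu> \<nu>' < ennreal d \<longrightarrow>
    transport_cost c \<mu> \<nu> \<le> transport_cost c \<mu>' \<nu>' + ennreal e"
proof -
  define z where "z = dense_seq 0"
  note pr = probs_cD[OF \<mu>] probs_cD[OF \<nu>]
  \<comment> \<open>Budget: 2 e1 \<le> e/4 from near-optimality and the modulus of c, 2 B e1 = e/4
    from the two tails and, with \<open>e2\<close> below, 8 B M e2 = e/4 from the four exceptional
    events.\<close>
  define e1 where "e1 = e / (8*B)"
  have e1: "e1 > 0" "e1 \<le> e / 8" using e B_ge_1 by (auto simp: e1_def field_simps)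
  obtain N1 N2 :: nat where N: "\<And>M. M \<ge> real N1 \<Longrightarrow> (\<integral>\<^sup>+x. ennreal (c z x - M) \<partial>\<mu>) < ennreal e1"
      "\<And>M. M \<ge> real N2 \<Longrightarrow> (\<integral>\<^sup>+x. ennreal (c z x - M) \<partial>\<nu>) < ennreal e1"
    using first_moment_tail[OF \<mu> e1(1)] first_moment_tail[OF \<nu> e1(1)] by meson
  define M where "M = real N1 + real N2 + 1"
  have M: "M > 0" "(\<integral>\<^sup>+x. ennreal (c z x - M) \<partial>\<mu>) < ennreal e1" "(\<integral>\<^sup>+x. ennreal (c z x - M) \<partial>\<nu>) < ennreal e1"
    using N(1)[of M] N(2)[of M] by (auto simp: M_def)
  define e2 where "e2 = e / (32 * B * M)"
  have e2: "e2 > 0" using e M B_pos by (simp add: e2_def)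
  obtain U K where U: "open U" "compact K" "U \<subseteq> K" "measure \<mu> (- U) < e2" "measure \<nu> (- U) < e2"
    using tight_pair[OF pr e2] by blast
  obtain r where r: "r > 0" "\<And>x y x' y'. x \<in> K \<Longrightarrow> y \<in> K \<Longrightarrow> c x x' < r \<Longrightarrow> c y y' < r \<Longrightarrow> \<bar>c x' y' - c x y\<bar> < e1"
    using c_modulus_on_compact[OF U(2) e1(1)] by blast
  \<comment> \<open>The coupling moves X by less than q and the gluing by less than q again;
    \<open>c_lt\<close> turns this into r.\<close>
  define q where "q = r / (2*B)"
  have q: "q > 0" using r B_pos by (simp add: q_def)
  \<comment> \<open>Markov's inequality: a cost below e2 q leaves probability at most e2 for a move
    of size q or more.\<close>
  define d where "d = e2 * q"
  have d: "d > 0" using e2 q by (simp add: d_def)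
  have "transport_cost c \<mu> \<nu> \<le> transport_cost c \<mu>' \<nu>' + ennreal e"
    if less: "transport_cost c \<mu> \<mu>' < ennreal d" "transport_cost c \<nu> \<nu>' < ennreal d" for \<mu>' \<nu>'
  proof (cases "transport_cost c \<mu>' \<nu>' = top")
    case False
    obtain \<gamma>0 where \<gamma>0: "\<gamma>0 \<in> couplings \<mu> \<mu>'" "cost \<gamma>0 < ennreal d"
      using less unfolding transport_cost_less_iff by blast
    obtain \<gamma>2 where \<gamma>2: "\<gamma>2 \<in> couplings \<nu>' \<nu>" "cost \<gamma>2 < ennreal d"
      using less unfolding transport_cost_sym[of \<nu>] transport_cost_less_iff by blast
    have "transport_cost c \<mu>' \<nu>' < transport_cost c \<mu>' \<nu>' + ennreal e1"
      using False e1 by (auto simp: less_top)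
    then obtain \<gamma>1 where \<gamma>1: "\<gamma>1 \<in> couplings \<mu>' \<nu>'" "cost \<gamma>1 < transport_cost c \<mu>' \<nu>' + ennreal e1"
      unfolding transport_cost_less_iff by blast
    obtain Q where Q: "prob_space Q" "\<And>n. (\<lambda>\<omega>. \<omega> n) \<in> Q \<rightarrow>\<^sub>M borel"
      "distr Q borel (\<lambda>\<omega>. \<omega> 0) = \<gamma>0" "distr Q borel (\<lambda>\<omega>. \<omega> (Suc 0)) = \<gamma>1" "distr Q borel (\<lambda>\<omega>. \<omega> 2) = \<gamma>2"
      and close: "AE \<omega> in Q. c (snd (\<omega> 0)) (fst (\<omega> (Suc 0))) < q \<and> c (snd (\<omega> (Suc 0))) (fst (\<omega> 2)) < q"
      using glue3[OF \<gamma>0(1) \<gamma>1(1) \<gamma>2(1) q] by blast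
    interpret prob_space Q by (rule Q)
    note [measurable] = Q(2) measurable_compose[OF Q(2) measurable_fst_borel] measurable_compose[OF Q(2) measurable_snd_borel]
    note l0 = distr_fst_snd[OF \<gamma>0(1) Q(3) Q(2)] and l1 = distr_fst_snd[OF \<gamma>1(1) Q(4) Q(2)]
      and l2 = distr_fst_snd[OF \<gamma>2(1) Q(5) Q(2)]
    define X X0 X1 Y1 Y0 Y where "X \<omega> = fst (\<omega> 0)" and "X0 \<omega> = snd (\<omega> 0)" and "X1 \<omega> = fst (\<omega> (Suc 0))"
      and "Y1 \<omega> = snd (\<omega> (Suc 0))" and "Y0 \<omega> = fst (\<omega> 2)" and "Y \<omega> = snd (\<omega> 2)" for \<omega> :: "nat \<Rightarrow> 'a \<times> 'a"
    have [measurable]: "X \<in> Q \<rightarrow>\<^sub>M borel" "X0 \<in> Q \<rightarrow>\<^sub>M borel" "X1 \<in> Q \<rightarrow>\<^sub>M borel"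
      "Y1 \<in> Q \<rightarrow>\<^sub>M borel" "Y0 \<in> Q \<rightarrow>\<^sub>M borel" "Y \<in> Q \<rightarrow>\<^sub>M borel"
      unfolding X_def X0_def X1_def Y1_def Y0_def Y_def by measurable
    note l0 = l0[folded X_def X0_def] and l1 = l1[folded X1_def Y1_def] and l2 = l2[folded Y0_def Y_def]
    note close = close[folded X_def X0_def X1_def Y1_def Y0_def Y_def]
    define b1 b2 b3 b4 where "b1 = {\<omega>\<in>space Q. X \<omega> \<notin> U}" and "b2 = {\<omega>\<in>space Q. Y \<omega> \<notin> U}"
      and "b3 = {\<omega>\<in>space Q. c (X \<omega>) (X0 \<omega>) \<ge> q}" and "b4 = {\<omega>\<in>space Q. c (Y0 \<omega>) (Y \<omega>) \<ge> q}"
    have [measurable]: "U \<in> sets borel" using U(1) by simp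
    have [measurable]: "b1 \<in> sets Q" "b2 \<in> sets Q" "b3 \<in> sets Q" "b4 \<in> sets Q"
      unfolding b1_def b2_def b3_def b4_def by measurable
    have m1: "emeasure Q b1 \<le> ennreal e2"
    proof -
      have "b1 = X -` (- U) \<inter> space Q" by (auto simp: b1_def)
      then have "emeasure Q b1 = emeasure \<mu> (- U)" using l0(1) by (subst l0(1)[symmetric], subst emeasure_distr) auto
      also have "\<dots> \<le> ennreal e2"
        using U(4) finite_measure.emeasure_eq_measure[OF prob_space.finite_measure[OF borel_probsD(1)[OF pr(1)]]]
        by (simp add: ennreal_leI)
      finally show ?thesis .
    qed
    have m2: "emeasure Q b2 \<le> ennreal e2"
    proof -
      have "b2 = Y -` (- U) \<inter> space Q" by (auto simp: b2_def)
      then have "emeasure Q b2 = emeasure \<nu> (- U)" by (subst l2(2)[symmetric], subst emeasure_distr) auto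
      also have "\<dots> \<le> ennreal e2"
        using U(5) finite_measure.emeasure_eq_measure[OF prob_space.finite_measure[OF borel_probsD(1)[OF pr(2)]]]
        by (simp add: ennreal_leI)
      finally show ?thesis .
    qed
    have markov: "emeasure Q {\<omega>\<in>space Q. f \<omega> \<ge> q} \<le> ennreal e2"
      if f: "f \<in> borel_measurable Q" "(\<integral>\<^sup>+\<omega>. ennreal (f \<omega>) \<partial>Q) < ennreal d" for f
    proof -
      have "ennreal q * emeasure Q {\<omega>\<in>space Q. f \<omega> \<ge> q} = (\<integral>\<^sup>+\<omega>. ennreal q * indicator {\<omega>\<in>space Q. f \<omega> \<ge> q} \<omega> \<partial>Q)"
        using f(1) by (subst nn_integral_cmult_indicator) auto
      also have "\<dots> \<le> (\<integral>\<^sup>+\<omega>. ennreal (f \<omega>) \<partial>Q)"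
        by (intro nn_integral_mono) (auto simp: indicator_def ennreal_leI)
      also have "\<dots> \<le> ennreal q * ennreal e2"
        using f(2) q e2 by (simp add: d_def mult.commute flip: ennreal_mult)
      finally show ?thesis
        using q by (simp add: ennreal_mult_le_mult_iff)
    qed
    have m3: "emeasure Q b3 \<le> ennreal e2" unfolding b3_def using \<gamma>0(2) l0(3) by (intro markov) auto
    have m4: "emeasure Q b4 \<le> ennreal e2" unfolding b4_def using \<gamma>2(2) l2(3) by (intro markov) auto
    \<comment> \<open>At least 1 on the union of the exceptional events; overlaps need no
      attention.\<close>
    let ?h = "\<lambda>\<omega>. (indicator b1 \<omega> + indicator b2 \<omega>) + (indicator b3 \<omega> + indicator b4 \<omega>) :: ennreal"
    have "transport_cost c \<mu> \<nu> \<le> (\<integral>\<^sup>+\<omega>. ennreal (c (X \<omega>) (Y \<omega>)) \<partial>Q)"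
      using transport_cost_le_joint[of Q X Y] Q(1) l0 l2 by simp
    also have "\<dots> \<le> (\<integral>\<^sup>+\<omega>. (ennreal (c (X1 \<omega>) (Y1 \<omega>)) + ennreal e1) +
        ennreal B * ((ennreal (c z (X \<omega>) - M) + ennreal (c z (Y \<omega>) - M)) + ennreal (2 * M) * ?h \<omega>) \<partial>Q)"
    proof (rule nn_integral_mono_AE)
      show "AE \<omega> in Q. ennreal (c (X \<omega>) (Y \<omega>)) \<le> (ennreal (c (X1 \<omega>) (Y1 \<omega>)) + ennreal e1) +
        ennreal B * ((ennreal (c z (X \<omega>) - M) + ennreal (c z (Y \<omega>) - M)) + ennreal (2 * M) * ?h \<omega>)"
        using close AE_space
      proof eventually_elim
        case (elim \<omega>)
        show ?case
        proof (cases "\<omega> \<in> b1 \<or> \<omega> \<in> b2 \<or> \<omega> \<in> b3 \<or> \<omega> \<in> b4")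
          case True
          then have h: "1 \<le> ?h \<omega>"
            by (auto simp: indicator_def add_increasing add_increasing2)
          have "c (X \<omega>) (Y \<omega>) \<le> B * (c z (X \<omega>) + c z (Y \<omega>))"
            using c_relaxed[of "X \<omega>" "Y \<omega>" z] c_sym[of z "X \<omega>"] by simp
          \<comment> \<open>Each distance to z is split into its excess over M and a part of size at
            most M.\<close>
          also have "\<dots> \<le> B * ((max 0 (c z (X \<omega>) - M) + max 0 (c z (Y \<omega>) - M)) + 2 * M)"
            using B_pos by (intro mult_left_mono) auto
          finally have "ennreal (c (X \<omega>) (Y \<omega>)) \<le> ennreal (B * ((max 0 (c z (X \<omega>) - M) + max 0 (c z (Y \<omega>) - M)) + 2 * M))"
            by (rule ennreal_leI)
          also have "\<dots> = ennreal B * ((ennreal (c z (X \<omega>) - M) + ennreal (c z (Y \<omega>) - M)) + ennreal (2 * M))"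
            using B_pos M(1) by (simp add: ennreal_mult ennreal_plus ennreal_max_0)
          also have "\<dots> \<le> ennreal B * ((ennreal (c z (X \<omega>) - M) + ennreal (c z (Y \<omega>) - M)) + ennreal (2 * M) * ?h \<omega>)"
            using mult_left_mono[OF h, of "ennreal (2 * M)"] by (intro mult_left_mono add_left_mono) auto
          also have "\<dots> \<le> (ennreal (c (X1 \<omega>) (Y1 \<omega>)) + ennreal e1) + \<dots>"
            by (rule add_increasing) auto
          finally show ?thesis .
        next
          case False
          then have ok: "X \<omega> \<in> K" "Y \<omega> \<in> K" "c (X \<omega>) (X0 \<omega>) < q" "c (Y0 \<omega>) (Y \<omega>) < q"
            using elim U(3) by (auto simp: b1_def b2_def b3_def b4_def)
          have "c (X \<omega>) (X1 \<omega>) < r" "c (Y1 \<omega>) (Y \<omega>) < r"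
            using elim ok by (auto simp: q_def intro: c_lt)
          then have "c (X \<omega>) (Y \<omega>) \<le> c (X1 \<omega>) (Y1 \<omega>) + e1"
            using r(2)[OF ok(1,2), of "X1 \<omega>" "Y1 \<omega>"] c_sym[of "Y1 \<omega>"] by simp
          then have "ennreal (c (X \<omega>) (Y \<omega>)) \<le> ennreal (c (X1 \<omega>) (Y1 \<omega>)) + ennreal e1"
            using e1 by (simp add: ennreal_leI flip: ennreal_plus)
          then show ?thesis by (rule add_increasing2[rotated]) simp
        qed
      qed
    qed
    also have "\<dots> = (cost \<gamma>1 + ennreal e1) + ennreal B * (((\<integral>\<^sup>+\<omega>. ennreal (c z (X \<omega>) - M) \<partial>Q) + (\<integral>\<^sup>+\<omega>. ennreal (c z (Y \<omega>) - M) \<partial>Q))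
        + ennreal (2 * M) * ((emeasure Q b1 + emeasure Q b2) + (emeasure Q b3 + emeasure Q b4)))"
      by (simp add: nn_integral_add nn_integral_cmult emeasure_space_1 l1(3))
    also have "(\<integral>\<^sup>+\<omega>. ennreal (c z (X \<omega>) - M) \<partial>Q) = (\<integral>\<^sup>+x. ennreal (c z x - M) \<partial>\<mu>)"
      by (subst l0(1)[symmetric], subst nn_integral_distr) auto
    also have "(\<integral>\<^sup>+\<omega>. ennreal (c z (Y \<omega>) - M) \<partial>Q) = (\<integral>\<^sup>+x. ennreal (c z x - M) \<partial>\<nu>)"
      by (subst l2(2)[symmetric], subst nn_integral_distr) auto
    also have "(cost \<gamma>1 + ennreal e1) + ennreal B * (((\<integral>\<^sup>+x. ennreal (c z x - M) \<partial>\<mu>) + (\<integral>\<^sup>+x. ennreal (c z x - M) \<partial>\<nu>))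
        + ennreal (2 * M) * ((emeasure Q b1 + emeasure Q b2) + (emeasure Q b3 + emeasure Q b4)))
      \<le> ((transport_cost c \<mu>' \<nu>' + ennreal e1) + ennreal e1) + ennreal B * ((ennreal e1 + ennreal e1)
        + ennreal (2 * M) * ((ennreal e2 + ennreal e2) + (ennreal e2 + ennreal e2)))"
      using \<gamma>1(2) M m1 m2 m3 m4 by (intro add_mono mult_left_mono) auto
    also have "\<dots> = transport_cost c \<mu>' \<nu>' + ennreal (e1 + e1 + B * (e1 + e1 + 2 * M * (e2 + e2 + (e2 + e2))))"
      using e1 e2 M(1) B_pos unfolding add.assoc[of "transport_cost c \<mu>' \<nu>'"]
      by (simp flip: ennreal_plus ennreal_mult add: add.assoc mult.assoc)
    also have "\<dots> \<le> transport_cost c \<mu>' \<nu>' + ennreal e"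
    proof -
      have "B * (e1 + e1) = e / 4" "B * (2 * M * (e2 + e2 + (e2 + e2))) = e / 4"
        using B_pos M(1) by (auto simp: e1_def e2_def field_simps)
      then show ?thesis
        using e1 by (intro add_left_mono ennreal_leI) (simp add: distrib_left)
    qed
    finally show ?thesis .
  qed simp
  with d show ?thesis by blast
qed

section \<open>Completeness of the transport cost\<close>

text \<open>Every use of the relaxed triangle inequality costs a factor B, so the steps have to
  shrink like powers of 1/(2B). Splitting off the first step leaves two equal contributions, and B
  times their sum is again the claimed bound, independent of k.\<close>

lemma geometric_chain_bound:
  fixes x :: "nat \<Rightarrow> 'a"
  assumes W: "W \<ge> 0" and step: "\<And>n. c (x n) (x (Suc n)) \<le> W / (2*B)^n"
  shows "c (x n) (x (n + k)) \<le> 2 * B * W / (2*B)^n"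
proof (induction k arbitrary: n)
  case 0
  show ?case using W B_pos by simp
next
  case (Suc k)
  have "c (x n) (x (n + Suc k)) \<le> B * (c (x n) (x (Suc n)) + c (x (Suc n)) (x (Suc n + k)))"
    using c_relaxed[of "x n" "x (n + Suc k)" "x (Suc n)"] by simp
  also have "\<dots> \<le> B * (W / (2*B)^n + 2 * B * W / (2*B)^(Suc n))"
    using B_pos step[of n] Suc[of "Suc n"] by (intro mult_left_mono add_mono) auto
  also have "\<dots> = 2 * B * W / (2*B)^n"
    using B_pos by (simp add: field_simps)
  finally show ?case .
qed

text \<open>Continuity of c passes the chain bound on to the limit. The explicit rate is what makes
  the distance to the limit integrable later.\<close>

lemma complete_limit:
  fixes x :: "nat \<Rightarrow> 'a"
  assumes compl: "semimetric_complete c" and W: "W \<ge> 0" and step: "\<And>n. c (x n) (x (Suc n)) \<le> W / (2*B)^n"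
  shows "\<exists>l. (\<lambda>n. c (x n) l) \<longlonglongrightarrow> 0 \<and> (\<forall>n. c (x n) l \<le> 2 * B * W / (2*B)^n)"
proof -
  have bound: "c (x n) (x m) \<le> 2 * B * W / (2*B)^n" if "m \<ge> n" for n m
    using geometric_chain_bound[OF W step, of n "m - n"] that by simp
  have lim0: "(\<lambda>n. 2 * B * W / (2*B)^n) \<longlonglongrightarrow> 0"
    using B_ge_1 by (intro LIMSEQ_divide_realpow_zero) auto
  have "(\<lambda>n. SUP m\<in>{n..}. ennreal (c (x n) (x m))) \<longlonglongrightarrow> 0"
  proof (rule tendsto_sandwich[OF _ _ tendsto_const])
    show "(\<lambda>n. ennreal (2 * B * W / (2*B)^n)) \<longlonglongrightarrow> 0"
      using tendsto_ennrealI[OF lim0] by simp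
    show "\<forall>\<^sub>F n in sequentially. (SUP m\<in>{n..}. ennreal (c (x n) (x m))) \<le> ennreal (2 * B * W / (2*B)^n)"
      using bound by (auto intro!: always_eventually SUP_least ennreal_leI)
  qed simp
  then obtain l where l: "(\<lambda>n. c (x n) l) \<longlonglongrightarrow> 0"
    using compl by (auto simp: semimetric_complete_def)
  have "c (x n) l \<le> 2 * B * W / (2*B)^n" for n
  proof (rule LIMSEQ_le_const2)
    show "(\<lambda>m. c (x n) (x m)) \<longlonglongrightarrow> c (x n) l"
      using c_seq_continuous l unfolding semimetric_continuous_def by (auto dest!: spec[of _ "\<lambda>_. x n"])
    show "\<exists>N. \<forall>m\<ge>N. c (x n) (x m) \<le> 2 * B * W / (2*B)^n" using bound by blast
  qed
  with l show ?thesis by blast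
qed

lemma c_tendsto:
  assumes "(\<lambda>n. c (x n) l) \<longlonglongrightarrow> 0"
  shows "(\<lambda>n. c z (x n)) \<longlonglongrightarrow> c z l"
  using c_seq_continuous assms unfolding semimetric_continuous_def
  by (auto dest!: spec[of _ "\<lambda>_. z"])

text \<open>Preimages of base balls are sublevel sets of distances to dense points, and open sets
  are countable unions of base balls. The purpose is measurability of a pointwise limit of random
  points.\<close>

lemma measurable_of_c:
  fixes X :: "'b \<Rightarrow> 'a"
  assumes "\<And>z. (\<lambda>\<omega>. c z (X \<omega>)) \<in> borel_measurable M"
  shows "X \<in> M \<rightarrow>\<^sub>M borel"
proof (rule borel_measurableI)
  fix S :: "'a set" assume "open S"
  have "X -` base_ball p \<inter> space M = {\<omega>\<in>space M. c (dense_seq (fst p)) (X \<omega>) < 1 / Suc (snd p)}" for p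
    by (auto simp: base_ball_def)
  then have *: "X -` base_ball p \<inter> space M \<in> sets M" for p
    using assms by simp
  have "X -` S \<inter> space M = (\<Union>p\<in>{p. base_ball p \<subseteq> S}. X -` base_ball p \<inter> space M)"
    using open_eq_Union_base[OF \<open>open S\<close>] by blast
  also have "\<dots> \<in> sets M"
    using * by (intro sets.countable_UN') auto
  finally show "X -` S \<inter> space M \<in> sets M" .
qed

text \<open>The glued chain realises all \<open>\<mu> n\<close> as laws of variables X n on one
  probability space. Their consecutive distances are almost surely summable with geometric weights,
  so X n converges to some L. The law of L is the limit, and integrating the rate gives both
  convergence in cost and the finite moment.\<close>

lemma chain_of_couplings_limit:
  fixes \<mu> :: "nat \<Rightarrow> 'a measure"
  assumes compl: "semimetric_complete c"
    and \<mu>: "\<And>n. \<mu> n \<in> probs_c c"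
    and step: "\<And>n. transport_cost c (\<mu> n) (\<mu> (Suc n)) < ennreal ((1 / (4*B))^n)"
  shows "\<exists>\<nu>\<in>probs_c c. (\<lambda>n. transport_cost c (\<mu> n) \<nu>) \<longlonglongrightarrow> 0"
proof -
  \<comment> \<open>Ratio 1/(4B): a factor 1/(2B) for the iterated relaxed triangle inequality and a
    factor 1/2 for summability in expectation.\<close>
  define a where "a n = (1 / (4*B))^n" for n
  have a: "a n > 0" for n using B_pos by (simp add: a_def)
  have "\<forall>n. \<exists>\<gamma>\<in>couplings (\<mu> n) (\<mu> (Suc n)). cost \<gamma> < ennreal (a n)"
    using step unfolding transport_cost_less_iff a_def by blast
  then obtain \<gamma> where \<gamma>: "\<And>n. \<gamma> n \<in> couplings (\<mu> n) (\<mu> (Suc n))" "\<And>n. cost (\<gamma> n) < ennreal (a n)"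
    by metis
  obtain Q :: "(nat \<Rightarrow> 'a \<times> 'a) measure" where
    Q: "prob_space Q" "\<And>n. (\<lambda>\<omega>. \<omega> n) \<in> Q \<rightarrow>\<^sub>M borel" "\<And>n. distr Q borel (\<lambda>\<omega>. \<omega> n) = \<gamma> n"
    "\<And>n. AE \<omega> in Q. c (snd (\<omega> n)) (fst (\<omega> (Suc n))) < a n"
  proof (rule glue_couplings[of \<gamma> a])
    show "\<gamma> n \<in> borel_probs" "distr (\<gamma> n) borel snd = distr (\<gamma> (Suc n)) borel fst" for n
      using couplingsD[OF \<gamma>(1)] by simp_all
  qed (use a in auto)
  interpret prob_space Q by (rule Q)
  define X where "X n \<omega> = fst (\<omega> n)" for n and \<omega> :: "nat \<Rightarrow> 'a \<times> 'a"
  define Y where "Y n \<omega> = snd (\<omega> n)" for n and \<omega> :: "nat \<Rightarrow> 'a \<times> 'a"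
  note law = distr_fst_snd[OF \<gamma>(1) Q(3) Q(2), folded X_def Y_def]
  have X[measurable]: "X n \<in> Q \<rightarrow>\<^sub>M borel" and Y[measurable]: "Y n \<in> Q \<rightarrow>\<^sub>M borel" for n
    unfolding X_def Y_def
    by (rule measurable_compose[OF Q(2) measurable_fst_borel], rule measurable_compose[OF Q(2) measurable_snd_borel])
  define D where "D n \<omega> = c (X n \<omega>) (X (Suc n) \<omega>)" for n \<omega>
  have D[measurable]: "D n \<in> borel_measurable Q" for n unfolding D_def by measurable
  \<comment> \<open>One coupling cost and one gluing error, each at most \<open>a n\<close>, times
    B.\<close>
  have ED: "(\<integral>\<^sup>+\<omega>. ennreal (D n \<omega>) \<partial>Q) \<le> ennreal (2 * B * a n)" for n
  proof -
    have "(\<integral>\<^sup>+\<omega>. ennreal (D n \<omega>) \<partial>Q) \<le> (\<integral>\<^sup>+\<omega>. ennreal B * (ennreal (c (X n \<omega>) (Y n \<omega>)) + ennreal (a n)) \<partial>Q)"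
    proof (rule nn_integral_mono_AE)
      show "AE \<omega> in Q. ennreal (D n \<omega>) \<le> ennreal B * (ennreal (c (X n \<omega>) (Y n \<omega>)) + ennreal (a n))"
        using Q(4)[of n]
      proof eventually_elim
        case (elim \<omega>)
        have "D n \<omega> \<le> B * (c (X n \<omega>) (Y n \<omega>) + c (Y n \<omega>) (X (Suc n) \<omega>))"
          unfolding D_def by (rule c_relaxed)
        also have "\<dots> \<le> B * (c (X n \<omega>) (Y n \<omega>) + a n)"
          using B_pos elim by (intro mult_left_mono add_left_mono) (auto simp: X_def Y_def)
        finally show ?case
          using B_pos a[of n] by (simp add: ennreal_leI flip: ennreal_plus ennreal_mult)
      qed
    qed
    also have "\<dots> = ennreal B * (cost (\<gamma> n) + ennreal (a n))"
      by (simp add: nn_integral_cmult nn_integral_add emeasure_space_1 law)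
    also have "\<dots> \<le> ennreal B * (ennreal (a n) + ennreal (a n))"
      using \<gamma>(2)[of n] by (intro mult_left_mono add_right_mono) auto
    also have "\<dots> = ennreal (2 * B * a n)"
      using B_pos a[of n] by (simp flip: ennreal_plus ennreal_mult)
    finally show ?thesis .
  qed
  \<comment> \<open>Controls all steps at once: \<open>D n\<close> is at most W / (2B)^n, the form
    required by \<open>complete_limit\<close>.\<close>
  define W where "W \<omega> = (\<Sum>n. ennreal ((2*B)^n * D n \<omega>))" for \<omega>
  have W[measurable]: "W \<in> borel_measurable Q" unfolding W_def by measurable
  have "(\<integral>\<^sup>+\<omega>. W \<omega> \<partial>Q) = (\<Sum>n. (\<integral>\<^sup>+\<omega>. ennreal ((2*B)^n * D n \<omega>) \<partial>Q))"
    unfolding W_def by (rule nn_integral_suminf) measurable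
  also have "\<dots> = (\<Sum>n. ennreal ((2*B)^n) * (\<integral>\<^sup>+\<omega>. ennreal (D n \<omega>) \<partial>Q))"
    using B_pos by (simp add: ennreal_mult nn_integral_cmult D_def)
  also have "\<dots> \<le> (\<Sum>n. ennreal ((2*B)^n) * ennreal (2 * B * a n))"
    by (intro suminf_le mult_left_mono ED) auto
  also have "\<dots> = (\<Sum>n. ennreal (2 * B * (1 / 2)^n))"
  proof (rule arg_cong[where f=suminf], rule ext)
    fix n
    have "(2*B)^n * a n = (2 * B * (1 / (4*B)))^n"
      unfolding a_def by (rule power_mult_distrib[symmetric])
    also have "2 * B * (1 / (4*B)) = 1 / 2" using B_pos by simp
    finally have "(2*B)^n * (2 * B * a n) = 2 * B * (1 / 2)^n" by simp
    then show "ennreal ((2*B)^n) * ennreal (2 * B * a n) = ennreal (2 * B * (1 / 2)^n)"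
      using B_pos a[of n] by (simp flip: ennreal_mult)
  qed
  also have "\<dots> = ennreal (2 * B * 2)"
  proof (rule suminf_ennreal_eq)
    show "(\<lambda>n. 2 * B * (1 / 2)^n) sums (2 * B * 2)"
      using geometric_sums[of "1/2 :: real"] by (intro sums_mult) simp
  qed (use B_pos in simp)
  finally have EW: "(\<integral>\<^sup>+\<omega>. W \<omega> \<partial>Q) \<le> ennreal (4 * B)" by simp
  have "AE \<omega> in Q. W \<omega> \<noteq> top"
    using EW by (intro nn_integral_noteq_infinite[simplified]) (auto simp: top_unique)
  then have "AE \<omega> in Q. W \<omega> < top" by (simp add: less_top)
  define good where "good = {\<omega>\<in>space Q. W \<omega> < top}"
  have good[measurable]: "good \<in> sets Q" unfolding good_def by measurable
  have AEgood: "AE \<omega> in Q. \<omega> \<in> good"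
    using \<open>AE \<omega> in Q. W \<omega> < top\<close> AE_space by eventually_elim (simp add: good_def)
  have lim: "\<exists>l. (\<lambda>n. c (X n \<omega>) l) \<longlonglongrightarrow> 0 \<and> (\<forall>n. c (X n \<omega>) l \<le> 2 * B * enn2real (W \<omega>) / (2*B)^n)"
    if \<omega>: "\<omega> \<in> good" for \<omega>
  proof (rule complete_limit[OF compl])
    fix n
    have "ennreal ((2*B)^n * D n \<omega>) \<le> W \<omega>"
      unfolding W_def using sum_le_suminf[of "\<lambda>n. ennreal ((2*B)^n * D n \<omega>)" "{n}"] by simp
    also have "W \<omega> = ennreal (enn2real (W \<omega>))" using \<omega> by (simp add: good_def)
    finally have "(2*B)^n * D n \<omega> \<le> enn2real (W \<omega>)" by (simp add: ennreal_le_iff)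
    then show "c (X n \<omega>) (X (Suc n) \<omega>) \<le> enn2real (W \<omega>) / (2*B)^n"
      using B_pos by (simp add: D_def field_simps)
  qed simp
  \<comment> \<open>On the almost sure event a limit with the stated rate is chosen; the value X 0
    elsewhere serves to keep L measurable.\<close>
  define L where "L \<omega> = (if \<omega> \<in> good then (SOME l. (\<lambda>n. c (X n \<omega>) l) \<longlonglongrightarrow> 0 \<and>
      (\<forall>n. c (X n \<omega>) l \<le> 2 * B * enn2real (W \<omega>) / (2*B)^n)) else X 0 \<omega>)" for \<omega>
  have L: "(\<lambda>n. c (X n \<omega>) (L \<omega>)) \<longlonglongrightarrow> 0" "c (X n \<omega>) (L \<omega>) \<le> 2 * B * enn2real (W \<omega>) / (2*B)^n"
    if "\<omega> \<in> good" for \<omega> n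
    using someI_ex[OF lim[OF that]] that by (auto simp: L_def)
  have mL[measurable]: "L \<in> Q \<rightarrow>\<^sub>M borel"
  proof (rule measurable_of_c)
    fix z
    show "(\<lambda>\<omega>. c z (L \<omega>)) \<in> borel_measurable Q"
    proof (rule borel_measurable_LIMSEQ_real)
      fix \<omega>
      show "(\<lambda>n. if \<omega> \<in> good then c z (X n \<omega>) else c z (X 0 \<omega>)) \<longlonglongrightarrow> c z (L \<omega>)"
        using c_tendsto[OF L(1)] by (cases "\<omega> \<in> good") (auto simp: L_def)
    qed measurable
  qed
  define \<nu> where "\<nu> = distr Q borel L"
  have \<nu>: "\<nu> \<in> borel_probs" unfolding \<nu>_def by (rule distr_borel_probs[OF Q(1) mL])
  have le: "transport_cost c (\<mu> n) \<nu> \<le> ennreal (8 * B\<^sup>2 / (2*B)^n)" for n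
  proof -
    have "transport_cost c (\<mu> n) \<nu> \<le> (\<integral>\<^sup>+\<omega>. ennreal (c (X n \<omega>) (L \<omega>)) \<partial>Q)"
      using transport_cost_le_joint[OF Q(1) X mL] by (simp add: law \<nu>_def)
    also have "\<dots> \<le> (\<integral>\<^sup>+\<omega>. ennreal (2 * B / (2*B)^n) * W \<omega> \<partial>Q)"
    proof (rule nn_integral_mono_AE)
      show "AE \<omega> in Q. ennreal (c (X n \<omega>) (L \<omega>)) \<le> ennreal (2 * B / (2*B)^n) * W \<omega>"
        using AEgood
      proof eventually_elim
        case (elim \<omega>)
        have "ennreal (c (X n \<omega>) (L \<omega>)) \<le> ennreal (2 * B / (2*B)^n * enn2real (W \<omega>))"
          using L(2)[OF elim, of n] by (intro ennreal_leI) simp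
        also have "\<dots> = ennreal (2 * B / (2*B)^n) * ennreal (enn2real (W \<omega>))"
          using B_pos by (intro ennreal_mult) auto
        also have "ennreal (enn2real (W \<omega>)) = W \<omega>" using elim by (simp add: good_def)
        finally show ?case .
      qed
    qed
    also have "\<dots> = ennreal (2 * B / (2*B)^n) * (\<integral>\<^sup>+\<omega>. W \<omega> \<partial>Q)"
      by (rule nn_integral_cmult) measurable
    also have "\<dots> \<le> ennreal (2 * B / (2*B)^n) * ennreal (4 * B)"
      by (intro mult_left_mono EW) simp
    also have "\<dots> = ennreal (8 * B\<^sup>2 / (2*B)^n)"
      using B_pos by (simp add: power2_eq_square flip: ennreal_mult)
    finally show ?thesis .
  qed
  have "(\<lambda>n. 8 * B\<^sup>2 / (2*B)^n) \<longlonglongrightarrow> 0"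
    using B_ge_1 by (intro LIMSEQ_divide_realpow_zero) auto
  from tendsto_ennrealI[OF this] have lim0: "(\<lambda>n. ennreal (8 * B\<^sup>2 / (2*B)^n)) \<longlonglongrightarrow> 0" by simp
  have conv: "(\<lambda>n. transport_cost c (\<mu> n) \<nu>) \<longlonglongrightarrow> 0"
    by (rule tendsto_sandwich[OF always_eventually always_eventually tendsto_const lim0]) (simp, intro allI le)
  have "\<nu> \<in> probs_c c"
  proof -
    define z where "z = dense_seq 0"
    have "(\<integral>\<^sup>+x. ennreal (c z x) \<partial>\<nu>) = (\<integral>\<^sup>+\<omega>. ennreal (c z (L \<omega>)) \<partial>Q)"
      unfolding \<nu>_def by (rule nn_integral_distr[OF mL]) simp
    also have "\<dots> \<le> (\<integral>\<^sup>+\<omega>. ennreal B * (ennreal (c z (X 0 \<omega>)) + ennreal (2 * B) * W \<omega>) \<partial>Q)"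
    proof (rule nn_integral_mono_AE)
      show "AE \<omega> in Q. ennreal (c z (L \<omega>)) \<le> ennreal B * (ennreal (c z (X 0 \<omega>)) + ennreal (2 * B) * W \<omega>)"
        using AEgood
      proof eventually_elim
        case (elim \<omega>)
        have "c z (L \<omega>) \<le> B * (c z (X 0 \<omega>) + c (X 0 \<omega>) (L \<omega>))" by (rule c_relaxed)
        also have "\<dots> \<le> B * (c z (X 0 \<omega>) + 2 * B * enn2real (W \<omega>))"
          using L(2)[OF elim, of 0] B_pos by (intro mult_left_mono add_left_mono) auto
        finally have "ennreal (c z (L \<omega>)) \<le> ennreal (B * (c z (X 0 \<omega>) + 2 * B * enn2real (W \<omega>)))"
          by (rule ennreal_leI)
        also have "\<dots> = ennreal B * (ennreal (c z (X 0 \<omega>)) + ennreal (2 * B) * ennreal (enn2real (W \<omega>)))"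
          using B_pos by (simp add: ennreal_mult ennreal_plus del: ennreal_enn2real_if)
        also have "ennreal (enn2real (W \<omega>)) = W \<omega>" using elim by (simp add: good_def)
        finally show ?case .
      qed
    qed
    also have "\<dots> = ennreal B * ((\<integral>\<^sup>+\<omega>. ennreal (c z (X 0 \<omega>)) \<partial>Q) + ennreal (2 * B) * (\<integral>\<^sup>+\<omega>. W \<omega> \<partial>Q))"
      by (simp add: nn_integral_cmult nn_integral_add)
    also have "(\<integral>\<^sup>+\<omega>. ennreal (c z (X 0 \<omega>)) \<partial>Q) = (\<integral>\<^sup>+x. ennreal (c z x) \<partial>\<mu> 0)"
      by (subst law(1)[symmetric], subst nn_integral_distr) auto
    also have "ennreal B * ((\<integral>\<^sup>+x. ennreal (c z x) \<partial>\<mu> 0) + ennreal (2 * B) * (\<integral>\<^sup>+\<omega>. W \<omega> \<partial>Q)) < \<infinity>"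
      using probs_c_finite[OF \<mu>, where z=z] le_less_trans[OF EW ennreal_less_top]
      by (simp add: ennreal_mult_less_top)
    finally show ?thesis using \<nu> by (auto simp: probs_c_def)
  qed
  with conv show ?thesis by blast
qed

text \<open>A subsequence with costs below (4B)^(-n) converges by the chain argument; one use of the
  triangle inequality transfers the limit to the whole sequence.\<close>

lemma transport_cost_complete:
  fixes \<mu> :: "nat \<Rightarrow> 'a measure"
  assumes compl: "semimetric_complete c"
    and \<mu>: "\<And>n. \<mu> n \<in> probs_c c"
    and cauchy: "\<And>e. e > 0 \<Longrightarrow> \<exists>N. \<forall>m\<ge>N. \<forall>n\<ge>N. transport_cost c (\<mu> m) (\<mu> n) < ennreal e"
  shows "\<exists>\<nu>\<in>probs_c c. (\<lambda>n. transport_cost c (\<mu> n) \<nu>) \<longlonglongrightarrow> 0"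
proof -
  define a where "a n = (1 / (4*B))^n" for n
  have a: "a n > 0" for n using B_pos by (simp add: a_def)
  have "\<forall>k. \<exists>N. \<forall>m\<ge>N. \<forall>n\<ge>N. transport_cost c (\<mu> m) (\<mu> n) < ennreal (a k)"
    using cauchy a by blast
  then obtain N where N: "\<And>k m n. m \<ge> N k \<Longrightarrow> n \<ge> N k \<Longrightarrow> transport_cost c (\<mu> m) (\<mu> n) < ennreal (a k)"
    by metis
  \<comment> \<open>Monotone with \<open>s k\<close> beyond \<open>N k\<close>, so that two
    consecutive terms are both controlled by \<open>a k\<close>.\<close>
  define s where "s k = k + (\<Sum>i\<le>k. N i)" for k
  have s: "s k \<ge> k" "s k \<ge> N k" "s (Suc k) \<ge> s k" for k
    using member_le_sum[of k "{..k}" N] by (auto simp: s_def)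
  have "\<exists>\<nu>\<in>probs_c c. (\<lambda>n. transport_cost c (\<mu> (s n)) \<nu>) \<longlonglongrightarrow> 0"
  proof (rule chain_of_couplings_limit[OF compl])
    show "transport_cost c (\<mu> (s n)) (\<mu> (s (Suc n))) < ennreal ((1 / (4*B))^n)" for n
      using N[where k=n, of "s n" "s (Suc n)"] s(2,3)[of n] by (simp add: a_def)
  qed (rule \<mu>)
  then obtain \<nu> where \<nu>: "\<nu> \<in> probs_c c" and lim: "(\<lambda>n. transport_cost c (\<mu> (s n)) \<nu>) \<longlonglongrightarrow> 0" by blast
  have "(\<lambda>n. transport_cost c (\<mu> n) \<nu>) \<longlonglongrightarrow> 0"
  proof (rule order_tendstoI)
    fix b :: ennreal assume "0 < b"
    then obtain x where "0 < x" "x < b" using dense by blast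
    then obtain e where e: "e > 0" "ennreal e < b"
      by (cases x) (auto simp: ennreal_less_zero_iff)
    have B2: "B\<^sup>2 > 0" using B_pos by simp
    define d where "d = e / (2 * B\<^sup>2)"
    have d: "d > 0" using e B2 by (simp add: d_def)
    obtain M where M: "\<forall>m\<ge>M. \<forall>n\<ge>M. transport_cost c (\<mu> m) (\<mu> n) < ennreal d" using cauchy[OF d] by blast
    have "\<forall>\<^sub>F k in sequentially. transport_cost c (\<mu> (s k)) \<nu> < ennreal d \<and> k \<ge> M"
      using order_tendstoD(2)[OF lim, of "ennreal d"] d
      by (intro eventually_conj eventually_ge_at_top) auto
    then obtain k where k: "transport_cost c (\<mu> (s k)) \<nu> < ennreal d" "k \<ge> M"
      using eventually_happens'[OF sequentially_bot] by blast
    show "\<forall>\<^sub>F n in sequentially. transport_cost c (\<mu> n) \<nu> < b"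
    proof (rule eventually_sequentiallyI[of M])
      fix n assume "n \<ge> M"
      have "transport_cost c (\<mu> n) \<nu> \<le> ennreal (B\<^sup>2) * (transport_cost c (\<mu> n) (\<mu> (s k)) + transport_cost c (\<mu> (s k)) \<nu>)"
        by (rule transport_cost_triangle) (simp_all add: probs_cD \<mu> \<nu>)
      also have "\<dots> \<le> ennreal (B\<^sup>2) * (ennreal d + ennreal d)"
        using M \<open>n \<ge> M\<close> s(1)[of k] k by (intro mult_left_mono add_mono) (auto intro!: less_imp_le)
      also have "\<dots> = ennreal e"
        using d B2 by (simp add: d_def flip: ennreal_plus ennreal_mult)
      finally show "transport_cost c (\<mu> n) \<nu> < b" using e by simp
    qed
  qed simp
  with \<nu> show ?thesis by blast
qed

end

section \<open>Dini derivatives\<close>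

text \<open>The barrier G is the claimed bound with slack \<eta> in the initial value and in the
  rate. Semicontinuity from the left carries f \<le> G to the supremum of the times up to which it
  holds. That supremum cannot lie before b, because the Dini bound with slack \<eta> is dominated by
  the growth of G.\<close>

lemma gronwall_dini:
  fixes f :: "real \<Rightarrow> real"
  assumes \<beta>: "\<beta> \<ge> 0" and \<epsilon>: "\<epsilon> \<ge> 0" and fa: "f a \<ge> 0"
    and lsc: "\<And>t e. t \<in> {a<..b} \<Longrightarrow> e > 0 \<Longrightarrow> \<forall>\<^sub>F s in at_left t. f t \<le> f s + e"
    and deriv: "\<And>t e. t \<in> {a..<b} \<Longrightarrow> e > 0 \<Longrightarrow> \<forall>\<^sub>F h in at_right 0. f (t + h) \<le> f t + h * (\<epsilon> + \<beta> * f t + e)"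
    and t: "t \<in> {a..b}"
  shows "f t \<le> exp (\<beta> * (t - a)) * (f a + \<epsilon> * (t - a))"
proof -
  have strict: "f t \<le> exp (\<beta> * (t - a)) * (f a + \<eta> + (\<epsilon> + \<eta>) * (t - a))" if \<eta>: "\<eta> > 0" for \<eta>
  proof -
    define G where "G t = exp (\<beta> * (t - a)) * (f a + \<eta> + (\<epsilon> + \<eta>) * (t - a))" for t
    have G_mono: "G s \<le> G u" if "a \<le> s" "s \<le> u" for s u
      unfolding G_def using that \<beta> \<epsilon> \<eta> fa
      by (intro mult_mono add_left_mono mult_left_mono) (auto intro!: add_nonneg_nonneg mult_left_mono)
    \<comment> \<open>An explicit Euler step of the differential inequality stays below G, since 1 +
      \<beta> h \<le> exp (\<beta> h).\<close>
    have G_step: "G s + h * (\<epsilon> + \<beta> * G s + \<eta>) \<le> G (s + h)" if "a \<le> s" "h \<ge> 0" for s h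
    proof -
      define E where "E = exp (\<beta> * (s - a))"
      define R where "R = f a + \<eta> + (\<epsilon> + \<eta>) * (s - a)"
      have E: "E \<ge> 1" using that \<beta> by (simp add: E_def)
      have R: "R \<ge> 0" using that \<epsilon> \<eta> fa by (auto simp: R_def)
      have "h * (\<epsilon> + \<eta>) * 1 \<le> h * (\<epsilon> + \<eta>) * E" using that \<epsilon> \<eta> E by (intro mult_left_mono) auto
      moreover have "0 \<le> \<beta> * h * (E * ((\<epsilon> + \<eta>) * h))" using that \<epsilon> \<eta> E \<beta> by auto
      ultimately have "E * R + h * (\<epsilon> + \<beta> * (E * R) + \<eta>) \<le> (1 + \<beta> * h) * (E * (R + (\<epsilon> + \<eta>) * h))"
        by (simp add: algebra_simps)
      also have "\<dots> \<le> exp (\<beta> * h) * (E * (R + (\<epsilon> + \<eta>) * h))"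
        using that \<epsilon> \<eta> E R exp_ge_add_one_self[of "\<beta> * h"] by (intro mult_right_mono) auto
      also have "\<dots> = exp (\<beta> * h) * E * (R + (\<epsilon> + \<eta>) * h)" by (rule mult.assoc[symmetric])
      also have "exp (\<beta> * h) * E = exp (\<beta> * (s + h - a))"
        unfolding E_def exp_add[symmetric] by (simp add: algebra_simps)
      also have "R + (\<epsilon> + \<eta>) * h = f a + \<eta> + (\<epsilon> + \<eta>) * (s + h - a)"
        by (simp add: R_def algebra_simps)
      finally have "E * R + h * (\<epsilon> + \<beta> * (E * R) + \<eta>) \<le> G (s + h)"
        by (simp only: G_def)
      then show ?thesis by (simp add: G_def E_def R_def)
    qed
    define S where "S = {t\<in>{a..b}. \<forall>s\<in>{a..t}. f s \<le> G s}"
    have ab: "a \<le> b" using t by simp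
    have aS: "a \<in> S" using ab \<eta> by (auto simp: S_def G_def)
    have bdd: "bdd_above S" by (auto simp: S_def intro!: bdd_aboveI[of _ b])
    define u where "u = Sup S"
    have u: "a \<le> u" "u \<le> b"
    proof -
      show "a \<le> u" unfolding u_def by (rule cSup_upper[OF aS bdd])
      show "u \<le> b" unfolding u_def by (rule cSup_least) (use aS in \<open>auto simp: S_def\<close>)
    qed
    have below: "f s \<le> G s" if s: "a \<le> s" "s < u" for s
    proof -
      obtain v where "v \<in> S" "s < v" using less_cSupD[of S s] aS s by (auto simp: u_def)
      then show ?thesis using s by (auto simp: S_def)
    qed
    have at_u: "f u \<le> G u"
    proof (cases "u = a")
      case True
      then show ?thesis using \<eta> by (simp add: G_def)
    next
      case False
      then have "u \<in> {a<..b}" using u by auto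
      show ?thesis
      proof (rule field_le_epsilon)
        fix e :: real assume "e > 0"
        have "\<forall>\<^sub>F s in at_left u. s \<in> {a<..<u}"
          using \<open>u \<in> {a<..b}\<close> by (intro eventually_at_left_real) auto
        with lsc[OF \<open>u \<in> {a<..b}\<close> \<open>e > 0\<close>] have "\<forall>\<^sub>F s in at_left u. f u \<le> f s + e \<and> s \<in> {a<..<u}"
          by (rule eventually_conj)
        then obtain s where "f u \<le> f s + e" "s \<in> {a<..<u}"
          using eventually_happens'[OF trivial_limit_at_left_real] by blast
        then show "f u \<le> G u + e" using below[of s] G_mono[of s u] by auto
      qed
    qed
    have "u = b"
    proof (rule ccontr)
      assume "u \<noteq> b"
      then have "u \<in> {a..<b}" using u by auto
      from deriv[OF this \<eta>] obtain d where d: "d > 0"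
        "\<And>h. 0 < h \<Longrightarrow> h < d \<Longrightarrow> f (u + h) \<le> f u + h * (\<epsilon> + \<beta> * f u + \<eta>)"
        unfolding eventually_at_right_field by auto
      define k where "k = min (d / 2) (b - u)"
      have k: "0 < k" "k < d" "u + k \<le> b" using d \<open>u \<in> {a..<b}\<close> by (auto simp: k_def)
      have "f s \<le> G s" if s: "s \<in> {a..u + k}" for s
      proof (cases "s \<le> u")
        case True
        then show ?thesis using below[of s] at_u s by (cases "s = u") auto
      next
        case False
        define h where "h = s - u"
        have h: "0 < h" "h < d" using False s k by (auto simp: h_def)
        have "f (u + h) \<le> f u + h * (\<epsilon> + \<beta> * f u + \<eta>)" by (rule d(2)[OF h])
        also have "\<dots> \<le> G u + h * (\<epsilon> + \<beta> * G u + \<eta>)"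
          using at_u h \<beta> by (intro add_mono mult_left_mono add_right_mono add_left_mono) auto
        also have "\<dots> \<le> G (u + h)" using u h by (intro G_step) auto
        finally show ?thesis by (simp add: h_def)
      qed
      then have "u + k \<in> S" using k u by (auto simp: S_def)
      then have "u + k \<le> u" unfolding u_def by (rule cSup_upper[OF _ bdd])
      with k show False by simp
    qed
    then have "f t \<le> G t" using below[of t] at_u t by (cases "t = u") auto
    then show ?thesis by (simp add: G_def)
  qed
  show ?thesis
  proof (rule field_le_epsilon)
    fix e :: real assume e: "e > 0"
    \<comment> \<open>Total weight of \<eta> in the bound, so that \<eta> = e / x contributes
      exactly e.\<close>
    define x where "x = exp (\<beta> * (t - a)) * (1 + (t - a))"
    have x: "x > 0" using t by (auto simp: x_def intro!: mult_pos_pos)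
    have "f t \<le> exp (\<beta> * (t - a)) * (f a + e / x + (\<epsilon> + e / x) * (t - a))"
      using e x by (intro strict) auto
    also have "\<dots> = exp (\<beta> * (t - a)) * (f a + \<epsilon> * (t - a)) + e / x * x"
    proof -
      have "E * (p + y + (\<epsilon> + y) * q) = E * (p + \<epsilon> * q) + y * (E * (1 + q))" for E p q y :: real
        by (simp add: algebra_simps)
      then show ?thesis unfolding x_def .
    qed
    finally show "f t \<le> exp (\<beta> * (t - a)) * (f a + \<epsilon> * (t - a)) + e" using x by simp
  qed
qed

text \<open>Gronwall with vanishing constants, applied to g - g a' and to its negative. The starting
  point a' is interior because the derivative is known on the open interval only; continuity lets a'
  tend to a.\<close>

lemma right_derivative_zero_imp_eq:
  fixes g :: "real \<Rightarrow> real"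
  assumes ab: "a \<le> b" and cont: "continuous_on {a..b} g"
    and deriv: "\<And>t. t \<in> {a<..<b} \<Longrightarrow> ((\<lambda>h. (g (t + h) - g t) / h) \<longlongrightarrow> 0) (at_right 0)"
  shows "g b = g a"
proof (cases "a = b")
  case False
  with ab have ab: "a < b" by simp
  have le: "s * g b \<le> s * g a'" if a': "a' \<in> {a<..<b}" and s: "\<bar>s\<bar> = 1" for a' and s :: real
  proof -
    have "(\<lambda>t. s * (g t - g a')) b \<le> exp (0 * (b - a')) * ((\<lambda>t. s * (g t - g a')) a' + 0 * (b - a'))"
    proof (rule gronwall_dini[where b=b])
      fix t e :: real assume t: "t \<in> {a'<..b}" and e: "e > 0"
      have "continuous_on {a..t} g" by (rule continuous_on_subset[OF cont]) (use t in auto)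
      then have "(g \<longlongrightarrow> g t) (at_left t)"
        using t a' by (auto simp: continuous_on_def at_within_Icc_at_left dest!: bspec[of _ _ t])
      then have "\<forall>\<^sub>F u in at_left t. dist (g u) (g t) < e" using e by (rule tendstoD)
      then show "\<forall>\<^sub>F u in at_left t. s * (g t - g a') \<le> s * (g u - g a') + e"
      proof eventually_elim
        case (elim u)
        have "s * (g t - g u) \<le> \<bar>s * (g t - g u)\<bar>" by simp
        also have "\<dots> = \<bar>g t - g u\<bar>" using s by (simp add: abs_mult)
        finally show ?case using elim by (simp add: dist_real_def algebra_simps)
      qed
    next
      fix t e :: real assume t: "t \<in> {a'..<b}" and e: "e > 0"
      have "\<forall>\<^sub>F h in at_right 0. dist ((g (t + h) - g t) / h) 0 < e"
        using deriv[of t] t a' e by (intro tendstoD) auto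
      then show "\<forall>\<^sub>F h in at_right 0. s * (g (t + h) - g a') \<le> s * (g t - g a') + h * (0 + 0 * (s * (g t - g a')) + e)"
        using eventually_at_right_less
      proof eventually_elim
        case (elim h)
        have "s * (g (t + h) - g t) \<le> \<bar>s * (g (t + h) - g t)\<bar>" by simp
        also have "\<dots> = \<bar>g (t + h) - g t\<bar>" using s by (simp add: abs_mult)
        also have "\<dots> \<le> h * e" using elim by (simp add: field_simps)
        finally show ?case by (simp add: algebra_simps)
      qed
    qed (use a' in auto)
    then show ?thesis by (simp add: algebra_simps)
  qed
  have lim: "(g \<longlongrightarrow> g a) (at_right a)"
    using cont ab by (auto simp: continuous_on_def at_within_Icc_at_right dest!: bspec[of _ _ a])
  have ev: "\<forall>\<^sub>F s in at_right a. s \<in> {a<..<b}"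
    using ab by (rule eventually_at_right_real)
  have "g b \<le> g a"
    by (rule tendsto_lowerbound[OF lim]) (use ev le[of _ 1] in \<open>auto elim: eventually_mono\<close>)
  moreover have "g a \<le> g b"
    by (rule tendsto_upperbound[OF lim]) (use ev le[of _ "-1"] in \<open>auto elim: eventually_mono\<close>)
  ultimately show ?thesis by simp
qed simp

section \<open>Probability semigroups\<close>

text \<open>The library instance needs a metric space as domain.\<close>

instance bcontfun :: (topological_space, complete_space) complete_space
proof
  fix f :: "nat \<Rightarrow> ('a, 'b) bcontfun"
  assume f: "Cauchy f"
  have "\<exists>g. uniform_limit UNIV f g sequentially"
    using f uniformly_convergent_eq_cauchy[of "\<lambda>_. True" f]
    unfolding Cauchy_def uniform_limit_sequentially_iff
    by (metis dist_fun_lt_imp_dist_val_lt)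
  then obtain g where "uniform_limit UNIV f g sequentially" ..
  from uniform_limit_bcontfunE[OF this sequentially_bot]
  obtain l' where "g = apply_bcontfun l'" "(f \<longlonglongrightarrow> l')" by metis
  then show "convergent f"
    by (intro convergentI)
qed

instance bcontfun :: (topological_space, banach) banach ..

section \<open>Semigroup operators on bounded continuous functions\<close>

locale relaxed_semimetric_semigroup = relaxed_semimetric c B
  for c :: "'a::topological_space \<Rightarrow> 'a \<Rightarrow> real" and B +
  fixes \<kappa> :: "real \<Rightarrow> 'a \<Rightarrow> 'a measure"
  assumes semigroup: "probability_semigroup \<kappa>"
begin

lemma kernel_probs: "t \<ge> 0 \<Longrightarrow> \<kappa> t x \<in> borel_probs"
  using semigroup by (simp add: probability_semigroup_def)

lemma kernel_op_bound:
  assumes "t \<ge> 0" "\<phi> \<in> bcontfun" "\<And>x. \<bar>\<phi> x\<bar> \<le> b"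
  shows "\<bar>kernel_op \<kappa> t \<phi> x\<bar> \<le> b"
proof -
  interpret prob_space "\<kappa> t x" by (rule borel_probsD(1)[OF kernel_probs[OF assms(1)]])
  have i: "integrable (\<kappa> t x) \<phi>" by (rule integrable_bcontfun[OF kernel_probs[OF assms(1)] assms(2)])
  have "\<bar>\<integral>y. \<phi> y \<partial>\<kappa> t x\<bar> \<le> (\<integral>y. \<bar>\<phi> y\<bar> \<partial>\<kappa> t x)" by (rule integral_abs_bound)
  also have "\<dots> \<le> (\<integral>y. b \<partial>\<kappa> t x)" by (rule integral_mono) (use i assms in auto)
  finally show ?thesis by (simp add: prob_space kernel_op_def)
qed

lemma kernel_op_bcontfun:
  assumes "t \<ge> 0" "\<phi> \<in> bcontfun"
  shows "kernel_op \<kappa> t \<phi> \<in> bcontfun"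
proof -
  have "continuous_on UNIV (kernel_op \<kappa> t \<phi>)"
    using semigroup assms by (simp add: probability_semigroup_def)
  moreover obtain b where "\<And>x. \<bar>\<phi> x\<bar> \<le> b" using bcontfun_bounded[OF assms(2)] by blast
  ultimately show ?thesis
    using kernel_op_bound[OF assms] by (intro bcontfun_normI[where b=b]) auto
qed

text \<open>Lifted to the normed type of bounded continuous functions, uniform limits become norm
  limits and Banach-valued calculus applies.\<close>

definition S :: "real \<Rightarrow> ('a \<Rightarrow>\<^sub>C real) \<Rightarrow> ('a \<Rightarrow>\<^sub>C real)" where
  "S t f = Bcontfun (kernel_op \<kappa> t (apply_bcontfun f))"

lemma apply_S: "t \<ge> 0 \<Longrightarrow> apply_bcontfun (S t f) = kernel_op \<kappa> t (apply_bcontfun f)"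
  unfolding S_def by (rule Bcontfun_inverse[OF kernel_op_bcontfun]) (auto intro: apply_bcontfun)

lemma S_0 [simp]: "S 0 f = f"
  using semigroup apply_bcontfun[of f]
  by (intro bcontfun_eqI) (simp add: apply_S probability_semigroup_def)

lemma S_add: "t \<ge> 0 \<Longrightarrow> s \<ge> 0 \<Longrightarrow> S (t + s) f = S t (S s f)"
  using semigroup apply_bcontfun[of f]
  by (intro bcontfun_eqI) (simp add: apply_S probability_semigroup_def)

lemma norm_S_le: "t \<ge> 0 \<Longrightarrow> norm (S t f) \<le> norm f"
  using norm_bounded[of f] by (intro norm_bound) (simp add: apply_S kernel_op_bound[OF _ apply_bcontfun])

lemma bounded_linear_S:
  assumes t: "t \<ge> 0"
  shows "bounded_linear (S t)"
proof (rule bounded_linear_intro[where K=1])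
  have i: "integrable (\<kappa> t x) (apply_bcontfun f)" for f :: "'a \<Rightarrow>\<^sub>C real" and x
    by (rule integrable_bcontfun[OF kernel_probs[OF t] apply_bcontfun])
  show "S t (f + g) = S t f + S t g" for f g
    using i by (intro bcontfun_eqI) (simp add: apply_S[OF t] kernel_op_def)
  show "S t (r *\<^sub>R f) = r *\<^sub>R S t f" for r f
    by (intro bcontfun_eqI) (simp add: apply_S[OF t] kernel_op_def)
qed (simp add: norm_S_le[OF t])

definition C0b :: "('a \<Rightarrow>\<^sub>C real) set" where
  "C0b = {f. apply_bcontfun f \<in> C0}"

lemma C0b_E:
  assumes "\<phi> \<in> C0"
  obtains f where "f \<in> C0b" "\<phi> = apply_bcontfun f"
  using assms bcontfunE[OF C0_bcontfun[OF assms]] by (metis C0b_def mem_Collect_eq)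

lemma S_C0b: "t \<ge> 0 \<Longrightarrow> f \<in> C0b \<Longrightarrow> S t f \<in> C0b"
  using semigroup by (simp add: C0b_def apply_S probability_semigroup_def)

lemma C0_add: "\<phi> \<in> C0 \<Longrightarrow> \<psi> \<in> C0 \<Longrightarrow> (\<lambda>x. \<phi> x + \<psi> x :: real) \<in> (C0 :: ('a \<Rightarrow> real) set)"
proof -
  assume \<phi>: "\<phi> \<in> C0" and \<psi>: "\<psi> \<in> C0"
  show "(\<lambda>x. \<phi> x + \<psi> x) \<in> C0"
    unfolding C0_def
  proof (safe)
    show "continuous_on UNIV (\<lambda>x. \<phi> x + \<psi> x)" using \<phi> \<psi> by (auto simp: C0_def intro: continuous_intros)
    fix e :: real assume "e > 0"
    then have "e / 2 > 0" by simp
    then obtain K L where "compact K" "\<And>x. x \<notin> K \<Longrightarrow> \<bar>\<phi> x\<bar> < e / 2" "compact L" "\<And>x. x \<notin> L \<Longrightarrow> \<bar>\<psi> x\<bar> < e / 2"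
      using \<phi> \<psi> unfolding C0_def by blast
    then show "\<exists>K. compact K \<and> (\<forall>x. x \<notin> K \<longrightarrow> \<bar>\<phi> x + \<psi> x\<bar> < e)"
      by (intro exI[of _ "K \<union> L"]) (fastforce simp: compact_Un)
  qed
qed

lemma C0_mult: 
  assumes \<phi>: "\<phi> \<in> C0" shows "(\<lambda>x. r * \<phi> x :: real) \<in> (C0 :: ('a \<Rightarrow> real) set)"
  unfolding C0_def
proof safe
  show "continuous_on UNIV (\<lambda>x. r * \<phi> x)" using \<phi> by (auto simp: C0_def intro: continuous_intros)
  fix e :: real assume "e > 0"
  then have "e / (\<bar>r\<bar> + 1) > 0" by simp
  then obtain K where K: "compact K" "\<And>x. x \<notin> K \<Longrightarrow> \<bar>\<phi> x\<bar> < e / (\<bar>r\<bar> + 1)"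
    using \<phi> unfolding C0_def by blast
  have "\<bar>r * \<phi> x\<bar> < e" if "x \<notin> K" for x
  proof -
    have "\<bar>r * \<phi> x\<bar> \<le> (\<bar>r\<bar> + 1) * \<bar>\<phi> x\<bar>" by (simp add: abs_mult mult_right_mono)
    also have "\<dots> < e" using K(2)[OF that] by (simp add: field_simps)
    finally show ?thesis .
  qed
  with K(1) show "\<exists>K. compact K \<and> (\<forall>x. x \<notin> K \<longrightarrow> \<bar>r * \<phi> x\<bar> < e)" by blast
qed

lemma subspace_C0b: "subspace C0b"
proof (rule subspaceI)
  show "0 \<in> C0b" by (auto simp: C0b_def intro!: C0_compact_support[of _ "{}"])
qed (auto simp: C0b_def C0_add C0_mult)

lemma closed_C0b: "closed C0b"
  unfolding closed_sequential_limits
proof (intro allI impI, elim conjE)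
  fix f and l assume f: "\<forall>n. f n \<in> C0b" and lim: "f \<longlonglongrightarrow> l"
  show "l \<in> C0b"
    unfolding C0b_def C0_def
  proof safe
    fix e :: real assume "e > 0"
    then have e: "e / 2 > 0" by simp
    obtain n where n: "dist (f n) l < e / 2"
      using tendstoD[OF lim e] eventually_happens'[OF sequentially_bot] by blast
    have "apply_bcontfun (f n) \<in> C0" using f by (simp add: C0b_def)
    then obtain K where K: "compact K" "\<And>x. x \<notin> K \<Longrightarrow> \<bar>f n x\<bar> < e / 2" using e unfolding C0_def by blast
    have "\<bar>l x\<bar> < e" if "x \<notin> K" for x
      using K(2)[OF that] dist_bounded[of "f n" x l] n by (simp add: dist_real_def)
    with K(1) show "\<exists>K. compact K \<and> (\<forall>x. x \<notin> K \<longrightarrow> \<bar>l x\<bar> < e)" by blast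
  qed simp
qed

lemma S_right_continuous_0:
  assumes "f \<in> C0b"
  shows "((\<lambda>t. S t f) \<longlongrightarrow> f) (at_right 0)"
proof (rule uniform_limit_tendsto_bcontfun)
  have "uniform_limit UNIV (\<lambda>t. kernel_op \<kappa> t (apply_bcontfun f)) f (at_right 0)"
    using semigroup assms by (simp add: probability_semigroup_def C0b_def)
  moreover have "\<forall>\<^sub>F t in at_right 0. \<forall>x\<in>UNIV. apply_bcontfun (S t f) x = kernel_op \<kappa> t (apply_bcontfun f) x"
    using eventually_at_right_less by eventually_elim (simp add: apply_S)
  ultimately show "uniform_limit UNIV (\<lambda>t. apply_bcontfun (S t f)) f (at_right 0)"
    by (subst uniform_limit_cong) auto
qed

text \<open>Both orbits pass through the operator at the smaller time, a contraction, so only the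
  gap matters. Right continuity at 0 thereby becomes uniform continuity on the half-line.\<close>

lemma dist_S_le:
  assumes "t \<ge> 0" "s \<ge> 0"
  shows "dist (S t f) (S s f) \<le> dist (S \<bar>t - s\<bar> f) f"
proof -
  have *: "dist (S t f) (S s f) \<le> dist (S (t - s) f) f" if "0 \<le> s" "s \<le> t" for s t
  proof -
    interpret bounded_linear "S s" by (rule bounded_linear_S[OF that(1)])
    have "S t f = S s (S (t - s) f)" using S_add[of s "t - s" f] that by simp
    then have "dist (S t f) (S s f) = norm (S s (S (t - s) f - f))" by (simp add: dist_norm diff)
    also have "\<dots> \<le> norm (S (t - s) f - f)" by (rule norm_S_le[OF that(1)])
    finally show ?thesis by (simp add: dist_norm)
  qed
  show ?thesis using *[of s t] *[of t s] assms by (cases "s \<le> t") (auto simp: dist_commute abs_real_def)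
qed

lemma S_uniform:
  assumes f: "f \<in> C0b" and e: "e > 0"
  shows "\<exists>d>0. \<forall>t\<ge>0. \<forall>s\<ge>0. \<bar>t - s\<bar> < d \<longrightarrow> dist (S t f) (S s f) < e"
proof -
  obtain d where d: "d > 0" "\<And>h. 0 < h \<Longrightarrow> h < d \<Longrightarrow> dist (S h f) f < e"
    using tendstoD[OF S_right_continuous_0[OF f] e] unfolding eventually_at_right_field by auto
  have "dist (S t f) (S s f) < e" if "t \<ge> 0" "s \<ge> 0" "\<bar>t - s\<bar> < d" for t s
    using dist_S_le[OF that(1,2), of f] d(2)[of "\<bar>t - s\<bar>"] that e by (cases "t = s") auto
  with d(1) show ?thesis by blast
qed

lemma continuous_on_S:
  assumes "f \<in> C0b"
  shows "continuous_on {0..} (\<lambda>t. S t f)"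
  unfolding continuous_on_iff
proof (intro ballI allI impI)
  fix t e :: real assume "t \<in> {0..}" "e > 0"
  then show "\<exists>d>0. \<forall>s\<in>{0..}. dist s t < d \<longrightarrow> dist (S s f) (S t f) < e"
    using S_uniform[OF assms \<open>e > 0\<close>] by (auto simp: dist_real_def)
qed

section \<open>The generator and density of its domain\<close>

definition gen :: "('a \<Rightarrow>\<^sub>C real) \<Rightarrow> ('a \<Rightarrow>\<^sub>C real) \<Rightarrow> bool" where
  "gen f g \<longleftrightarrow> f \<in> C0b \<and> ((\<lambda>t. (S t f - f) /\<^sub>R t) \<longlongrightarrow> g) (at_right 0)"

lemma gen_imp_C0b:
  assumes "gen f g"
  shows "g \<in> C0b"
proof (rule Lim_in_closed_set[OF closed_C0b])
  have f: "f \<in> C0b" using assms by (simp add: gen_def)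
  show "\<forall>\<^sub>F t in at_right 0. (S t f - f) /\<^sub>R t \<in> C0b"
    using eventually_at_right_less
    by eventually_elim (intro subspace_scale subspace_diff subspace_C0b S_C0b f, auto simp: f)
qed (use assms in \<open>auto simp: gen_def\<close>)

lemma apply_quotient:
  "t > 0 \<Longrightarrow> apply_bcontfun ((S t f - f) /\<^sub>R t) x = (kernel_op \<kappa> t (apply_bcontfun f) x - f x) / t"
  by (simp add: apply_S divide_inverse mult.commute)

text \<open>The function \<psi> in \<open>generator\<close> is arbitrary a priori; as a uniform
  limit of bounded continuous quotients it is bounded and continuous, hence an element of the Banach
  space.\<close>

lemma generator_iff_gen: "(\<phi>, \<psi>) \<in> generator \<kappa> \<longleftrightarrow> (\<exists>f g. gen f g \<and> \<phi> = apply_bcontfun f \<and> \<psi> = apply_bcontfun g)"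
proof
  assume *: "(\<phi>, \<psi>) \<in> generator \<kappa>"
  then obtain f where f: "f \<in> C0b" "\<phi> = apply_bcontfun f"
    by (auto simp: generator_def elim: C0b_E)
  have "uniform_limit UNIV (\<lambda>t x. (kernel_op \<kappa> t \<phi> x - \<phi> x) / t) \<psi> (at_right 0)"
    using * by (simp add: generator_def)
  moreover have "\<forall>\<^sub>F t in at_right 0. \<forall>x\<in>UNIV. apply_bcontfun ((S t f - f) /\<^sub>R t) x = (kernel_op \<kappa> t \<phi> x - \<phi> x) / t"
    using eventually_at_right_less by eventually_elim (intro ballI, simp only: apply_quotient f(2))
  ultimately have "uniform_limit UNIV (\<lambda>t. apply_bcontfun ((S t f - f) /\<^sub>R t)) \<psi> (at_right 0)"
    by (subst uniform_limit_cong) auto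
  then obtain g where "\<psi> = apply_bcontfun g" "((\<lambda>t. (S t f - f) /\<^sub>R t) \<longlongrightarrow> g) (at_right 0)"
    by (rule uniform_limit_bcontfunE) auto
  with f show "\<exists>f g. gen f g \<and> \<phi> = apply_bcontfun f \<and> \<psi> = apply_bcontfun g"
    by (auto simp: gen_def)
next
  assume "\<exists>f g. gen f g \<and> \<phi> = apply_bcontfun f \<and> \<psi> = apply_bcontfun g"
  then obtain f g where fg: "gen f g" "\<phi> = apply_bcontfun f" "\<psi> = apply_bcontfun g" by blast
  then have "uniform_limit UNIV (\<lambda>t. apply_bcontfun ((S t f - f) /\<^sub>R t)) g (at_right 0)"
    by (intro tendsto_bcontfun_uniform_limit) (simp add: gen_def)
  moreover have "\<forall>\<^sub>F t in at_right 0. \<forall>x\<in>UNIV. apply_bcontfun ((S t f - f) /\<^sub>R t) x = (kernel_op \<kappa> t \<phi> x - \<phi> x) / t"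
    using eventually_at_right_less by eventually_elim (intro ballI, simp only: apply_quotient fg(2))
  ultimately have "uniform_limit UNIV (\<lambda>t x. (kernel_op \<kappa> t \<phi> x - \<phi> x) / t) \<psi> (at_right 0)"
    unfolding fg(3) by (subst (asm) uniform_limit_cong) auto
  then show "(\<phi>, \<psi>) \<in> generator \<kappa>"
    using fg by (simp add: generator_def gen_def C0b_def)
qed

lemma gen_S:
  assumes "gen f g" "t \<ge> 0"
  shows "gen (S t f) (S t g)"
proof -
  interpret bounded_linear "S t" by (rule bounded_linear_S[OF assms(2)])
  have "((\<lambda>h. S t ((S h f - f) /\<^sub>R h)) \<longlongrightarrow> S t g) (at_right 0)"
    using assms(1) by (intro tendsto) (simp add: gen_def)
  moreover have "\<forall>\<^sub>F h in at_right 0. S t ((S h f - f) /\<^sub>R h) = (S h (S t f) - S t f) /\<^sub>R h"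
    using eventually_at_right_less
  proof eventually_elim
    case (elim h)
    then have "S t (S h f) = S h (S t f)"
      using S_add[of t h f] S_add[of h t f] assms(2) by (simp add: add.commute)
    then show ?case by (simp add: scaleR diff)
  qed
  ultimately have "((\<lambda>h. (S h (S t f) - S t f) /\<^sub>R h) \<longlongrightarrow> S t g) (at_right 0)"
    by (rule Lim_transform_eventually)
  then show ?thesis using assms S_C0b by (simp add: gen_def)
qed

text \<open>Backward quotients arise when \<open>S (b - s) f\<close> is differentiated in s. Writing
  S r as S (r - h) after S h, contractivity bounds the error by that of the forward quotient plus
  \<open>dist (S h g) g\<close>.\<close>

lemma S_left_derivative:
  assumes fg: "gen f g" and r: "r > 0"
  shows "((\<lambda>h. (S (r - h) f - S r f) /\<^sub>R h) \<longlongrightarrow> - S r g) (at_right 0)"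
proof -
  have g: "g \<in> C0b" by (rule gen_imp_C0b[OF fg])
  have "((\<lambda>h. norm ((S h f - f) /\<^sub>R h - g) + dist (S h g) g) \<longlongrightarrow> norm (g - g) + dist g g) (at_right 0)"
    using fg by (intro tendsto_intros S_right_continuous_0 g) (simp add: gen_def)
  then have "((\<lambda>h. norm ((S h f - f) /\<^sub>R h - g) + dist (S h g) g) \<longlongrightarrow> 0) (at_right 0)" by simp
  then have "((\<lambda>h. (S (r - h) f - S r f) /\<^sub>R h - (- S r g)) \<longlongrightarrow> 0) (at_right 0)"
  proof (rule Lim_null_comparison[rotated])
    have "\<forall>\<^sub>F h in at_right (0::real). h \<in> {0<..<r}" using r by (rule eventually_at_right_real)
    then show "\<forall>\<^sub>F h in at_right 0. norm ((S (r - h) f - S r f) /\<^sub>R h - (- S r g)) \<le> norm ((S h f - f) /\<^sub>R h - g) + dist (S h g) g"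
    proof eventually_elim
      case (elim h)
      then have h: "0 < h" "0 \<le> r - h" by auto
      interpret bounded_linear "S (r - h)" by (rule bounded_linear_S[OF h(2)])
      have "S r f = S (r - h) (S h f)" using S_add[of "r - h" h f] h by simp
      then have "(S (r - h) f - S r f) /\<^sub>R h - (- S r g) = (S r g - S (r - h) g) - S (r - h) ((S h f - f) /\<^sub>R h - g)"
        by (simp add: scaleR diff add algebra_simps)
      also have "norm \<dots> \<le> norm (S r g - S (r - h) g) + norm (S (r - h) ((S h f - f) /\<^sub>R h - g))"
        by (rule norm_triangle_ineq4)
      also have "norm (S r g - S (r - h) g) \<le> dist (S h g) g"
        using dist_S_le[of r "r - h" g] h by (simp add: dist_norm)
      also have "norm (S (r - h) ((S h f - f) /\<^sub>R h - g)) \<le> norm ((S h f - f) /\<^sub>R h - g)"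
        by (rule norm_S_le[OF h(2)])
      finally show ?case by simp
    qed
  qed
  then show ?thesis by (rule LIM_zero_cancel)
qed

text \<open>Time averages of orbits lie in the domain even if f does not: applying S t shifts the
  window, and what remains are integrals over [h, h+t] and [0, t], which divided by t tend to S h f
  and f.\<close>

lemma gen_average:
  assumes f: "f \<in> C0b" and h: "h > 0"
  shows "gen (integral {0..h} (\<lambda>s. S s f)) (S h f - f)"
proof -
  have cont: "continuous_on {a..b} (\<lambda>s. S s f)" if "a \<ge> 0" for a b
    by (rule continuous_on_subset[OF continuous_on_S[OF f]]) (use that in auto)
  have int: "(\<lambda>s. S s f) integrable_on {a..b}" if "a \<ge> 0" for a b
    by (rule integrable_continuous_interval[OF cont[OF that]])
  define J where "J = integral {0..h} (\<lambda>s. S s f)"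
  \<comment> \<open>The integral is a limit of Riemann sums, which lie in the closed subspace
    \<open>C0b\<close>.\<close>
  have J: "J \<in> C0b"
  proof -
    have "\<exists>y\<in>C0b. norm (y - J) < e" if "e > 0" for e
    proof -
      have "((\<lambda>s. S s f) has_integral J) (cbox 0 h)"
        unfolding J_def box_real by (rule integrable_integral) (simp add: int)
      from this[unfolded has_integral, rule_format, OF \<open>e > 0\<close>]
      obtain \<gamma> where \<gamma>: "gauge \<gamma>" "\<forall>p. p tagged_division_of (cbox 0 h) \<and> \<gamma> fine p \<longrightarrow>
          norm ((\<Sum>(x,k)\<in>p. measure lborel k *\<^sub>R S x f) - J) < e"
        by (elim exE conjE)
      obtain p where p: "p tagged_division_of (cbox 0 h)" "\<gamma> fine p" using fine_division_exists[OF \<gamma>(1)] by blast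
      have "(\<Sum>(x,k)\<in>p. measure lborel k *\<^sub>R S x f) \<in> C0b"
      proof (rule subspace_sum[OF subspace_C0b])
        fix z assume z: "z \<in> p"
        obtain x k where zxk: "z = (x, k)" by (cases z)
        then have "x \<in> cbox 0 h" using tag_in_interval[OF p(1)] z by simp
        then have "S x f \<in> C0b" by (intro S_C0b f) auto
        then show "(case z of (x, k) \<Rightarrow> measure lborel k *\<^sub>R S x f) \<in> C0b"
          by (simp add: zxk subspace_scale[OF subspace_C0b])
      qed
      with \<gamma>(2)[rule_format, OF conjI, OF p] show ?thesis by blast
    qed
    then have "J \<in> closure C0b" by (auto simp: closure_approachable dist_norm)
    then show ?thesis using closed_C0b by simp
  qed
  have SJ: "S t J - J = integral {h..h+t} (\<lambda>s. S s f) - integral {0..t} (\<lambda>s. S s f)" if t: "t > 0" for t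
  proof -
    have "S t J = integral {0..h} (\<lambda>s. S t (S s f))"
      unfolding J_def using integral_linear[OF int[of 0 h] bounded_linear_S[of t]] t by (simp add: comp_def)
    also have "\<dots> = integral {0..h} (\<lambda>s. S (s + t) f)"
      using t by (intro integral_cong) (simp add: add.commute[of _ t] S_add)
    also have "\<dots> = integral {t..h+t} (\<lambda>s. S s f)"
      using integral_shift_real_ivl[of t t "h + t" "\<lambda>s. S s f"] by simp
    finally have 1: "S t J = integral {t..h+t} (\<lambda>s. S s f)" .
    have "integral {0..t} (\<lambda>s. S s f) + integral {t..h+t} (\<lambda>s. S s f) = integral {0..h+t} (\<lambda>s. S s f)"
      using t h int[of 0 "h+t"] by (intro Henstock_Kurzweil_Integration.integral_combine) auto
    moreover have "J + integral {h..h+t} (\<lambda>s. S s f) = integral {0..h+t} (\<lambda>s. S s f)"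
      unfolding J_def using t h int[of 0 "h+t"] by (intro Henstock_Kurzweil_Integration.integral_combine) auto
    ultimately have "integral {0..t} (\<lambda>s. S s f) + S t J = J + integral {h..h+t} (\<lambda>s. S s f)"
      by (simp add: 1)
    then show ?thesis by (simp add: algebra_simps)
  qed
  have deriv: "((\<lambda>t. integral {a..a+t} (\<lambda>s. S s f) /\<^sub>R t) \<longlongrightarrow> S a f) (at_right 0)" if a: "a \<ge> 0" for a
  proof -
    have "((\<lambda>u. integral {a..u} (\<lambda>s. S s f)) has_vector_derivative S a f) (at a within {a..a+1})"
      by (rule integral_has_vector_derivative[OF cont[OF a]]) auto
    then have "((\<lambda>u. (integral {a..u} (\<lambda>s. S s f) - integral {a..a} (\<lambda>s. S s f) - (u - a) *\<^sub>R S a f) /\<^sub>R norm (u - a)) \<longlongrightarrow> 0) (at_right a)"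
      unfolding has_vector_derivative_def has_derivative_at_within by (simp add: at_within_Icc_at_right)
    then have "((\<lambda>t. (integral {a..t+a} (\<lambda>s. S s f) - t *\<^sub>R S a f) /\<^sub>R \<bar>t\<bar>) \<longlongrightarrow> 0) (at_right 0)"
      by (simp add: filterlim_at_right_to_0[of _ _ a])
    moreover have "\<forall>\<^sub>F t in at_right 0. (integral {a..t+a} (\<lambda>s. S s f) - t *\<^sub>R S a f) /\<^sub>R \<bar>t\<bar> = integral {a..a+t} (\<lambda>s. S s f) /\<^sub>R t - S a f"
      using eventually_at_right_less by eventually_elim (simp add: scaleR_diff_right add.commute)
    ultimately have "((\<lambda>t. integral {a..a+t} (\<lambda>s. S s f) /\<^sub>R t - S a f) \<longlongrightarrow> 0) (at_right 0)"
      by (rule Lim_transform_eventually)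
    then show ?thesis by (rule LIM_zero_cancel)
  qed
  have "((\<lambda>t. integral {h..h+t} (\<lambda>s. S s f) /\<^sub>R t - integral {0..0+t} (\<lambda>s. S s f) /\<^sub>R t) \<longlongrightarrow> S h f - S 0 f) (at_right 0)"
    using h by (intro tendsto_diff deriv) auto
  moreover have "\<forall>\<^sub>F t in at_right 0. integral {h..h+t} (\<lambda>s. S s f) /\<^sub>R t - integral {0..0+t} (\<lambda>s. S s f) /\<^sub>R t = (S t J - J) /\<^sub>R t"
    using eventually_at_right_less by eventually_elim (simp add: SJ scaleR_diff_right)
  ultimately have "((\<lambda>t. (S t J - J) /\<^sub>R t) \<longlongrightarrow> S h f - f) (at_right 0)"
    by (simp add: Lim_transform_eventually)
  with J show ?thesis by (simp add: gen_def J_def)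
qed

text \<open>Averaging over a window on which the orbit stays within e/2 of f moves f by at most
  e/2.\<close>

lemma gen_dense:
  assumes f: "f \<in> C0b" and e: "e > 0"
  shows "\<exists>u v. gen u v \<and> dist u f < e"
proof -
  obtain d where d: "d > 0" "\<And>t s. t \<ge> 0 \<Longrightarrow> s \<ge> 0 \<Longrightarrow> \<bar>t - s\<bar> < d \<Longrightarrow> dist (S t f) (S s f) < e / 2"
    using S_uniform[OF f, of "e / 2"] e by auto
  define h where "h = d / 2"
  have h: "h > 0" "h < d" using d by (auto simp: h_def)
  have cont: "continuous_on {0..h} (\<lambda>s. S s f)"
    by (rule continuous_on_subset[OF continuous_on_S[OF f]]) auto
  define J where "J = integral {0..h} (\<lambda>s. S s f)"
  have G: "gen J (S h f - f)" unfolding J_def by (rule gen_average[OF f h(1)])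
  have "gen (J /\<^sub>R h) ((S h f - f) /\<^sub>R h)"
  proof -
    have "((\<lambda>t. ((S t J - J) /\<^sub>R t) /\<^sub>R h) \<longlongrightarrow> (S h f - f) /\<^sub>R h) (at_right 0)"
      using G by (intro tendsto_intros) (simp add: gen_def)
    moreover have "\<forall>\<^sub>F t in at_right 0. ((S t J - J) /\<^sub>R t) /\<^sub>R h = (S t (J /\<^sub>R h) - J /\<^sub>R h) /\<^sub>R t"
      using eventually_at_right_less
    proof eventually_elim
      case (elim t)
      interpret bounded_linear "S t" by (rule bounded_linear_S) (use elim in simp)
      show ?case by (simp add: scaleR scaleR_diff_right mult.commute)
    qed
    ultimately show ?thesis
      using G subspace_scale[OF subspace_C0b] by (simp add: gen_def Lim_transform_eventually)
  qed
  moreover have "dist (J /\<^sub>R h) f < e"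
  proof -
    have i: "(\<lambda>s. S s f) integrable_on {0..h}" by (rule integrable_continuous_interval[OF cont])
    have "J - h *\<^sub>R f = integral {0..h} (\<lambda>s. S s f - f)"
      unfolding J_def using h i by (subst integral_diff) auto
    also have "norm \<dots> \<le> e / 2 * (h - 0)"
    proof (rule integral_bound)
      show "norm (S s f - f) \<le> e / 2" if "s \<in> {0..h}" for s
        using d(2)[of s 0] that h by (simp add: dist_norm)
    qed (use h cont in \<open>auto intro!: continuous_intros\<close>)
    finally have *: "norm (J - h *\<^sub>R f) \<le> e / 2 * h" by simp
    have "J /\<^sub>R h - f = (J - h *\<^sub>R f) /\<^sub>R h" using h by (simp add: scaleR_diff_right)
    then have "norm (J /\<^sub>R h - f) = norm (J - h *\<^sub>R f) / h" using h by (simp add: divide_inverse mult.commute)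
    also have "\<dots> \<le> e / 2" using * h by (simp add: divide_le_eq)
    finally show ?thesis using e by (simp add: dist_norm)
  qed
  ultimately show ?thesis by blast
qed

end

section \<open>Uniqueness of the dual flow\<close>

context relaxed_semimetric begin

lemma abs_integral_le_norm:
  fixes f :: "'a \<Rightarrow>\<^sub>C real"
  assumes "\<mu> \<in> borel_probs"
  shows "\<bar>\<integral>x. f x \<partial>\<mu>\<bar> \<le> norm f"
proof -
  interpret prob_space \<mu> by (rule borel_probsD(1)[OF assms])
  have i: "integrable \<mu> f" by (rule integrable_bcontfun[OF assms apply_bcontfun])
  have "\<bar>\<integral>x. f x \<partial>\<mu>\<bar> \<le> (\<integral>x. \<bar>f x\<bar> \<partial>\<mu>)" by (rule integral_abs_bound)
  also have "\<dots> \<le> (\<integral>x. norm f \<partial>\<mu>)"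
    by (rule integral_mono) (use i norm_bounded[of f] in auto)
  finally show ?thesis by (simp add: prob_space)
qed

lemma bounded_linear_integral:
  assumes "\<mu> \<in> borel_probs"
  shows "bounded_linear (\<lambda>f :: 'a \<Rightarrow>\<^sub>C real. \<integral>x. f x \<partial>\<mu>)"
proof (rule bounded_linear_intro[where K=1])
  have i: "integrable \<mu> f" for f :: "'a \<Rightarrow>\<^sub>C real" by (rule integrable_bcontfun[OF assms apply_bcontfun])
  show "(\<integral>x. (f + g) x \<partial>\<mu>) = (\<integral>x. f x \<partial>\<mu>) + (\<integral>x. g x \<partial>\<mu>)" for f g :: "'a \<Rightarrow>\<^sub>C real"
    using i by simp
qed (use abs_integral_le_norm[OF assms] in auto)

end

context relaxed_semimetric_semigroup begin

text \<open>The derivative is required only inside the interval, which fits curves whose generator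
  changes at the endpoints; continuity reaches the endpoints themselves.\<close>

lemma strong_dual_flow_unique:
  assumes ab: "a \<le> b"
    and \<sigma>: "\<And>s. s \<in> {a..b} \<Longrightarrow> \<sigma> s \<in> borel_probs"
    and weak: "\<And>\<phi>. \<phi> \<in> C0 \<Longrightarrow> continuous_on {a..b} (\<lambda>s. \<integral>x. \<phi> x \<partial>(\<sigma> s))"
    and deriv: "\<And>s \<phi> \<psi>. s \<in> {a<..<b} \<Longrightarrow> (\<phi>, \<psi>) \<in> generator \<kappa> \<Longrightarrow>
      ((\<lambda>h. ((\<integral>x. \<phi> x \<partial>(\<sigma> (s + h))) - (\<integral>x. \<phi> x \<partial>(\<sigma> s))) / h) \<longlongrightarrow> (\<integral>x. \<psi> x \<partial>(\<sigma> s))) (at_right 0)"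
    and \<phi>: "\<phi> \<in> C0"
  shows "(\<integral>x. \<phi> x \<partial>(\<sigma> b)) = (\<integral>x. kernel_op \<kappa> (b - a) \<phi> x \<partial>(\<sigma> a))"
proof -
  define E where "E s f = (\<integral>x. apply_bcontfun f x \<partial>(\<sigma> s))" for s and f :: "'a \<Rightarrow>\<^sub>C real"
  have bl: "bounded_linear (E s)" if "s \<in> {a..b}" for s
    unfolding E_def using bounded_linear_integral[OF \<sigma>[OF that]] .
  have En: "\<bar>E s f\<bar> \<le> norm f" if "s \<in> {a..b}" for s f
    unfolding E_def using abs_integral_le_norm[OF \<sigma>[OF that]] .
  have Ec: "continuous_on {a..b} (\<lambda>s. E s f)" if "f \<in> C0b" for f
    unfolding E_def using weak that by (simp add: C0b_def)
  have main: "E b f = E a (S (b - a) f)" if fg: "gen f g" for f g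
  proof -
    have f: "f \<in> C0b" and g: "g \<in> C0b" using fg gen_imp_C0b by (auto simp: gen_def)
    define G where "G s = E s (S (b - s) f)" for s
    have "G b = G a"
    proof (rule right_derivative_zero_imp_eq[OF ab])
      \<comment> \<open>E u is a contraction for every u, so moving the argument costs the norm of S
        (b - u) f - F, uniformly in u. The measure moves only against the fixed F, where weak
        continuity applies.\<close>
      show "continuous_on {a..b} G"
        unfolding continuous_on_def
      proof
        fix s assume s: "s \<in> {a..b}"
        define F where "F = S (b - s) f"
        have F: "F \<in> C0b" unfolding F_def using s by (intro S_C0b f) auto
        have "((\<lambda>u. S (b - u) f) \<longlongrightarrow> S (b - s) f) (at s within {a..b})"
        proof -
          have "continuous_on {a..b} (\<lambda>u. S (b - u) f)"
            by (rule continuous_on_compose2[OF continuous_on_S[OF f]]) (auto intro!: continuous_intros)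
          then show ?thesis using s by (simp add: continuous_on_def)
        qed
        then have "((\<lambda>u. norm (S (b - u) f - F)) \<longlongrightarrow> 0) (at s within {a..b})"
          unfolding F_def by (intro tendsto_norm_zero LIM_zero)
        then have "((\<lambda>u. E u (S (b - u) f - F)) \<longlongrightarrow> 0) (at s within {a..b})"
          by (rule Lim_null_comparison[rotated]) (use En in \<open>auto simp: eventually_at_filter\<close>)
        moreover have "((\<lambda>u. E u F) \<longlongrightarrow> E s F) (at s within {a..b})"
          using Ec[OF F] s by (simp add: continuous_on_def)
        ultimately have "((\<lambda>u. E u (S (b - u) f - F) + E u F) \<longlongrightarrow> 0 + E s F) (at s within {a..b})"
          by (rule tendsto_add)
        moreover have "\<forall>\<^sub>F u in at s within {a..b}. E u (S (b - u) f - F) + E u F = G u"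
          unfolding eventually_at_filter
        proof (intro always_eventually allI impI)
          fix u assume u: "u \<in> {a..b}"
          interpret bounded_linear "E u" by (rule bl[OF u])
          show "E u (S (b - u) f - F) + E u F = G u" by (simp add: diff G_def)
        qed
        ultimately show "(G \<longlongrightarrow> G s) (at s within {a..b})"
          unfolding G_def[of s] F_def[symmetric] by (simp add: Lim_transform_eventually)
      qed
    next
      fix s assume s: "s \<in> {a<..<b}"
      then have s': "s \<in> {a..b}" by auto
      define F where "F = S (b - s) f"
      define q where "q = S (b - s) g"
      have Fq: "gen F q" unfolding F_def q_def using s by (intro gen_S fg) auto
      have q: "- q \<in> C0b" using subspace_neg[OF subspace_C0b] gen_imp_C0b[OF Fq] .
      define D where "D h = (S (b - s - h) f - S (b - s) f) /\<^sub>R h" for h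
      have D: "(D \<longlongrightarrow> - q) (at_right 0)"
        unfolding D_def q_def using s by (intro S_left_derivative[OF fg]) auto
      have ev: "\<forall>\<^sub>F h in at_right 0. h \<in> {0<..<b - s}"
        using s by (intro eventually_at_right_real) auto
      have "((\<lambda>h. norm (D h - (- q))) \<longlongrightarrow> 0) (at_right 0)"
        using D by (intro tendsto_norm_zero LIM_zero)
      then have 1: "((\<lambda>h. E (s + h) (D h - (- q))) \<longlongrightarrow> 0) (at_right 0)"
        by (rule Lim_null_comparison[rotated]) (use ev s in \<open>auto elim!: eventually_mono intro!: En\<close>)
      have "((\<lambda>u. E u (- q)) \<longlongrightarrow> E s (- q)) (at_right s)"
      proof -
        have "continuous_on {s..b} (\<lambda>u. E u (- q))"
          by (rule continuous_on_subset[OF Ec[OF q]]) (use s in auto)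
        then show ?thesis
          using s by (auto simp: continuous_on_def at_within_Icc_at_right dest!: bspec[of _ _ s])
      qed
      then have 2: "((\<lambda>h. E (s + h) (- q)) \<longlongrightarrow> E s (- q)) (at_right 0)"
        by (simp add: filterlim_at_right_to_0[of _ _ s] add.commute)
      have 3: "((\<lambda>h. (E (s + h) F - E s F) / h) \<longlongrightarrow> E s q) (at_right 0)"
        unfolding E_def using Fq generator_iff_gen by (intro deriv[OF s]) blast
      \<comment> \<open>The increment of G splits into moving the semigroup, whose quotient D tends
        to -q and is tested by the measure at s + h, and moving the measure against the fixed F,
        which contributes +q. The two cancel.\<close>
      have L: "((\<lambda>h. E (s + h) (D h - (- q)) + E (s + h) (- q) + (E (s + h) F - E s F) / h) \<longlongrightarrow> 0 + E s (- q) + E s q) (at_right 0)"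
        by (intro tendsto_add 1 2 3)
      have Z: "0 + E s (- q) + E s q = 0"
      proof -
        interpret bounded_linear "E s" by (rule bl[OF s'])
        show ?thesis by (simp add: neg)
      qed
      have V: "\<forall>\<^sub>F h in at_right 0. E (s + h) (D h - (- q)) + E (s + h) (- q) + (E (s + h) F - E s F) / h = (G (s + h) - G s) / h"
        using ev
      proof eventually_elim
        case (elim h)
        then have h: "s + h \<in> {a..b}" "h > 0" using s by auto
        interpret bounded_linear "E (s + h)" by (rule bl[OF h(1)])
        have "E (s + h) (D h - (- q)) + E (s + h) (- q) = E (s + h) (D h)" by (simp add: diff neg add)
        also have "\<dots> = (G (s + h) - E (s + h) F) / h"
          by (simp add: D_def scaleR diff G_def F_def diff_diff_eq divide_inverse mult.commute)
        finally show ?case by (simp add: G_def[of s] F_def diff_divide_distrib)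
      qed
      show "((\<lambda>h. (G (s + h) - G s) / h) \<longlongrightarrow> 0) (at_right 0)"
        using Lim_transform_eventually[OF L V] unfolding Z .
    qed
    then show ?thesis by (simp add: G_def)
  qed
  obtain f where f: "f \<in> C0b" "\<phi> = apply_bcontfun f" using C0b_E[OF \<phi>] .
  \<comment> \<open>Both sides are contractions in f, so the identity passes from the generator
    domain to its closure.\<close>
  have "\<bar>E b f - E a (S (b - a) f)\<bar> \<le> 0"
  proof (rule field_le_epsilon)
    fix e :: real assume "e > 0"
    then obtain u v where uv: "gen u v" "dist u f < e / 2" using gen_dense[OF f(1), of "e / 2"] by auto
    interpret Eb: bounded_linear "E b" using ab by (intro bl) auto
    interpret Ea: bounded_linear "E a" using ab by (intro bl) auto
    interpret Sba: bounded_linear "S (b - a)" using ab by (intro bounded_linear_S) auto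
    have "E b f - E a (S (b - a) f) = E a (S (b - a) (u - f)) - E b (u - f)"
      using main[OF uv(1)] by (simp add: Eb.diff Ea.diff Sba.diff)
    also have "\<bar>\<dots>\<bar> \<le> \<bar>E a (S (b - a) (u - f))\<bar> + \<bar>E b (u - f)\<bar>" by simp
    also have "\<bar>E a (S (b - a) (u - f))\<bar> \<le> norm (S (b - a) (u - f))" using ab by (intro En) auto
    also have "\<dots> \<le> norm (u - f)" using ab by (intro norm_S_le) auto
    also have "\<bar>E b (u - f)\<bar> \<le> norm (u - f)" using ab by (intro En) auto
    finally show "\<bar>E b f - E a (S (b - a) f)\<bar> \<le> 0 + e" using uv(2) by (simp add: dist_norm)
  qed
  then show ?thesis using ab by (simp add: E_def f(2) apply_S)
qed

section \<open>The dual action on measures\<close>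

text \<open>Weak continuity says nothing directly about sets. For open U, approximation by
  \<open>C0\<close> functions exhibits the kernel mass of U as a pointwise limit of continuous
  functions of x, and open sets form a generating pi-system.\<close>

lemma kernel_measurable:
  assumes t: "t \<ge> 0"
  shows "\<kappa> t \<in> borel \<rightarrow>\<^sub>M subprob_algebra borel"
proof (rule measurable_subprob_algebra_generated[where G="{U. open U}" and \<Omega>=UNIV])
  fix U :: "'a set" assume "U \<in> {U. open U}"
  then have U: "open U" by simp
  obtain f where f: "\<And>n. f n \<in> (C0 :: ('a \<Rightarrow> real) set)" "\<And>n x. 0 \<le> f n x" "\<And>n x. f n x \<le> 1"
    "\<And>x. (\<lambda>n. f n x) \<longlonglongrightarrow> indicator U x"
    using open_approx_C0[OF U] by blast
  have "(\<lambda>x. measure (\<kappa> t x) U) \<in> borel_measurable borel"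
  proof (rule borel_measurable_LIMSEQ_real)
    show "(\<lambda>n. kernel_op \<kappa> t (f n) x) \<longlonglongrightarrow> measure (\<kappa> t x) U" for x
      unfolding kernel_op_def by (rule integral_approx_open[OF kernel_probs[OF t] f U])
    show "kernel_op \<kappa> t (f n) \<in> borel_measurable borel" for n
      by (rule borel_measurable_bcontfun[OF kernel_op_bcontfun[OF t C0_bcontfun[OF f(1)]]])
  qed
  moreover have "emeasure (\<kappa> t x) U = ennreal (measure (\<kappa> t x) U)" for x
    using kernel_probs[OF t, of x]
    by (intro finite_measure.emeasure_eq_measure prob_space.finite_measure borel_probsD)
  ultimately show "(\<lambda>x. emeasure (\<kappa> t x) U) \<in> borel_measurable borel" by simp
next
  have "emeasure (\<kappa> t x) UNIV = 1" for x
    using prob_space.emeasure_space_1[OF borel_probsD(1)[OF kernel_probs[OF t, of x]]]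
      space_borel_probs[OF kernel_probs[OF t, of x]] by simp
  then show "(\<lambda>x. emeasure (\<kappa> t x) UNIV) \<in> borel_measurable borel" by simp
next
  show "subprob_space (\<kappa> t x)" "sets (\<kappa> t x) = sets borel" for x
    using borel_probsD[OF kernel_probs[OF t, of x]] by (auto intro: prob_space_imp_subprob_space)
qed (auto simp: borel_def Int_stable_def)

text \<open>The measure is the mixture of the kernels under \<mu>; its existence gives meaning to
  the definite description in \<open>dual_exp\<close>.\<close>

lemma dual_measure_exists:
  assumes t: "t \<ge> 0" and \<mu>: "\<mu> \<in> borel_probs"
  shows "\<exists>\<nu>\<in>borel_probs. \<forall>\<phi>\<in>bcontfun. (\<integral>x. \<phi> x \<partial>\<nu>) = (\<integral>x. kernel_op \<kappa> t \<phi> x \<partial>\<mu>)"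
proof
  interpret \<mu>: prob_space \<mu> by (rule borel_probsD(1)[OF \<mu>])
  have K: "\<kappa> t \<in> \<mu> \<rightarrow>\<^sub>M subprob_algebra borel"
    using kernel_measurable[OF t] by (simp add: measurable_cong_sets[OF borel_probsD(2)[OF \<mu>] refl])
  show "\<mu> \<bind> \<kappa> t \<in> borel_probs"
    unfolding borel_probs_def
  proof safe
    show "prob_space (\<mu> \<bind> \<kappa> t)"
      using borel_probsD(1)[OF kernel_probs[OF t]] K by (intro \<mu>.prob_space_bind) auto
    show "x \<in> sets borel" if "x \<in> sets (\<mu> \<bind> \<kappa> t)" for x
      using that sets_bind_measurable[OF K \<mu>.not_empty] by simp
    show "x \<in> sets (\<mu> \<bind> \<kappa> t)" if "x \<in> sets borel" for x
      using that sets_bind_measurable[OF K \<mu>.not_empty] by simp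
  qed
  show "\<forall>\<phi>\<in>bcontfun. (\<integral>x. \<phi> x \<partial>(\<mu> \<bind> \<kappa> t)) = (\<integral>x. kernel_op \<kappa> t \<phi> x \<partial>\<mu>)"
  proof
    fix \<phi> :: "'a \<Rightarrow> real" assume \<phi>: "\<phi> \<in> bcontfun"
    obtain b where b: "\<And>x. \<bar>\<phi> x\<bar> \<le> b" using bcontfun_bounded[OF \<phi>] by blast
    show "(\<integral>x. \<phi> x \<partial>(\<mu> \<bind> \<kappa> t)) = (\<integral>x. kernel_op \<kappa> t \<phi> x \<partial>\<mu>)"
      unfolding kernel_op_def
    proof (rule integral_bind[where K=borel and B=b and B'=1])
      show "\<phi> \<in> borel_measurable borel" by (rule borel_measurable_bcontfun[OF \<phi>])
      show "AE x in \<mu>. emeasure (\<kappa> t x) (space (\<kappa> t x)) \<le> ennreal 1"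
        using prob_space.emeasure_space_1[OF borel_probsD(1)[OF kernel_probs[OF t]]] by simp
    qed (use b K \<mu>.not_empty \<mu>.finite_measure_axioms in auto)
  qed
qed

end

context relaxed_semimetric begin

lemma generators_c_semigroup:
  assumes "A \<in> generators_c c"
  shows "probability_semigroup (semigroup_of A)" "generator (semigroup_of A) = A"
proof -
  have "\<exists>\<kappa>. probability_semigroup \<kappa> \<and> generator \<kappa> = A" using assms by (simp add: generators_c_def)
  from someI_ex[OF this] show "probability_semigroup (semigroup_of A)" "generator (semigroup_of A) = A"
    by (auto simp: semigroup_of_def)
qed

lemma generators_c_locale:
  "A \<in> generators_c c \<Longrightarrow> relaxed_semimetric_semigroup c B (semigroup_of A)"
  using generators_c_semigroup
  by (intro relaxed_semimetric_semigroup.intro relaxed_semimetric_semigroup_axioms.intro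
      relaxed_semimetric_axioms) auto

lemma exp_op_bcontfun: "A \<in> generators_c c \<Longrightarrow> t \<ge> 0 \<Longrightarrow> \<phi> \<in> bcontfun \<Longrightarrow> exp_op t A \<phi> \<in> bcontfun"
  using relaxed_semimetric_semigroup.kernel_op_bcontfun[OF generators_c_locale] by (simp add: exp_op_def)

text \<open>The definition of \<open>dual_exp\<close> tests against all bounded continuous
  functions. Agreement on \<open>C0\<close> is enough once a measure with the full property exists,
  because \<open>C0\<close> already separates measures.\<close>

lemma dual_exp_eqI:
  assumes A: "A \<in> generators_c c" and t: "t \<ge> 0" and \<mu>: "\<mu> \<in> borel_probs" and \<nu>: "\<nu> \<in> borel_probs"
    and eq: "\<And>\<phi>. \<phi> \<in> C0 \<Longrightarrow> (\<integral>x. \<phi> x \<partial>\<nu>) = (\<integral>x. exp_op t A \<phi> x \<partial>\<mu>)"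
  shows "dual_exp \<mu> t A = \<nu>"
proof -
  obtain \<nu>' where \<nu>': "\<nu>' \<in> borel_probs" "\<forall>\<phi>\<in>bcontfun. (\<integral>x. \<phi> x \<partial>\<nu>') = (\<integral>x. exp_op t A \<phi> x \<partial>\<mu>)"
    using relaxed_semimetric_semigroup.dual_measure_exists[OF generators_c_locale[OF A] t \<mu>]
    unfolding exp_op_def by blast
  have *: "\<nu>1 = \<nu>" if "\<nu>1 \<in> borel_probs" "\<forall>\<phi>\<in>bcontfun. (\<integral>x. \<phi> x \<partial>\<nu>1) = (\<integral>x. exp_op t A \<phi> x \<partial>\<mu>)" for \<nu>1
    by (rule measure_eqI_C0[OF that(1) \<nu>]) (simp add: eq that(2) C0_bcontfun)
  show ?thesis
    unfolding dual_exp_def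
  proof (rule the_equality)
    show "\<nu> \<in> borel_probs \<and> (\<forall>\<phi>\<in>bcontfun. (\<integral>x. \<phi> x \<partial>\<nu>) = (\<integral>x. exp_op t A \<phi> x \<partial>\<mu>))"
      using *[OF \<nu>'] \<nu>' by simp
  qed (use * in blast)
qed

lemma dual_exp:
  assumes A: "A \<in> generators_c c" and t: "t \<ge> 0" and \<mu>: "\<mu> \<in> borel_probs"
  shows "dual_exp \<mu> t A \<in> borel_probs"
    and "\<phi> \<in> bcontfun \<Longrightarrow> (\<integral>x. \<phi> x \<partial>(dual_exp \<mu> t A)) = (\<integral>x. exp_op t A \<phi> x \<partial>\<mu>)"
proof -
  obtain \<nu> where \<nu>: "\<nu> \<in> borel_probs" "\<forall>\<phi>\<in>bcontfun. (\<integral>x. \<phi> x \<partial>\<nu>) = (\<integral>x. exp_op t A \<phi> x \<partial>\<mu>)"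
    using relaxed_semimetric_semigroup.dual_measure_exists[OF generators_c_locale[OF A] t \<mu>]
    unfolding exp_op_def by blast
  have "dual_exp \<mu> t A = \<nu>"
    by (rule dual_exp_eqI[OF A t \<mu> \<nu>(1)]) (simp add: \<nu>(2) C0_bcontfun)
  then show "dual_exp \<mu> t A \<in> borel_probs"
    and "\<phi> \<in> bcontfun \<Longrightarrow> (\<integral>x. \<phi> x \<partial>(dual_exp \<mu> t A)) = (\<integral>x. exp_op t A \<phi> x \<partial>\<mu>)"
    using \<nu> by auto
qed

lemma dual_exp_0:
  assumes A: "A \<in> generators_c c" and \<mu>: "\<mu> \<in> borel_probs"
  shows "dual_exp \<mu> 0 A = \<mu>"
  using generators_c_semigroup(1)[OF A]
  by (intro dual_exp_eqI[OF A _ \<mu> \<mu>]) (simp_all add: exp_op_def probability_semigroup_def C0_bcontfun)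

lemma dual_exp_add:
  assumes A: "A \<in> generators_c c" and t: "t \<ge> 0" "s \<ge> 0" and \<mu>: "\<mu> \<in> borel_probs"
  shows "dual_exp \<mu> (t + s) A = dual_exp (dual_exp \<mu> t A) s A"
proof (rule dual_exp_eqI[OF A _ \<mu>])
  note d = dual_exp[OF A t(1) \<mu>]
  show "dual_exp (dual_exp \<mu> t A) s A \<in> borel_probs" by (rule dual_exp(1)[OF A t(2) d(1)])
  fix \<phi> :: "'a \<Rightarrow> real" assume "\<phi> \<in> C0"
  then have \<phi>: "\<phi> \<in> bcontfun" by (rule C0_bcontfun)
  have "exp_op (t + s) A \<phi> = exp_op t A (exp_op s A \<phi>)"
    using generators_c_semigroup(1)[OF A] t \<phi> by (simp add: exp_op_def probability_semigroup_def)
  then show "(\<integral>x. \<phi> x \<partial>(dual_exp (dual_exp \<mu> t A) s A)) = (\<integral>x. exp_op (t + s) A \<phi> x \<partial>\<mu>)"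
    using dual_exp(2)[OF A t(2) d(1) \<phi>] d(2)[OF exp_op_bcontfun[OF A t(2) \<phi>]] by simp
qed (use t in simp)

lemma dual_exp_right_derivative:
  assumes A: "A \<in> generators_c c" and \<mu>: "\<mu> \<in> borel_probs" and \<phi>\<psi>: "(\<phi>, \<psi>) \<in> A"
  shows "((\<lambda>h. ((\<integral>x. \<phi> x \<partial>(dual_exp \<mu> h A)) - (\<integral>x. \<phi> x \<partial>\<mu>)) / h) \<longlongrightarrow> (\<integral>x. \<psi> x \<partial>\<mu>)) (at_right 0)"
proof -
  interpret relaxed_semimetric_semigroup c B "semigroup_of A" by (rule generators_c_locale[OF A])
  interpret E: bounded_linear "\<lambda>f :: 'a \<Rightarrow>\<^sub>C real. \<integral>x. f x \<partial>\<mu>" by (rule bounded_linear_integral[OF \<mu>])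
  obtain f g where fg: "gen f g" "\<phi> = apply_bcontfun f" "\<psi> = apply_bcontfun g"
    using \<phi>\<psi> generator_iff_gen unfolding generators_c_semigroup(2)[OF A] by blast
  have "((\<lambda>h. \<integral>x. ((S h f - f) /\<^sub>R h) x \<partial>\<mu>) \<longlongrightarrow> (\<integral>x. g x \<partial>\<mu>)) (at_right 0)"
    using fg(1) by (intro E.tendsto) (simp add: gen_def)
  moreover have "\<forall>\<^sub>F h in at_right 0. (\<integral>x. ((S h f - f) /\<^sub>R h) x \<partial>\<mu>) =
      ((\<integral>x. \<phi> x \<partial>(dual_exp \<mu> h A)) - (\<integral>x. \<phi> x \<partial>\<mu>)) / h"
    using eventually_at_right_less
  proof eventually_elim
    case (elim h)
    then have "(\<integral>x. S h f x \<partial>\<mu>) = (\<integral>x. \<phi> x \<partial>(dual_exp \<mu> h A))"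
      using dual_exp(2)[OF A _ \<mu> apply_bcontfun, of h f] by (simp add: apply_S exp_op_def fg)
    moreover have "(\<integral>x. ((S h f - f) /\<^sub>R h) x \<partial>\<mu>) = ((\<integral>x. S h f x \<partial>\<mu>) - (\<integral>x. f x \<partial>\<mu>)) /\<^sub>R h"
      by (simp only: E.scaleR E.diff)
    ultimately show ?case by (simp add: fg divide_inverse mult.commute)
  qed
  ultimately show ?thesis
    unfolding fg(3) by (rule Lim_transform_eventually)
qed

end

section \<open>Piecewise constant curves of generators\<close>

lemma tendsto_0_ennreal_iff:
  fixes f :: "'b \<Rightarrow> ennreal"
  shows "(f \<longlongrightarrow> 0) F \<longleftrightarrow> (\<forall>e>0::real. \<forall>\<^sub>F x in F. f x < ennreal e)"
proof
  assume "(f \<longlongrightarrow> 0) F"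
  then show "\<forall>e>0::real. \<forall>\<^sub>F x in F. f x < ennreal e" by (auto intro: order_tendstoD)
next
  assume *: "\<forall>e>0::real. \<forall>\<^sub>F x in F. f x < ennreal e"
  show "(f \<longlongrightarrow> 0) F"
  proof (rule order_tendstoI)
    fix b :: ennreal assume "0 < b"
    then obtain x where "0 < x" "x < b" using dense by blast
    then obtain e where e: "e > 0" "ennreal e < b" by (cases x) (auto simp: ennreal_less_zero_iff)
    show "\<forall>\<^sub>F x in F. f x < b" using *[rule_format, OF e(1)] by eventually_elim (use e in simp)
  qed simp
qed

text \<open>Two versions because at a partition point the forward and the backward neighbourhood lie
  in different pieces: the first finds the piece to the right of t, the second the piece to its
  left.\<close>

lemma partition_locate:
  assumes p: "is_partition T K p"
  shows "0 \<le> t \<Longrightarrow> t < T \<Longrightarrow> \<exists>k<K. p k \<le> t \<and> t < p (Suc k)"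
    and "0 < t \<Longrightarrow> t \<le> T \<Longrightarrow> \<exists>k<K. p k < t \<and> t \<le> p (Suc k)"
proof -
  have *: "\<exists>k<n. p k \<le> t \<and> t < p (Suc k)" if "0 \<le> t" "t < p n" "n \<le> K" for n
    using that
  proof (induction n)
    case 0
    then show ?case using p by (simp add: is_partition_def)
  next
    case (Suc n)
    then show ?case by (cases "t < p n") (auto intro: less_SucI)
  qed
  show "0 \<le> t \<Longrightarrow> t < T \<Longrightarrow> \<exists>k<K. p k \<le> t \<and> t < p (Suc k)"
    using *[of K] p by (simp add: is_partition_def)
  have *: "\<exists>k<n. p k < t \<and> t \<le> p (Suc k)" if "0 < t" "t \<le> p n" "n \<le> K" for n
    using that
  proof (induction n)
    case 0
    then show ?case using p by (simp add: is_partition_def)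
  next
    case (Suc n)
    then show ?case by (cases "t \<le> p n") (auto intro: less_SucI)
  qed
  show "0 < t \<Longrightarrow> t \<le> T \<Longrightarrow> \<exists>k<K. p k < t \<and> t \<le> p (Suc k)"
    using *[of K] p by (simp add: is_partition_def)
qed

lemma partition_less:
  assumes "is_partition T K p" "i < j" "j \<le> K"
  shows "p i < p j"
  using assms(2,3)
proof (induction j)
  case (Suc j)
  have "p (Suc j - 1) < p (Suc j)" using assms(1) Suc.prems unfolding is_partition_def by (metis One_nat_def Suc_leI atLeastAtMost_iff zero_less_Suc)
  then have "p j < p (Suc j)" by simp
  with Suc show ?case by (cases "i = j") auto
qed simp

lemma partition_le: "is_partition T K p \<Longrightarrow> i \<le> j \<Longrightarrow> j \<le> K \<Longrightarrow> p i \<le> p j"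
  using partition_less[of T K p i j] by (cases "i = j") auto

lemma partition_range: "is_partition T K p \<Longrightarrow> k \<le> K \<Longrightarrow> p k \<in> {0..T}"
  using partition_le[of T K p 0 k] partition_le[of T K p k K] by (auto simp: is_partition_def)

lemma partition_mesh: "is_partition T K p \<Longrightarrow> k < K \<Longrightarrow> p (Suc k) - p k \<le> mesh K p"
proof -
  assume "k < K"
  then have "\<bar>p (Suc k) - p (Suc k - 1)\<bar> \<le> mesh K p"
    unfolding mesh_def by (intro Max_ge finite_imageI finite_atLeastAtMost imageI) simp
  then show ?thesis by simp
qed

section \<open>The explicit solution for piecewise constant curves\<close>

text \<open>Each piece is frozen at its right endpoint, as in
  \<open>pc_approximating_sequence\<close>. The pieces are closed at both ends; at a shared point
  the later piece only says that time zero changes nothing.\<close>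

definition pc_flow :: "nat \<Rightarrow> (nat \<Rightarrow> real) \<Rightarrow> (real \<Rightarrow> 'a::topological_space operator) \<Rightarrow> (real \<Rightarrow> 'a measure) \<Rightarrow> bool" where
  "pc_flow K p A \<rho> \<longleftrightarrow> (\<forall>k<K. \<forall>t\<in>{p k..p (Suc k)}. \<rho> t = dual_exp (\<rho> (p k)) (t - p k) (A (p (Suc k))))"

lemma pc_flowD:
  assumes "pc_flow K p A \<rho>" "k < K" "p k \<le> t" "t \<le> p (Suc k)"
  shows "\<rho> t = dual_exp (\<rho> (p k)) (t - p k) (A (p (Suc k)))"
  by (rule assms(1)[unfolded pc_flow_def, rule_format]) (simp_all add: assms(2-))

context relaxed_semimetric begin

lemma generators_cD:
  assumes "A \<in> generators_c c" "\<mu> \<in> probs_c c" "t \<ge> 0"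
  shows "dual_exp \<mu> t A \<in> probs_c c"
    and "((\<lambda>s. transport_cost c (dual_exp \<mu> t A) (dual_exp \<mu> s A)) \<longlongrightarrow> 0) (at t within {0..})"
  using assms by (auto simp: generators_c_def)

lemma cost_continuous_iff:
  fixes t :: real
  assumes "\<rho> t \<in> borel_probs"
  shows "((\<lambda>s. transport_cost c (\<rho> t) (\<rho> s)) \<longlongrightarrow> 0) (at t within X) \<longleftrightarrow>
    (\<forall>e>0. \<exists>d>0. \<forall>s\<in>X. \<bar>s - t\<bar> < d \<longrightarrow> transport_cost c (\<rho> t) (\<rho> s) < ennreal e)"
proof -
  have self: "transport_cost c (\<rho> t) (\<rho> t) < ennreal e" if "e > 0" for e
    using that by (simp add: transport_cost_self[OF assms])
  have "(s \<noteq> t \<and> dist s t < d \<longrightarrow> transport_cost c (\<rho> t) (\<rho> s) < ennreal e) \<longleftrightarrow>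
      (\<bar>s - t\<bar> < d \<longrightarrow> transport_cost c (\<rho> t) (\<rho> s) < ennreal e)" if "e > 0" for e s d
    using self[OF that] by (cases "s = t") (simp_all add: dist_real_def)
  then show ?thesis
    unfolding tendsto_0_ennreal_iff eventually_at by simp
qed

lemma pc_flow_exists:
  assumes p: "is_partition T K p" and A: "\<And>t. t \<in> {0..T} \<Longrightarrow> A t \<in> generators_c c" and \<rho>0: "\<rho>0 \<in> probs_c c"
  shows "\<exists>\<rho>. \<rho> 0 = \<rho>0 \<and> pc_flow K p A \<rho>"
proof -
  have "\<exists>\<rho>. \<rho> 0 = \<rho>0 \<and> (\<forall>t\<in>{0..p n}. \<rho> t \<in> probs_c c) \<and> pc_flow n p A \<rho>" if "n \<le> K" for n
    using that
  proof (induction n)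
    case 0
    show ?case using p \<rho>0 by (intro exI[of _ "\<lambda>_. \<rho>0"]) (simp add: pc_flow_def is_partition_def)
  next
    case (Suc n)
    then obtain \<rho> where \<rho>: "\<rho> 0 = \<rho>0" "\<forall>t\<in>{0..p n}. \<rho> t \<in> probs_c c" "pc_flow n p A \<rho>" by auto
    define \<rho>' where "\<rho>' t = (if t \<le> p n then \<rho> t else dual_exp (\<rho> (p n)) (t - p n) (A (p (Suc n))))" for t
    have pn: "0 \<le> p n" using partition_range[OF p, of n] Suc.prems by simp
    have \<rho>n: "\<rho> (p n) \<in> probs_c c" using \<rho>(2) pn by simp
    have An: "A (p (Suc n)) \<in> generators_c c" using A partition_range[OF p Suc.prems] .
    have 1: "\<rho>' t \<in> probs_c c" if "t \<in> {0..p (Suc n)}" for t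
      using that \<rho>(2) generators_cD(1)[OF An \<rho>n] by (simp add: \<rho>'_def)
    have 2: "\<rho>' t = dual_exp (\<rho>' (p k)) (t - p k) (A (p (Suc k)))" if k: "k < Suc n" and t: "t \<in> {p k..p (Suc k)}" for k t
    proof (cases "k = n")
      case True
      then show ?thesis using t dual_exp_0[OF An probs_cD[OF \<rho>n]] by (auto simp: \<rho>'_def)
    next
      case False
      then have "k < n" using k by simp
      moreover have "p (Suc k) \<le> p n" "p k \<le> p n" using partition_le[OF p] \<open>k < n\<close> Suc.prems by auto
      ultimately show ?thesis
        using pc_flowD[OF \<rho>(3) \<open>k < n\<close>, of t] t unfolding \<rho>'_def by auto
    qed
    have 3: "\<rho>' 0 = \<rho>0" using \<rho>(1) pn by (simp add: \<rho>'_def)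
    show ?case
      unfolding pc_flow_def by (rule exI[of _ \<rho>']) (intro conjI ballI allI impI 1 2 3)
  qed
  from this[of K] show ?thesis by blast
qed

context
  fixes T K p A \<rho>0 and \<rho> :: "real \<Rightarrow> 'a measure"
  assumes p: "is_partition T K p" and A: "\<And>t. t \<in> {0..T} \<Longrightarrow> A t \<in> generators_c c" and \<rho>0: "\<rho>0 \<in> probs_c c"
    and start: "\<rho> 0 = \<rho>0" and flow: "pc_flow K p A \<rho>"
begin

lemma A_right: "k < K \<Longrightarrow> A (p (Suc k)) \<in> generators_c c"
  using A partition_range[OF p, of "Suc k"] by simp

lemma pc_flow_probs_c:
  assumes "t \<in> {0..T}"
  shows "\<rho> t \<in> probs_c c"
proof -
  have "\<forall>t\<in>{0..p n}. \<rho> t \<in> probs_c c" if "n \<le> K" for n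
    using that
  proof (induction n)
    case 0
    then show ?case using start \<rho>0 p by (simp add: is_partition_def)
  next
    case (Suc n)
    have pn: "\<rho> (p n) \<in> probs_c c" using Suc partition_range[OF p, of n] by simp
    show ?case
    proof
      fix t assume t: "t \<in> {0..p (Suc n)}"
      show "\<rho> t \<in> probs_c c"
      proof (cases "t \<le> p n")
        case True
        then show ?thesis using Suc t by simp
      next
        case False
        then have "\<rho> t = dual_exp (\<rho> (p n)) (t - p n) (A (p (Suc n)))"
          using Suc.prems t by (intro pc_flowD[OF flow]) auto
        then show ?thesis using generators_cD(1)[OF A_right pn, of n] Suc.prems False by simp
      qed
    qed
  qed
  from this[of K] show ?thesis using p assms by (simp add: is_partition_def)
qed

lemma pc_flow_step:
  assumes k: "k < K" and t: "p k \<le> t" and h: "h \<ge> 0" "t + h \<le> p (Suc k)"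
  shows "\<rho> (t + h) = dual_exp (\<rho> t) h (A (p (Suc k)))"
proof -
  have pk: "\<rho> (p k) \<in> probs_c c" using pc_flow_probs_c partition_range[OF p, of k] k by simp
  have "\<rho> (t + h) = dual_exp (\<rho> (p k)) ((t - p k) + h) (A (p (Suc k)))"
    using pc_flowD[OF flow k, of "t + h"] t h by (simp only: add_diff_eq add_diff_add diff_add_eq[symmetric])
  also have "\<dots> = dual_exp (dual_exp (\<rho> (p k)) (t - p k) (A (p (Suc k)))) h (A (p (Suc k)))"
    using t h by (intro dual_exp_add A_right k probs_cD pk) auto
  also have "dual_exp (\<rho> (p k)) (t - p k) (A (p (Suc k))) = \<rho> t"
    using t h by (intro pc_flowD[OF flow k, symmetric]) auto
  finally show ?thesis .
qed

lemma pc_flow_continuous_piece: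
  assumes k: "k < K" and t: "t \<in> {p k..p (Suc k)}" and e: "e > 0"
  shows "\<exists>d>0. \<forall>s\<in>{p k..p (Suc k)}. \<bar>s - t\<bar> < d \<longrightarrow> transport_cost c (\<rho> t) (\<rho> s) < ennreal e"
proof -
  have pk: "\<rho> (p k) \<in> probs_c c" using pc_flow_probs_c partition_range[OF p, of k] k by simp
  let ?d = "\<lambda>s. dual_exp (\<rho> (p k)) s (A (p (Suc k)))"
  have "?d (t - p k) \<in> borel_probs" using probs_cD generators_cD(1)[OF A_right[OF k] pk] t by simp
  from cost_continuous_iff[where \<rho>="?d" and t="t - p k", OF this, THEN iffD1, OF generators_cD(2)[OF A_right[OF k] pk]] t e
  obtain d where d: "d > 0" "\<And>s. s \<ge> 0 \<Longrightarrow> \<bar>s - (t - p k)\<bar> < d \<Longrightarrow> transport_cost c (?d (t - p k)) (?d s) < ennreal e"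
    by auto
  have "transport_cost c (\<rho> t) (\<rho> s) < ennreal e" if "s \<in> {p k..p (Suc k)}" "\<bar>s - t\<bar> < d" for s
    using d(2)[of "s - p k"] that t pc_flowD[OF flow k, of t] pc_flowD[OF flow k, of s] by auto
  with d(1) show ?thesis by blast
qed

text \<open>The pieces on the two sides of t are treated separately. The cost is always measured
  from \<open>\<rho> t\<close>, so combining them takes the smaller radius and no triangle
  inequality.\<close>

lemma pc_flow_continuous:
  assumes t: "t \<in> {0..T}" and e: "e > 0"
  shows "\<exists>d>0. \<forall>s\<in>{0..T}. \<bar>s - t\<bar> < d \<longrightarrow> transport_cost c (\<rho> t) (\<rho> s) < ennreal e"
proof -
  have "\<exists>d>0. \<forall>s\<in>{0..t}. \<bar>s - t\<bar> < d \<longrightarrow> transport_cost c (\<rho> t) (\<rho> s) < ennreal e"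
  proof (cases "t = 0")
    case True
    then show ?thesis
      using e transport_cost_self[OF probs_cD[OF pc_flow_probs_c[OF t]]] by (intro exI[of _ 1]) simp
  next
    case False
    then obtain k where k: "k < K" "p k < t" "t \<le> p (Suc k)" using partition_locate(2)[OF p, of t] t by auto
    then obtain d where "d > 0" "\<forall>s\<in>{p k..p (Suc k)}. \<bar>s - t\<bar> < d \<longrightarrow> transport_cost c (\<rho> t) (\<rho> s) < ennreal e"
      using pc_flow_continuous_piece[OF k(1) _ e, of t] by auto
    with k show ?thesis by (intro exI[of _ "min d (t - p k)"]) auto
  qed
  then obtain d1 where d1: "d1 > 0" "\<forall>s\<in>{0..t}. \<bar>s - t\<bar> < d1 \<longrightarrow> transport_cost c (\<rho> t) (\<rho> s) < ennreal e" by blast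
  have "\<exists>d>0. \<forall>s\<in>{t..T}. \<bar>s - t\<bar> < d \<longrightarrow> transport_cost c (\<rho> t) (\<rho> s) < ennreal e"
  proof (cases "t = T")
    case True
    then show ?thesis
      using e transport_cost_self[OF probs_cD[OF pc_flow_probs_c[OF t]]] by (intro exI[of _ 1]) simp
  next
    case False
    then obtain k where k: "k < K" "p k \<le> t" "t < p (Suc k)" using partition_locate(1)[OF p, of t] t by auto
    then obtain d where "d > 0" "\<forall>s\<in>{p k..p (Suc k)}. \<bar>s - t\<bar> < d \<longrightarrow> transport_cost c (\<rho> t) (\<rho> s) < ennreal e"
      using pc_flow_continuous_piece[OF k(1) _ e, of t] by auto
    with k show ?thesis by (intro exI[of _ "min d (p (Suc k) - t)"]) auto
  qed
  then obtain d2 where d2: "d2 > 0" "\<forall>s\<in>{t..T}. \<bar>s - t\<bar> < d2 \<longrightarrow> transport_cost c (\<rho> t) (\<rho> s) < ennreal e" by blast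
  have "transport_cost c (\<rho> t) (\<rho> s) < ennreal e" if "s \<in> {0..T}" "\<bar>s - t\<bar> < min d1 d2" for s
    using d1(2)[rule_format, of s] d2(2)[rule_format, of s] that by (cases "s \<le> t") auto
  with d1(1) d2(1) show ?thesis by (intro exI[of _ "min d1 d2"]) auto
qed

lemma pc_flow_strong_dual_solution:
  assumes AA: "\<And>k t. k \<in> {1..K} \<Longrightarrow> t \<in> {p (k - 1)..<p k} \<Longrightarrow> AA t = A (p k)" and T: "T > 0"
  shows "strong_dual_solution c T \<rho>0 AA (restrict \<rho> {0..T})"
  unfolding strong_dual_solution_def
proof (intro conjI ballI)
  have "((\<lambda>s. transport_cost c (restrict \<rho> {0..T} t) (restrict \<rho> {0..T} s)) \<longlongrightarrow> 0) (at t within {0..T})"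
    if t: "t \<in> {0..T}" for t
    using pc_flow_continuous[OF t] pc_flow_probs_c[OF t] t by (subst cost_continuous_iff) (simp_all add: probs_cD)
  then show "restrict \<rho> {0..T} \<in> curves_c c T"
    using pc_flow_probs_c by (simp add: curves_c_def)
  show "restrict \<rho> {0..T} 0 = \<rho>0" using start T by simp
next
  fix t z assume t: "t \<in> {0<..<T}" and z: "z \<in> AA t"
  obtain \<phi> \<psi> where z': "z = (\<phi>, \<psi>)" by (cases z)
  obtain k where k: "k < K" "p k \<le> t" "t < p (Suc k)" using partition_locate(1)[OF p, of t] t by auto
  have At: "AA t = A (p (Suc k))" using AA[of "Suc k" t] k by simp
  have "((\<lambda>h. ((\<integral>x. \<phi> x \<partial>(dual_exp (\<rho> t) h (A (p (Suc k))))) - (\<integral>x. \<phi> x \<partial>(\<rho> t))) / h) \<longlongrightarrow> (\<integral>x. \<psi> x \<partial>(\<rho> t))) (at_right 0)"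
    using z t by (intro dual_exp_right_derivative A_right k probs_cD pc_flow_probs_c) (auto simp: z' At)
  moreover have "\<forall>\<^sub>F h in at_right 0. ((\<integral>x. \<phi> x \<partial>(dual_exp (\<rho> t) h (A (p (Suc k))))) - (\<integral>x. \<phi> x \<partial>(\<rho> t))) / h =
      ((\<integral>x. \<phi> x \<partial>(restrict \<rho> {0..T} (t + h))) - (\<integral>x. \<phi> x \<partial>(restrict \<rho> {0..T} t))) / h"
  proof -
    have "\<forall>\<^sub>F h in at_right 0. h \<in> {0<..<p (Suc k) - t}" using k by (intro eventually_at_right_real) auto
    then show ?thesis
    proof eventually_elim
      case (elim h)
      then have h: "h > 0" "t + h \<le> p (Suc k)" by auto
      then have "t + h \<le> T" using partition_range[OF p, of "Suc k"] k by simp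
      then show ?case using pc_flow_step[OF k(1,2), of h] h t by simp
    qed
  qed
  ultimately have "((\<lambda>h. ((\<integral>x. \<phi> x \<partial>(restrict \<rho> {0..T} (t + h))) - (\<integral>x. \<phi> x \<partial>(restrict \<rho> {0..T} t))) / h) \<longlongrightarrow> (\<integral>x. \<psi> x \<partial>(\<rho> t))) (at_right 0)"
    by (rule Lim_transform_eventually)
  then show "case z of (\<phi>, \<psi>) \<Rightarrow> ((\<lambda>h. ((\<integral>x. \<phi> x \<partial>(restrict \<rho> {0..T} (t + h))) - (\<integral>x. \<phi> x \<partial>(restrict \<rho> {0..T} t))) / h)
      \<longlongrightarrow> (\<integral>x. \<psi> x \<partial>(restrict \<rho> {0..T} t))) (at_right 0)"
    using t by (simp add: z')
qed

text \<open>Continuity in transport cost makes \<open>C0\<close> integrals of \<sigma> continuous by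
  \<open>integral_C0_close\<close>, as \<open>strong_dual_flow_unique\<close> demands. On a piece
  the generator is constant, so that lemma determines \<sigma> there from its value at the left
  endpoint, and induction passes it on.\<close>

lemma strong_dual_solution_eq_pc_flow:
  assumes AA: "\<And>k t. k \<in> {1..K} \<Longrightarrow> t \<in> {p (k - 1)..<p k} \<Longrightarrow> AA t = A (p k)"
    and \<sigma>: "strong_dual_solution c T \<rho>0 AA \<sigma>"
  shows "\<sigma> = restrict \<rho> {0..T}"
proof -
  have \<sigma>c: "\<sigma> \<in> curves_c c T" and \<sigma>0: "\<sigma> 0 = \<rho>0" using \<sigma> by (auto simp: strong_dual_solution_def)
  have \<sigma>p: "\<sigma> t \<in> probs_c c" if "t \<in> {0..T}" for t using \<sigma>c that by (auto simp: curves_c_def)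
  have weak: "continuous_on {0..T} (\<lambda>s. \<integral>x. \<phi> x \<partial>(\<sigma> s))" if \<phi>: "\<phi> \<in> C0" for \<phi>
    unfolding continuous_on_def
  proof
    fix t assume t: "t \<in> {0..T}"
    show "((\<lambda>s. \<integral>x. \<phi> x \<partial>(\<sigma> s)) \<longlongrightarrow> (\<integral>x. \<phi> x \<partial>(\<sigma> t))) (at t within {0..T})"
    proof (rule tendstoI)
      fix e :: real assume "e > 0"
      then obtain d where d: "d > 0" "\<And>\<mu> \<nu>. transport_cost c \<mu> \<nu> < ennreal d \<Longrightarrow> \<bar>(\<integral>x. \<phi> x \<partial>\<mu>) - (\<integral>x. \<phi> x \<partial>\<nu>)\<bar> < e"
        using integral_C0_close[OF \<phi>] by blast
      have "((\<lambda>s. transport_cost c (\<sigma> t) (\<sigma> s)) \<longlongrightarrow> 0) (at t within {0..T})"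
        using \<sigma>c t by (simp add: curves_c_def)
      then have "\<forall>\<^sub>F s in at t within {0..T}. transport_cost c (\<sigma> t) (\<sigma> s) < ennreal d"
        using d(1) by (simp add: tendsto_0_ennreal_iff)
      then show "\<forall>\<^sub>F s in at t within {0..T}. dist (\<integral>x. \<phi> x \<partial>(\<sigma> s)) (\<integral>x. \<phi> x \<partial>(\<sigma> t)) < e"
      proof eventually_elim
        case (elim s)
        from d(2)[OF elim] show ?case by (simp add: dist_real_def abs_minus_commute)
      qed
    qed
  qed
  have "\<forall>t\<in>{0..p n}. \<sigma> t = \<rho> t" if "n \<le> K" for n
    using that
  proof (induction n)
    case 0
    then show ?case using start \<sigma>0 p by (simp add: is_partition_def)
  next
    case (Suc n)
    show ?case
    proof
      fix t assume t: "t \<in> {0..p (Suc n)}"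
      show "\<sigma> t = \<rho> t"
      proof (cases "t \<le> p n")
        case True
        then show ?thesis using Suc t by simp
      next
        case False
        have n: "n < K" using Suc.prems by simp
        have pn: "0 \<le> p n" "p n \<le> T" "p (Suc n) \<le> T"
          using partition_range[OF p, of n] partition_range[OF p, of "Suc n"] n by auto
        have eq: "\<sigma> (p n) = \<rho> (p n)" using Suc pn by simp
        interpret G: relaxed_semimetric_semigroup c B "semigroup_of (A (p (Suc n)))"
          by (rule generators_c_locale[OF A_right[OF n]])
        have "dual_exp (\<sigma> (p n)) (t - p n) (A (p (Suc n))) = \<sigma> t"
        proof (rule dual_exp_eqI[OF A_right[OF n]])
          fix \<phi> :: "'a \<Rightarrow> real" assume \<phi>: "\<phi> \<in> C0"
          show "(\<integral>x. \<phi> x \<partial>(\<sigma> t)) = (\<integral>x. exp_op (t - p n) (A (p (Suc n))) \<phi> x \<partial>(\<sigma> (p n)))"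
            unfolding exp_op_def
          proof (rule G.strong_dual_flow_unique[OF _ _ _ _ \<phi>])
            show "\<sigma> s \<in> borel_probs" if "s \<in> {p n..t}" for s
              using that t pn by (intro probs_cD \<sigma>p) auto
            show "continuous_on {p n..t} (\<lambda>s. \<integral>x. \<phi>' x \<partial>(\<sigma> s))" if "\<phi>' \<in> C0" for \<phi>'
              by (rule continuous_on_subset[OF weak[OF that]]) (use t pn in auto)
            fix s \<phi>' \<psi>'
            assume s: "s \<in> {p n<..<t}" and "(\<phi>', \<psi>') \<in> generator (semigroup_of (A (p (Suc n))))"
            then have "(\<phi>', \<psi>') \<in> AA s"
              using AA[of "Suc n" s] n t by (simp add: generators_c_semigroup(2)[OF A_right[OF n]])
            then show "((\<lambda>h. ((\<integral>x. \<phi>' x \<partial>(\<sigma> (s + h))) - (\<integral>x. \<phi>' x \<partial>(\<sigma> s))) / h) \<longlongrightarrow> (\<integral>x. \<psi>' x \<partial>(\<sigma> s))) (at_right 0)"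
              using \<sigma> s t pn by (auto simp: strong_dual_solution_def)
          qed (use False in simp)
        qed (use False t pn in \<open>auto intro!: probs_cD \<sigma>p\<close>)
        moreover have "\<rho> t = dual_exp (\<rho> (p n)) (t - p n) (A (p (Suc n)))"
          using t False by (intro pc_flowD[OF flow n]) auto
        ultimately show ?thesis using eq by simp
      qed
    qed
  qed
  from this[of K] have "\<sigma> t = \<rho> t" if "t \<in> {0..T}" for t
    using that p by (simp add: is_partition_def)
  then show ?thesis
    using \<sigma>c by (intro extensionalityI[of _ "{0..T}"]) (auto simp: curves_c_def PiE_def)
qed

end

section \<open>Comparison of approximations\<close>

text \<open>Forgets the partition and keeps what the comparison uses: at every time before T the
  curve moves forward under A frozen at some time within m. Curves with unrelated partitions can
  then be compared without a common refinement.\<close>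

definition locally_generated :: "real \<Rightarrow> (real \<Rightarrow> 'a operator) \<Rightarrow> real \<Rightarrow> (real \<Rightarrow> 'a measure) \<Rightarrow> bool" where
  "locally_generated T A m \<rho> \<longleftrightarrow> (\<forall>t\<in>{0..<T}. \<exists>u\<in>{0..T}. \<bar>u - t\<bar> \<le> m \<and>
     (\<forall>\<^sub>F h in at_right 0. t + h \<le> T \<and> \<rho> (t + h) = dual_exp (\<rho> t) h (A u)))"

lemma S0_locally_generated:
  assumes p: "is_partition T K p" and A: "\<And>t. t \<in> {0..T} \<Longrightarrow> A t \<in> generators_c c" and \<rho>0: "\<rho>0 \<in> probs_c c"
    and AA: "\<And>k t. k \<in> {1..K} \<Longrightarrow> t \<in> {p (k - 1)..<p k} \<Longrightarrow> AA t = A (p k)" and T: "T > 0"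
  shows "S0 c T \<rho>0 AA \<in> curves_c c T" "S0 c T \<rho>0 AA 0 = \<rho>0" "locally_generated T A (mesh K p) (S0 c T \<rho>0 AA)"
proof -
  obtain \<rho> where \<rho>: "\<rho> 0 = \<rho>0" "pc_flow K p A \<rho>" using pc_flow_exists[where A=A, OF p A \<rho>0] by blast
  note ctx = p A \<rho>0 \<rho>
  have sol: "strong_dual_solution c T \<rho>0 AA (restrict \<rho> {0..T})"
    by (rule pc_flow_strong_dual_solution[where A=A, OF ctx AA T])
  have S0: "S0 c T \<rho>0 AA = restrict \<rho> {0..T}"
    unfolding S0_def
  proof (rule the_equality)
    show "strong_dual_solution c T \<rho>0 AA (restrict \<rho> {0..T})" by (rule sol)
  qed (rule strong_dual_solution_eq_pc_flow[where A=A, OF ctx AA])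
  show "S0 c T \<rho>0 AA \<in> curves_c c T" "S0 c T \<rho>0 AA 0 = \<rho>0"
    using sol unfolding S0 by (auto simp: strong_dual_solution_def)
  show "locally_generated T A (mesh K p) (S0 c T \<rho>0 AA)"
    unfolding locally_generated_def
  proof
    fix t assume t: "t \<in> {0..<T}"
    then obtain k where k: "k < K" "p k \<le> t" "t < p (Suc k)" using partition_locate(1)[OF p, of t] by auto
    have u: "p (Suc k) \<in> {0..T}" using partition_range[OF p, of "Suc k"] k by simp
    have "\<bar>p (Suc k) - t\<bar> \<le> mesh K p" using partition_mesh[OF p k(1)] k by simp
    moreover have "\<forall>\<^sub>F h in at_right 0. h \<in> {0<..<p (Suc k) - t}" using k by (intro eventually_at_right_real) auto
    then have "\<forall>\<^sub>F h in at_right 0. t + h \<le> T \<and> S0 c T \<rho>0 AA (t + h) = dual_exp (S0 c T \<rho>0 AA t) h (A (p (Suc k)))"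
    proof eventually_elim
      case (elim h)
      then have h: "h \<ge> 0" "t + h \<le> p (Suc k)" by auto
      then show ?case using pc_flow_step[where A=A, OF ctx k(1,2) h] t u by (simp add: S0)
    qed
    ultimately show "\<exists>u\<in>{0..T}. \<bar>u - t\<bar> \<le> mesh K p \<and> (\<forall>\<^sub>F h in at_right 0. t + h \<le> T \<and>
        S0 c T \<rho>0 AA (t + h) = dual_exp (S0 c T \<rho>0 AA t) h (A u))"
      using u by blast
  qed
qed

text \<open>A limsup bound becomes an eventual bound only with slack e. Finiteness of the costs
  makes the extended subtraction a real one, so the quotient can be cleared by multiplying with
  h.\<close>

lemma omega_c_boundD:
  assumes \<mu>: "\<mu> \<in> probs_c c" and \<nu>: "\<nu> \<in> probs_c c"
    and G: "G1 \<in> generators_c c" "G2 \<in> generators_c c"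
    and le: "omega_c c \<mu> \<nu> G1 G2 \<le> ereal \<epsilon> + ereal \<beta> * enn2ereal (transport_cost c \<mu> \<nu>)"
    and e: "e > 0"
  shows "\<forall>\<^sub>F h in at_right 0. enn2real (transport_cost c (dual_exp \<mu> h G1) (dual_exp \<nu> h G2)) \<le>
    enn2real (transport_cost c \<mu> \<nu>) + h * (\<epsilon> + \<beta> * enn2real (transport_cost c \<mu> \<nu>) + e)"
proof -
  define x where "x = enn2real (transport_cost c \<mu> \<nu>)"
  have x: "enn2ereal (transport_cost c \<mu> \<nu>) = ereal x"
    using transport_cost_finite[OF \<mu> \<nu>] unfolding x_def
    by (cases "transport_cost c \<mu> \<nu>") (auto simp: enn2ereal_ennreal)
  have "omega_c c \<mu> \<nu> G1 G2 < ereal (\<epsilon> + \<beta> * x + e)"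
    using le e unfolding x by (simp add: le_less_trans)
  then have "\<forall>\<^sub>F h in at_right 0. (enn2ereal (transport_cost c (dual_exp \<mu> h G1) (dual_exp \<nu> h G2))
      - enn2ereal (transport_cost c \<mu> \<nu>)) / ereal h < ereal (\<epsilon> + \<beta> * x + e)"
    unfolding omega_c_def by (rule Limsup_lessD)
  then show ?thesis
    using eventually_at_right_less
  proof eventually_elim
    case (elim h)
    define y where "y = enn2real (transport_cost c (dual_exp \<mu> h G1) (dual_exp \<nu> h G2))"
    have y: "enn2ereal (transport_cost c (dual_exp \<mu> h G1) (dual_exp \<nu> h G2)) = ereal y"
      using transport_cost_finite[OF generators_cD(1)[OF G(1) \<mu>, of h] generators_cD(1)[OF G(2) \<nu>, of h]] elim(2)
      unfolding y_def by (cases "transport_cost c (dual_exp \<mu> h G1) (dual_exp \<nu> h G2)") (auto simp: enn2ereal_ennreal)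
    have "(y - x) / h < \<epsilon> + \<beta> * x + e" using elim unfolding x y by simp
    then show ?case using elim(2) unfolding x_def[symmetric] y_def[symmetric] by (simp add: field_simps)
  qed
qed

lemma curves_cD:
  assumes "\<rho> \<in> curves_c c T" "t \<in> {0..T}"
  shows "\<rho> t \<in> probs_c c"
    and "((\<lambda>s. transport_cost c (\<rho> t) (\<rho> s)) \<longlongrightarrow> 0) (at t within {0..T})"
  using assms by (auto simp: curves_c_def)

text \<open>At each t the two frozen times differ by at most m1 + m2 < \<delta>, so the omega bound
  applies whatever the partitions are. Equal starting points make f 0 vanish, and only the
  accumulated \<epsilon> remains in the Gronwall estimate.\<close>

lemma locally_generated_compare:
  assumes T: "T > 0" and \<beta>: "\<beta> \<ge> 0" and \<epsilon>: "\<epsilon> \<ge> 0" and A: "\<And>t. t \<in> {0..T} \<Longrightarrow> A t \<in> generators_c c"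
    and \<omega>: "\<And>u v \<mu> \<nu>. u \<in> {0..T} \<Longrightarrow> v \<in> {0..T} \<Longrightarrow> \<bar>u - v\<bar> < \<delta> \<Longrightarrow> \<mu> \<in> probs_c c \<Longrightarrow> \<nu> \<in> probs_c c \<Longrightarrow>
      omega_c c \<mu> \<nu> (A u) (A v) \<le> ereal \<epsilon> + ereal \<beta> * enn2ereal (transport_cost c \<mu> \<nu>)"
    and \<rho>: "\<rho> \<in> curves_c c T" "locally_generated T A m1 \<rho>" and \<sigma>: "\<sigma> \<in> curves_c c T" "locally_generated T A m2 \<sigma>"
    and m: "m1 < \<delta> / 2" "m2 < \<delta> / 2" and start: "\<rho> 0 = \<sigma> 0" and t: "t \<in> {0..T}"
  shows "transport_cost c (\<rho> t) (\<sigma> t) \<le> ennreal (exp (\<beta> * T) * (\<epsilon> * T))"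
proof -
  define f where "f t = enn2real (transport_cost c (\<rho> t) (\<sigma> t))" for t
  have f: "transport_cost c (\<rho> t) (\<sigma> t) = ennreal (f t)" if "t \<in> {0..T}" for t
    using transport_cost_finite[OF curves_cD(1)[OF \<rho>(1) that] curves_cD(1)[OF \<sigma>(1) that]] by (simp add: f_def)
  have f0: "f 0 = 0"
    using transport_cost_self[OF probs_cD[OF curves_cD(1)[OF \<sigma>(1)]], of 0] T by (simp add: f_def start)
  have fn: "f t \<ge> 0" for t by (simp add: f_def)
  have "f t \<le> exp (\<beta> * (t - 0)) * (f 0 + \<epsilon> * (t - 0))"
  proof (rule gronwall_dini[where b=T])
    fix t e :: real assume t: "t \<in> {0<..T}" and e: "e > 0"
    then have t': "t \<in> {0..T}" by simp
    obtain d where d: "d > 0" "\<And>\<mu>' \<nu>'. transport_cost c (\<rho> t) \<mu>' < ennreal d \<Longrightarrow> transport_cost c (\<sigma> t) \<nu>' < ennreal d \<Longrightarrow>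
      transport_cost c (\<rho> t) (\<sigma> t) \<le> transport_cost c \<mu>' \<nu>' + ennreal e"
      using transport_cost_lsc[OF curves_cD(1)[OF \<rho>(1) t'] curves_cD(1)[OF \<sigma>(1) t'] e] by blast
    have "at_left t = at t within {0..t}" using t by (simp add: at_within_Icc_at_left)
    then have le: "at_left t \<le> at t within {0..T}" using t by (auto intro: at_le)
    have "\<forall>\<^sub>F s in at t within {0..T}. transport_cost c (\<rho> t) (\<rho> s) < ennreal d"
      "\<forall>\<^sub>F s in at t within {0..T}. transport_cost c (\<sigma> t) (\<sigma> s) < ennreal d"
      using curves_cD(2)[OF \<rho>(1) t'] curves_cD(2)[OF \<sigma>(1) t'] d(1) by (auto simp: tendsto_0_ennreal_iff)
    note ev = this[THEN filter_leD[OF le]]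
    have "\<forall>\<^sub>F s in at_left t. s \<in> {0<..<t}" using t by (intro eventually_at_left_real) auto
    with ev show "\<forall>\<^sub>F s in at_left t. f t \<le> f s + e"
    proof eventually_elim
      case (elim s)
      have "ennreal (f t) \<le> ennreal (f s) + ennreal e"
        using d(2)[OF elim(1,2)] f[OF t'] f[of s] elim(3) t by simp
      also have "\<dots> = ennreal (f s + e)" using fn e by (simp add: ennreal_plus)
      finally show ?case using fn[of s] e by (subst (asm) ennreal_le_iff) auto
    qed
  next
    fix t e :: real assume t: "t \<in> {0..<T}" and e: "e > 0"
    then have t': "t \<in> {0..T}" by simp
    obtain u where u: "u \<in> {0..T}" "\<bar>u - t\<bar> \<le> m1"
      "\<forall>\<^sub>F h in at_right 0. t + h \<le> T \<and> \<rho> (t + h) = dual_exp (\<rho> t) h (A u)"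
      using \<rho>(2) t unfolding locally_generated_def by blast
    obtain v where v: "v \<in> {0..T}" "\<bar>v - t\<bar> \<le> m2"
      "\<forall>\<^sub>F h in at_right 0. t + h \<le> T \<and> \<sigma> (t + h) = dual_exp (\<sigma> t) h (A v)"
      using \<sigma>(2) t unfolding locally_generated_def by blast
    have "\<bar>u - v\<bar> < \<delta>" using u(2) v(2) m by linarith
    then have "omega_c c (\<rho> t) (\<sigma> t) (A u) (A v) \<le> ereal \<epsilon> + ereal \<beta> * enn2ereal (transport_cost c (\<rho> t) (\<sigma> t))"
      by (intro \<omega> u v curves_cD(1)[OF \<rho>(1)] curves_cD(1)[OF \<sigma>(1)] t')
    note omega_c_boundD[OF curves_cD(1)[OF \<rho>(1) t'] curves_cD(1)[OF \<sigma>(1) t'] A[OF u(1)] A[OF v(1)] this e]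
    with u(3) v(3) show "\<forall>\<^sub>F h in at_right 0. f (t + h) \<le> f t + h * (\<epsilon> + \<beta> * f t + e)"
      by eventually_elim (simp add: f_def)
  qed (use \<beta> \<epsilon> t fn in auto)
  also have "\<dots> \<le> exp (\<beta> * T) * (\<epsilon> * T)"
    using t \<beta> \<epsilon> by (auto simp: f0 intro!: mult_mono mult_left_mono mult_nonneg_nonneg)
  finally show ?thesis using f[OF t] by (simp add: ennreal_leI)
qed

text \<open>Without any approximating sequence the property that characterises the limit curve would
  be vacuous, so uniqueness needs one; so does the construction of the limit.\<close>

lemma uniform_approximating_sequence:
  assumes T: "T > 0"
  shows "\<exists>AA. pc_approximating_sequence T A AA"
proof -
  define K where "K n = Suc n" for n :: nat
  define p where "p n k = real k * T / real (Suc n)" for n k :: nat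
  \<comment> \<open>The floor is the index of the left endpoint of the piece containing t; the right
    endpoint has index one more.\<close>
  define AA where "AA n t = A (p n (Suc (nat \<lfloor>t * real (Suc n) / T\<rfloor>)))" for n :: nat and t :: real
  have part: "is_partition T (K n) (p n)" for n
    using T by (auto simp: is_partition_def K_def p_def intro!: divide_strict_right_mono mult_strict_right_mono)
  have AA: "AA n t = A (p n k)" if k: "k \<in> {1..K n}" and t: "t \<in> {p n (k - 1)..<p n k}" for n k t
  proof -
    have "real (k - 1) \<le> t * real (Suc n) / T" "t * real (Suc n) / T < real k"
      using t T by (auto simp: p_def field_simps)
    then have "\<lfloor>t * real (Suc n) / T\<rfloor> = int (k - 1)"
      using k by (intro floor_unique) (auto simp: of_nat_diff)
    then have "nat \<lfloor>t * real (Suc n) / T\<rfloor> = k - 1" by (simp only: nat_int)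
    then show ?thesis using k by (simp add: AA_def)
  qed
  have mesh: "mesh (K n) (p n) = T / real (Suc n)" for n
  proof -
    have "\<bar>p n k - p n (k - 1)\<bar> = T / real (Suc n)" if "k \<in> {1..K n}" for k
    proof -
      have "p n k - p n (k - 1) = T / real (Suc n)"
        using that by (simp add: p_def of_nat_diff left_diff_distrib flip: diff_divide_distrib)
      then show ?thesis using T by simp
    qed
    then have "(\<lambda>k. \<bar>p n k - p n (k - 1)\<bar>) ` {1..K n} = (\<lambda>_. T / real (Suc n)) ` {1..K n}"
      by (intro image_cong refl)
    also have "\<dots> = {T / real (Suc n)}" by (auto simp: K_def)
    finally show ?thesis by (simp add: mesh_def)
  qed
  have "(\<lambda>n. T / real (Suc n)) \<longlonglongrightarrow> 0"
    using LIMSEQ_Suc[OF lim_const_over_n[of T]] by simp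
  then show ?thesis
    unfolding pc_approximating_sequence_def using part AA mesh
    by (intro exI[of _ AA] exI[of _ K] exI[of _ p]) auto
qed

lemma S0_approximations:
  assumes T: "T > 0" and A: "\<And>t. t \<in> {0..T} \<Longrightarrow> A t \<in> generators_c c" and \<rho>0: "\<rho>0 \<in> probs_c c"
    and pc: "pc_approximating_sequence T A AA"
  obtains m where "m \<longlonglongrightarrow> (0 :: real)" "\<And>n. S0 c T \<rho>0 (AA n) \<in> curves_c c T" "\<And>n. S0 c T \<rho>0 (AA n) 0 = \<rho>0"
    "\<And>n. locally_generated T A (m n) (S0 c T \<rho>0 (AA n))"
proof -
  obtain K p where Kp: "\<And>n. is_partition T (K n) (p n)"
      "\<And>n k t. k \<in> {1..K n} \<Longrightarrow> t \<in> {p n (k - 1)..<p n k} \<Longrightarrow> AA n t = A (p n k)"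
      "(\<lambda>n. mesh (K n) (p n)) \<longlonglongrightarrow> 0"
    using pc unfolding pc_approximating_sequence_def by blast
  note S = S0_locally_generated[where A=A, OF Kp(1) A \<rho>0 Kp(2) T]
  show thesis
    by (rule that[OF Kp(3) S])
qed

lemma curves_c_eqI:
  assumes "\<rho> \<in> curves_c c T" "\<sigma> \<in> curves_c c T" "\<And>t. t \<in> {0..T} \<Longrightarrow> \<rho> t = \<sigma> t"
  shows "\<rho> = \<sigma>"
  using assms by (intro extensionalityI[of _ "{0..T}"]) (auto simp: curves_c_def PiE_def)

lemma transport_cost_triangle_ennreal:
  assumes "\<mu> \<in> borel_probs" "\<sigma> \<in> borel_probs" "\<nu> \<in> borel_probs" "a \<ge> 0" "b \<ge> 0"
    and "transport_cost c \<mu> \<sigma> \<le> ennreal a" "transport_cost c \<sigma> \<nu> \<le> ennreal b"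
  shows "transport_cost c \<mu> \<nu> \<le> ennreal (B\<^sup>2 * (a + b))"
proof -
  have "transport_cost c \<mu> \<nu> \<le> ennreal (B\<^sup>2) * (transport_cost c \<mu> \<sigma> + transport_cost c \<sigma> \<nu>)"
    by (rule transport_cost_triangle) fact+
  also have "\<dots> \<le> ennreal (B\<^sup>2) * (ennreal a + ennreal b)"
    by (intro mult_left_mono add_mono assms) simp
  also have "\<dots> = ennreal (B\<^sup>2 * (a + b))"
    using assms(4,5) by (simp flip: ennreal_plus ennreal_mult)
  finally show ?thesis .
qed

end

section \<open>Existence and uniqueness of the limit curve\<close>

theorem theorem4p16:
  fixes c :: "'a::topological_space \<Rightarrow> 'a \<Rightarrow> real"
    and B T :: real
    and A :: "real \<Rightarrow> 'a operator"
    and \<rho>0 :: "'a measure"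
  assumes "semimetric c"
    and "semimetric_topology c"
    and "semimetric_complete c"
    and "separable_space (euclidean :: 'a topology)"
    and "locally_compact_space (euclidean :: 'a topology)"
    and "semimetric_continuous c"
    and "B \<ge> 1"
    and "\<forall>x y z. c x y \<le> B * (c x z + c z y)"
    and "T > 0"
    and "exp_continuous c T A"
    and "\<rho>0 \<in> probs_c c"
  shows "\<exists>!\<rho>. \<rho> \<in> curves_c c T \<and>
           (\<forall>AA. pc_approximating_sequence T A AA \<longrightarrow>
              (\<lambda>n. SUP t\<in>{0..T}. transport_cost c (\<rho> t) (S0 c T \<rho>0 (AA n) t)) \<longlonglongrightarrow> 0)"
proof -
  interpret relaxed_semimetric c B
    using assms(1,2,4-8) by unfold_locales blast+
  note T = \<open>T > 0\<close> and \<rho>0 = \<open>\<rho>0 \<in> probs_c c\<close>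
  have A: "\<And>t. t \<in> {0..T} \<Longrightarrow> A t \<in> generators_c c"
    using assms(10) by (simp add: exp_continuous_def)
  obtain \<beta> where \<beta>: "\<beta> \<ge> 0" and \<omega>: "\<And>\<epsilon>. \<epsilon> > 0 \<Longrightarrow> \<exists>\<delta>>0. \<forall>t\<in>{0..T}. \<forall>s\<in>{0..T}. \<bar>t - s\<bar> < \<delta> \<longrightarrow>
        (\<forall>\<mu>\<in>probs_c c. \<forall>\<nu>\<in>probs_c c.
           omega_c c \<mu> \<nu> (A t) (A s) \<le> ereal \<epsilon> + ereal \<beta> * enn2ereal (transport_cost c \<mu> \<nu>))"
    using assms(10) unfolding exp_continuous_def by blast
  have B2: "B\<^sup>2 > 0" using B_pos by simp

  \<comment> \<open>The threshold d depends on e alone and not on the partitions, so it serves for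
    two members of one sequence and for members of different sequences alike.\<close>
  have compare: "\<exists>d>0. \<forall>m1 m2 \<rho> \<sigma>. m1 < d \<longrightarrow> m2 < d \<longrightarrow> \<rho> \<in> curves_c c T \<longrightarrow> \<sigma> \<in> curves_c c T \<longrightarrow>
      \<rho> 0 = \<sigma> 0 \<longrightarrow> locally_generated T A m1 \<rho> \<longrightarrow> locally_generated T A m2 \<sigma> \<longrightarrow>
      (\<forall>t\<in>{0..T}. transport_cost c (\<rho> t) (\<sigma> t) \<le> ennreal e)" if e: "e > 0" for e
  proof -
    define \<epsilon> where "\<epsilon> = e / (exp (\<beta> * T) * T)"
    have \<epsilon>: "\<epsilon> > 0" "exp (\<beta> * T) * (\<epsilon> * T) = e" using e T by (simp_all add: \<epsilon>_def)
    obtain \<delta> where \<delta>: "\<delta> > 0" "\<And>u v \<mu> \<nu>. u \<in> {0..T} \<Longrightarrow> v \<in> {0..T} \<Longrightarrow> \<bar>u - v\<bar> < \<delta> \<Longrightarrow> \<mu> \<in> probs_c c \<Longrightarrow> \<nu> \<in> probs_c c \<Longrightarrow>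
      omega_c c \<mu> \<nu> (A u) (A v) \<le> ereal \<epsilon> + ereal \<beta> * enn2ereal (transport_cost c \<mu> \<nu>)"
      using \<omega>[OF \<epsilon>(1)] by blast
    show ?thesis
    proof (intro exI[of _ "\<delta> / 2"] conjI allI impI ballI)
      fix m1 m2 t and \<rho> \<sigma> :: "real \<Rightarrow> 'a measure"
      assume "m1 < \<delta> / 2" "m2 < \<delta> / 2" "\<rho> \<in> curves_c c T" "\<sigma> \<in> curves_c c T"
        "\<rho> 0 = \<sigma> 0" "locally_generated T A m1 \<rho>" "locally_generated T A m2 \<sigma>" "t \<in> {0..T}"
      then show "transport_cost c (\<rho> t) (\<sigma> t) \<le> ennreal e"
        using locally_generated_compare[where A=A, OF T \<beta> less_imp_le[OF \<epsilon>(1)] A \<delta>(2)] unfolding \<epsilon>(2) by blast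
    qed (use \<delta> in simp)
  qed

  \<comment> \<open>A reference sequence: it defines the limit, and in the uniqueness part a
    competitor is tested against it.\<close>
  obtain AA where AA: "pc_approximating_sequence T A AA" using uniform_approximating_sequence[OF T] by blast
  obtain m where m: "m \<longlonglongrightarrow> (0 :: real)" "\<And>n. S0 c T \<rho>0 (AA n) \<in> curves_c c T" "\<And>n. S0 c T \<rho>0 (AA n) 0 = \<rho>0"
    "\<And>n. locally_generated T A (m n) (S0 c T \<rho>0 (AA n))"
    using S0_approximations[where A=A, OF T A \<rho>0 AA] by blast
  define r where "r n = S0 c T \<rho>0 (AA n)" for n
  note r = m(2-4)[folded r_def]

  \<comment> \<open>Completeness is applied at each fixed t; continuity of the limit in t is shown
    afterwards.\<close>
  have "\<exists>\<nu>\<in>probs_c c. (\<lambda>n. transport_cost c (r n t) \<nu>) \<longlonglongrightarrow> 0" if t: "t \<in> {0..T}" for t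
  proof (rule transport_cost_complete[OF assms(3)])
    show "r n t \<in> probs_c c" for n by (rule curves_cD(1)[OF r(1) t])
    fix e :: real assume e: "e > 0"
    then obtain d where d: "d > 0" "\<And>m1 m2 \<rho> \<sigma>. m1 < d \<Longrightarrow> m2 < d \<Longrightarrow> \<rho> \<in> curves_c c T \<Longrightarrow> \<sigma> \<in> curves_c c T \<Longrightarrow>
      \<rho> 0 = \<sigma> 0 \<Longrightarrow> locally_generated T A m1 \<rho> \<Longrightarrow> locally_generated T A m2 \<sigma> \<Longrightarrow> transport_cost c (\<rho> t) (\<sigma> t) \<le> ennreal (e / 2)"
      using compare[of "e / 2"] t by (metis half_gt_zero)
    obtain N where N: "\<And>n. n \<ge> N \<Longrightarrow> m n < d"
      using order_tendstoD(2)[OF m(1) d(1)] by (auto simp: eventually_sequentially)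
    have "transport_cost c (r i t) (r j t) < ennreal e" if "i \<ge> N" "j \<ge> N" for i j
    proof -
      have "transport_cost c (r i t) (r j t) \<le> ennreal (e / 2)"
        by (rule d(2)[OF N[OF that(1)] N[OF that(2)] r(1) r(1) _ r(3) r(3)]) (simp add: r(2))
      also have "\<dots> < ennreal e" using e by (simp add: ennreal_less_iff)
      finally show ?thesis .
    qed
    then show "\<exists>N. \<forall>i\<ge>N. \<forall>j\<ge>N. transport_cost c (r i t) (r j t) < ennreal e" by blast
  qed
  then obtain R where R: "\<And>t. t \<in> {0..T} \<Longrightarrow> R t \<in> probs_c c"
      "\<And>t. t \<in> {0..T} \<Longrightarrow> (\<lambda>n. transport_cost c (r n t) (R t)) \<longlonglongrightarrow> 0"
    by metis
  define \<rho> where "\<rho> = restrict R {0..T}"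

  \<comment> \<open>The index n below may depend on t, since R t is only a pointwise limit, but the
    bound from \<open>compare\<close> does not. This upgrades pointwise convergence to a bound
    uniform in t, and for arbitrary approximations.\<close>
  have close: "\<exists>d>0. \<forall>m1 \<sigma>. m1 < d \<longrightarrow> \<sigma> \<in> curves_c c T \<longrightarrow> \<sigma> 0 = \<rho>0 \<longrightarrow> locally_generated T A m1 \<sigma> \<longrightarrow>
      (\<forall>t\<in>{0..T}. transport_cost c (\<rho> t) (\<sigma> t) \<le> ennreal e)" if e: "e > 0" for e
  proof -
    define e' where "e' = e / (2 * B\<^sup>2)"
    have e': "e' > 0" "B\<^sup>2 * (e' + e') = e" using e B2 by (auto simp: e'_def)
    obtain d where d: "d > 0" "\<And>m1 m2 \<rho> \<sigma> t. m1 < d \<Longrightarrow> m2 < d \<Longrightarrow> \<rho> \<in> curves_c c T \<Longrightarrow> \<sigma> \<in> curves_c c T \<Longrightarrow>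
      \<rho> 0 = \<sigma> 0 \<Longrightarrow> locally_generated T A m1 \<rho> \<Longrightarrow> locally_generated T A m2 \<sigma> \<Longrightarrow> t \<in> {0..T} \<Longrightarrow> transport_cost c (\<rho> t) (\<sigma> t) \<le> ennreal e'"
      using compare[OF e'(1)] by metis
    show ?thesis
    proof (intro exI[of _ d] conjI allI impI ballI d(1))
      fix m1 t and \<sigma> :: "real \<Rightarrow> 'a measure"
      assume \<sigma>: "m1 < d" "\<sigma> \<in> curves_c c T" "\<sigma> 0 = \<rho>0" "locally_generated T A m1 \<sigma>" and t: "t \<in> {0..T}"
      have "\<forall>\<^sub>F n in sequentially. transport_cost c (r n t) (R t) < ennreal e'"
        using R(2)[OF t] e'(1) by (simp add: tendsto_0_ennreal_iff)
      with order_tendstoD(2)[OF m(1) d(1)]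
      have "\<forall>\<^sub>F n in sequentially. m n < d \<and> transport_cost c (r n t) (R t) < ennreal e'"
        by (rule eventually_conj)
      then obtain n where n: "m n < d" "transport_cost c (r n t) (R t) < ennreal e'"
        using eventually_happens'[OF sequentially_bot] by blast
      have 2: "transport_cost c (r n t) (\<sigma> t) \<le> ennreal e'"
        by (rule d(2)[OF n(1) \<sigma>(1) r(1) \<sigma>(2) _ r(3) \<sigma>(4) t]) (simp add: r(2) \<sigma>(3))
      have 1: "transport_cost c (R t) (r n t) \<le> ennreal e'"
        using n(2) by (simp add: transport_cost_sym[of "R t"])
      have "transport_cost c (R t) (\<sigma> t) \<le> ennreal (B\<^sup>2 * (e' + e'))"
        by (rule transport_cost_triangle_ennreal[OF _ _ _ _ _ 1 2])
          (use e'(1) probs_cD[OF R(1)[OF t]] probs_cD[OF curves_cD(1)[OF r(1) t]]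
            probs_cD[OF curves_cD(1)[OF \<sigma>(2) t]] in simp_all)
      then show "transport_cost c (\<rho> t) (\<sigma> t) \<le> ennreal e" unfolding e'(2) using t by (simp add: \<rho>_def)
    qed
  qed

  have \<rho>p: "\<rho> t \<in> probs_c c" if "t \<in> {0..T}" for t using R(1)[OF that] that by (simp add: \<rho>_def)
  have \<rho>: "\<rho> \<in> curves_c c T"
    unfolding curves_c_def
  proof (intro CollectI conjI ballI)
    show "\<rho> \<in> {0..T} \<rightarrow>\<^sub>E probs_c c" using R(1) by (simp add: \<rho>_def)
    fix t assume t: "t \<in> {0..T}"
    show "((\<lambda>s. transport_cost c (\<rho> t) (\<rho> s)) \<longlongrightarrow> 0) (at t within {0..T})"
      unfolding tendsto_0_ennreal_iff
    proof (intro allI impI)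
      fix e :: real assume e: "e > 0"
      \<comment> \<open>Going from t to s through \<open>r n\<close> uses the triangle inequality
        twice; with B^2 at least 1 the total is at most 3 B^4 e', that is 3 e/4.\<close>
      define e' where "e' = e / (4 * B\<^sup>2 * B\<^sup>2)"
      have B4: "1 \<le> B\<^sup>2" using B_ge_1 by simp
      have e': "e' > 0" using e B2 by (simp add: e'_def)
      obtain d where d: "d > 0" "\<And>m1 \<sigma> t. m1 < d \<Longrightarrow> \<sigma> \<in> curves_c c T \<Longrightarrow> \<sigma> 0 = \<rho>0 \<Longrightarrow> locally_generated T A m1 \<sigma> \<Longrightarrow>
        t \<in> {0..T} \<Longrightarrow> transport_cost c (\<rho> t) (\<sigma> t) \<le> ennreal e'"
        using close[OF e'] by metis
      obtain n where n: "m n < d"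
        using order_tendstoD(2)[OF m(1) d(1)] eventually_happens'[OF sequentially_bot] by blast
      note cl = d(2)[OF n r(1) r(2) r(3)]
      have "\<forall>\<^sub>F s in at t within {0..T}. transport_cost c (r n t) (r n s) < ennreal e'"
        using curves_cD(2)[OF r(1) t] e' by (simp add: tendsto_0_ennreal_iff)
      moreover have "\<forall>\<^sub>F s in at t within {0..T}. s \<in> {0..T}"
        by (simp add: eventually_at_filter)
      ultimately show "\<forall>\<^sub>F s in at t within {0..T}. transport_cost c (\<rho> t) (\<rho> s) < ennreal e"
      proof eventually_elim
        case (elim s)
        have b: "\<rho> t \<in> borel_probs" "\<rho> s \<in> borel_probs" "r n t \<in> borel_probs" "r n s \<in> borel_probs"
          using \<rho>p t elim(2) curves_cD(1)[OF r(1)] by (auto intro: probs_cD)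
        have 1: "transport_cost c (r n s) (\<rho> s) \<le> ennreal e'" using cl[OF elim(2)] by (simp add: transport_cost_sym[of _ "\<rho> s"])
        have 2: "transport_cost c (r n t) (\<rho> s) \<le> ennreal (B\<^sup>2 * (e' + e'))"
          by (rule transport_cost_triangle_ennreal[OF b(3,4,2) _ _ _ 1]) (use e' elim(1) in auto)
        have "transport_cost c (\<rho> t) (\<rho> s) \<le> ennreal (B\<^sup>2 * (e' + B\<^sup>2 * (e' + e')))"
          by (rule transport_cost_triangle_ennreal[OF b(1,3,2) _ _ cl[OF t] 2]) (use e' B2 in auto)
        also have "\<dots> < ennreal e"
        proof -
          have "B\<^sup>2 * (e' + B\<^sup>2 * (e' + e')) \<le> B\<^sup>2 * (B\<^sup>2 * e' + B\<^sup>2 * (e' + e'))"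
            using mult_right_mono[OF B4, of e'] e' B2 by (intro mult_left_mono add_right_mono) auto
          also have "\<dots> = 3 / 4 * e" using B2 by (simp add: e'_def field_simps)
          also have "\<dots> < e" using e by simp
          finally show ?thesis by (rule ennreal_lessI[OF e])
        qed
        finally show ?case .
      qed
    qed
  qed

  have conv: "(\<lambda>n. SUP t\<in>{0..T}. transport_cost c (\<rho> t) (S0 c T \<rho>0 (AA' n) t)) \<longlonglongrightarrow> 0"
    if AA': "pc_approximating_sequence T A AA'" for AA'
    unfolding tendsto_0_ennreal_iff
  proof (intro allI impI)
    fix e :: real assume e: "e > 0"
    obtain d where d: "d > 0" "\<And>m1 \<sigma> t. m1 < d \<Longrightarrow> \<sigma> \<in> curves_c c T \<Longrightarrow> \<sigma> 0 = \<rho>0 \<Longrightarrow> locally_generated T A m1 \<sigma> \<Longrightarrow>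
      t \<in> {0..T} \<Longrightarrow> transport_cost c (\<rho> t) (\<sigma> t) \<le> ennreal (e / 2)"
      using close[of "e / 2"] e by (metis half_gt_zero)
    obtain m' where m': "m' \<longlonglongrightarrow> (0 :: real)" "\<And>n. S0 c T \<rho>0 (AA' n) \<in> curves_c c T" "\<And>n. S0 c T \<rho>0 (AA' n) 0 = \<rho>0"
      "\<And>n. locally_generated T A (m' n) (S0 c T \<rho>0 (AA' n))"
      using S0_approximations[where A=A, OF T A \<rho>0 AA'] by blast
    show "\<forall>\<^sub>F n in sequentially. (SUP t\<in>{0..T}. transport_cost c (\<rho> t) (S0 c T \<rho>0 (AA' n) t)) < ennreal e"
      using order_tendstoD(2)[OF m'(1) d(1)]
    proof eventually_elim
      case (elim n)
      have "(SUP t\<in>{0..T}. transport_cost c (\<rho> t) (S0 c T \<rho>0 (AA' n) t)) \<le> ennreal (e / 2)"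
        by (rule SUP_least) (rule d(2)[OF elim m'(2-4)])
      also have "\<dots> < ennreal e" using e by (simp add: ennreal_less_iff)
      finally show ?case .
    qed
  qed

  show ?thesis
  proof (rule ex1I[of _ \<rho>])
    show "\<rho> \<in> curves_c c T \<and> (\<forall>AA. pc_approximating_sequence T A AA \<longrightarrow>
        (\<lambda>n. SUP t\<in>{0..T}. transport_cost c (\<rho> t) (S0 c T \<rho>0 (AA n) t)) \<longlonglongrightarrow> 0)"
      using \<rho> conv by blast
  next
    fix \<sigma> assume \<sigma>: "\<sigma> \<in> curves_c c T \<and> (\<forall>AA. pc_approximating_sequence T A AA \<longrightarrow>
        (\<lambda>n. SUP t\<in>{0..T}. transport_cost c (\<sigma> t) (S0 c T \<rho>0 (AA n) t)) \<longlonglongrightarrow> 0)"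
    then have \<sigma>c: "\<sigma> \<in> curves_c c T"
      and lim: "(\<lambda>n. SUP t\<in>{0..T}. transport_cost c (\<sigma> t) (r n t)) \<longlonglongrightarrow> 0"
      using AA by (auto simp: r_def)
    have lim\<rho>: "(\<lambda>n. SUP t\<in>{0..T}. transport_cost c (\<rho> t) (r n t)) \<longlonglongrightarrow> 0"
      using conv[OF AA] by (simp add: r_def)
    show "\<sigma> = \<rho>"
    proof (rule curves_c_eqI[OF \<sigma>c \<rho>])
      fix t assume t: "t \<in> {0..T}"
      have "transport_cost c (\<sigma> t) (\<rho> t) \<le> 0"
      proof (rule ennreal_le_epsilon)
        fix e :: real assume e: "e > 0"
        define e' where "e' = e / (2 * B\<^sup>2)"
        have e': "e' > 0" "B\<^sup>2 * (e' + e') = e" using e B2 by (auto simp: e'_def)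
        have "\<forall>\<^sub>F n in sequentially. (SUP t\<in>{0..T}. transport_cost c (\<sigma> t) (r n t)) < ennreal e' \<and>
            (SUP t\<in>{0..T}. transport_cost c (\<rho> t) (r n t)) < ennreal e'"
          using lim lim\<rho> e'(1) unfolding tendsto_0_ennreal_iff by (intro eventually_conj) auto
        then obtain n where n: "(SUP t\<in>{0..T}. transport_cost c (\<sigma> t) (r n t)) < ennreal e'"
            "(SUP t\<in>{0..T}. transport_cost c (\<rho> t) (r n t)) < ennreal e'"
          using eventually_happens'[OF sequentially_bot] by blast
        have 1: "transport_cost c (\<sigma> t) (r n t) \<le> ennreal e'"
          by (rule order_trans[OF SUP_upper[OF t] less_imp_le[OF n(1)]])
        have 2: "transport_cost c (r n t) (\<rho> t) \<le> ennreal e'"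
          unfolding transport_cost_sym[of "r n t"]
          by (rule order_trans[OF SUP_upper[OF t] less_imp_le[OF n(2)]])
        have "transport_cost c (\<sigma> t) (\<rho> t) \<le> ennreal (B\<^sup>2 * (e' + e'))"
          by (rule transport_cost_triangle_ennreal[OF _ _ _ _ _ 1 2])
            (use e'(1) probs_cD[OF \<rho>p[OF t]] probs_cD[OF curves_cD(1)[OF r(1) t]]
              probs_cD[OF curves_cD(1)[OF \<sigma>c t]] in simp_all)
        then show "transport_cost c (\<sigma> t) (\<rho> t) \<le> 0 + ennreal e" unfolding e'(2) by simp
      qed
      then show "\<sigma> t = \<rho> t"
        by (intro transport_cost_0_imp_eq probs_cD \<rho>p t curves_cD(1)[OF \<sigma>c t]) simp
    qed
  qed
qed

end
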